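(* Let $t>0$ be a real number, let $R$ be a linear forest on $5$ vertices, and let $G$ be a $t$-tough $R$-free graph on at least $3$ vertices. Then $G$ has a $2$-factor provided that one of the following holds: (1) $R\in\{P_4\cup P_1,\ P_3\cup 2P_1,\ P_2\cup 3P_1\}$ and $t=1$, unless one of the following exceptional situations occurs: (a) $R=P_2\cup 3P_1$, and either $G\cong H_0$ or, for some $i\in\{1,2,3,4\}$, $G$ contains $H_i$ as a spanning subgraph such that $E(G)\setminus E(H_i)\subseteq E_G(S,V(G)\setminus(T\cup S))$; (b) $R=P_3\cup 2P_1$ and $G$ contains $H_1$ as a spanning subgraph such that $E(G)\setminus E(H_1)\subseteq E_G(S,V(G)\setminus(T\cup S))$. (2) $R=5P_1$ and $t>1$. (3) $R\in\{P_5,\ P_3\cup P_2,\ 2P_2\cup P_1\}$ and $t=3/2$.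
   Context: All graphs are finite, simple and undirected. $P_b$ is the path on $b$ vertices; $aP_b$ is the disjoint union of $a$ copies of $P_b$; unions such as $P_4\cup P_1$ are vertex-disjoint unions. A linear forest is a disjoint union of paths. $G$ is $R$-free if $G$ has no induced subgraph isomorphic to $R$. A $2$-factor is a $2$-regular spanning subgraph. $c(G)$ is the number of components of $G$; $G$ is $t$-tough if $t\cdot c(G-W)\le |W|$ for every cutset $W$ of $G$ (every $W\subseteq V(G)$ with $c(G-W)\ge 2$); in particular complete graphs are $t$-tough for every $t$. $E_G(A,B)$ is the set of edges of $G$ with one end in $A$ and the other in $B$ ($A,B$ disjoint). Graphs: - $H_0$ has vertices $t_1,t_2,t_3,v_1,\dots,v_6$; edges: the triangles $v_1v_2v_3$ and $v_4v_5v_6$, and $t_1v_1,t_1v_4,t_2v_2,t_2v_5,t_3v_3,t_3v_6$. - In $H_1,\dots,H_4$ we have $S=\{x\}$, $T=\{t_1,t_2,t_3\}$, and edges $xt_1,xt_2,xt_3$, together with the following. - $H_1$: further vertices $v_1,v_2,v_3$; edges of the triangle $v_1v_2v_3$ and $t_1v_1,t_2v_2,t_3v_3$. - $H_2,H_3,H_4$: further vertices $v_1,v_2,v_3,v_4$; edges $t_1v_3,t_2v_1,t_3v_2$; and on $\{v_1,v_2,v_3,v_4\}$: all six edges for $H_2$; all edges except $v_2v_3$ for $H_3$; exactly $v_1v_2,v_1v_4,v_2v_4,v_3v_4$ for $H_4$. "$G$ contains $H_i$ as a spanning subgraph" means a copy of $H_i$ in $G$ with the same vertex set as $G$; $S$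 and $T$ then denote the corresponding vertex sets in $G$. *)

theory Defs
  imports Complex_Main
begin

record 'a graph =
  verts :: "'a set"
  edges :: "'a set set"

definition simple_graph :: "'a graph \<Rightarrow> bool" where
  "simple_graph G \<longleftrightarrow>
     finite (verts G) \<and> (\<forall>e \<in> edges G. e \<subseteq> verts G \<and> card e = 2)"

definition graph_isomorphism :: "('a \<Rightarrow> 'b) \<Rightarrow> 'a graph \<Rightarrow> 'b graph \<Rightarrow> bool" where
  "graph_isomorphism f G H \<longleftrightarrow>
     bij_betw f (verts G) (verts H) \<and>
     (\<forall>u \<in> verts G. \<forall>v \<in> verts G. {u, v} \<in> edges G \<longleftrightarrow> {f u, f v} \<in> edges H)"

definition isomorphic :: "'a graph \<Rightarrow> 'b graph \<Rightarrow> bool"  (infix "\<simeq>" 50) where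
  "G \<simeq> H \<longleftrightarrow> (\<exists>f. graph_isomorphism f G H)"

definition induced_subgraph :: "'a graph \<Rightarrow> 'a set \<Rightarrow> 'a graph" where
  "induced_subgraph G W = \<lparr>verts = W, edges = {e \<in> edges G. e \<subseteq> W}\<rparr>"

definition induced_free :: "'b graph \<Rightarrow> 'a graph \<Rightarrow> bool" where
  "induced_free R G \<longleftrightarrow> \<not> (\<exists>W \<subseteq> verts G. induced_subgraph G W \<simeq> R)"

definition spanning_subgraph :: "'a graph \<Rightarrow> 'a graph \<Rightarrow> bool" where
  "spanning_subgraph H G \<longleftrightarrow>
     simple_graph H \<and> verts H = verts G \<and> edges H \<subseteq> edges G"

definition degree :: "'a graph \<Rightarrow> 'a \<Rightarrow> nat" where
  "degree G v = card {e \<in> edges G. v \<in> e}"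

definition has_two_factor :: "'a graph \<Rightarrow> bool" where
  "has_two_factor G \<longleftrightarrow>
     (\<exists>F. spanning_subgraph F G \<and> (\<forall>v \<in> verts F. degree F v = 2))"

definition connected_rel :: "'a graph \<Rightarrow> ('a \<times> 'a) set" where
  "connected_rel G =
     {(u, v). u \<in> verts G \<and> v \<in> verts G \<and> (u, v) \<in> {(x, y). {x, y} \<in> edges G}\<^sup>*}"

definition num_components :: "'a graph \<Rightarrow> nat" where
  "num_components G = card (verts G // connected_rel G)"

definition tough :: "real \<Rightarrow> 'a graph \<Rightarrow> bool" where
  "tough t G \<longleftrightarrow>
     (\<forall>W \<subseteq> verts G. num_components (induced_subgraph G (verts G - W)) \<ge> 2 \<longrightarrow>
        t * real (num_components (induced_subgraph G (verts G - W))) \<le> real (card W))"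

definition edges_between :: "'a graph \<Rightarrow> 'a set \<Rightarrow> 'a set \<Rightarrow> 'a set set" where
  "edges_between G A B = {e \<in> edges G. \<exists>a \<in> A. \<exists>b \<in> B. e = {a, b}}"

definition path_graph :: "nat \<Rightarrow> nat graph" where
  "path_graph b = \<lparr>verts = {..<b}, edges = {{j, Suc j} | j. Suc j < b}\<rparr>"

text \<open>The members of the list are made vertex-disjoint by tagging each vertex with its
  position in the list.\<close>

definition disjoint_union :: "'a graph list \<Rightarrow> (nat \<times> 'a) graph" where
  "disjoint_union Gs =
     \<lparr>verts = (\<Union>i<length Gs. Pair i ` verts (Gs ! i)),
      edges = (\<Union>i<length Gs. (`) (Pair i) ` edges (Gs ! i))\<rparr>"

definition linear_forest :: "'a graph \<Rightarrow> bool" where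
  "linear_forest R \<longleftrightarrow>
     simple_graph R \<and>
     (\<exists>bs. (\<forall>b \<in> set bs. b \<ge> 1) \<and> R \<simeq> disjoint_union (map path_graph bs))"

datatype hvertex = X | T nat | V nat

definition H0 :: "hvertex graph" where
  "H0 = \<lparr>verts = {T 1, T 2, T 3, V 1, V 2, V 3, V 4, V 5, V 6},
         edges = {{V 1, V 2}, {V 2, V 3}, {V 1, V 3},
                  {V 4, V 5}, {V 5, V 6}, {V 4, V 6},
                  {T 1, V 1}, {T 1, V 4}, {T 2, V 2}, {T 2, V 5}, {T 3, V 3}, {T 3, V 6}}\<rparr>"

definition H1 :: "hvertex graph" where
  "H1 = \<lparr>verts = {X, T 1, T 2, T 3, V 1, V 2, V 3},
         edges = {{X, T 1}, {X, T 2}, {X, T 3},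
                  {V 1, V 2}, {V 2, V 3}, {V 1, V 3},
                  {T 1, V 1}, {T 2, V 2}, {T 3, V 3}}\<rparr>"

definition H2 :: "hvertex graph" where
  "H2 = \<lparr>verts = {X, T 1, T 2, T 3, V 1, V 2, V 3, V 4},
         edges = {{X, T 1}, {X, T 2}, {X, T 3},
                  {T 1, V 3}, {T 2, V 1}, {T 3, V 2},
                  {V 1, V 2}, {V 1, V 3}, {V 1, V 4}, {V 2, V 3}, {V 2, V 4}, {V 3, V 4}}\<rparr>"

definition H3 :: "hvertex graph" where
  "H3 = \<lparr>verts = {X, T 1, T 2, T 3, V 1, V 2, V 3, V 4},
         edges = {{X, T 1}, {X, T 2}, {X, T 3},
                  {T 1, V 3}, {T 2, V 1}, {T 3, V 2},
                  {V 1, V 2}, {V 1, V 3}, {V 1, V 4}, {V 2, V 4}, {V 3, V 4}}\<rparr>"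

definition H4 :: "hvertex graph" where
  "H4 = \<lparr>verts = {X, T 1, T 2, T 3, V 1, V 2, V 3, V 4},
         edges = {{X, T 1}, {X, T 2}, {X, T 3},
                  {T 1, V 3}, {T 2, V 1}, {T 3, V 2},
                  {V 1, V 2}, {V 1, V 4}, {V 2, V 4}, {V 3, V 4}}\<rparr>"

text \<open>\<open>K\<close> is the spanning copy of \<open>H\<close> in \<open>G\<close>; the sets \<open>S = {x}\<close> and
  \<open>T = {t\<^sub>1, t\<^sub>2, t\<^sub>3}\<close> in \<open>G\<close> are the images under the isomorphism \<open>f\<close>
  from \<open>H\<close> onto \<open>K\<close>.\<close>

definition exceptional_for :: "hvertex graph \<Rightarrow> 'a graph \<Rightarrow> bool" where
  "exceptional_for H G \<longleftrightarrow>
     (\<exists>K f. spanning_subgraph K G \<and> graph_isomorphism f H K \<and>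
        (let S' = f ` {X}; T' = f ` {T 1, T 2, T 3}
         in edges G - edges K \<subseteq> edges_between G S' (verts G - (T' \<union> S'))))"

end

theory Submission
  imports Defs
begin

text \<open>
  Suppose that a tough graph has no 2-factor. Tutte's 2-factor theorem then yields disjoint
  vertex sets \<open>S\<close> and \<open>R\<close> witnessing this, and extremal choices give the pair a rigid shape
  (locale \<open>tutte_barrier\<close>): \<open>R\<close> is independent; between \<open>R\<close> and a component \<open>C\<close> of the graph
  induced on the remaining vertices the edges form a matching, whose size \<open>e(C)\<close> is zero or
  odd; and \<open>2|S| + \<Sum>(e(C) - 1) + 2 \<le> 2|R|\<close>, the sum running over the components with
  \<open>e(C) > 0\<close>. On the other hand, delete \<open>S\<close> and, in every component, the ends of all but
  one of the edges to \<open>R\<close>. Then the vertices of \<open>R\<close> lie in different components, so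
  \<open>t\<close>-toughness gives \<open>t|R| \<le> |S| + \<Sum>(e(C) - 1)\<close>. The two inequalities force a component
  with \<open>e(C) \<ge> 3\<close>.

  The forbidden linear forests are then found around such a component, inside the union of
  \<open>R\<close> and the components attached to it. For \<open>t > 1\<close>
  the inequalities and a degree count give \<open>|R| \<ge> 5\<close>, hence \<open>5P\<^sub>1\<close>. For \<open>t = 3/2\<close> they give
  two components with \<open>e(C) \<ge> 3\<close> that share a vertex of \<open>R\<close>, hence the three forests of
  that case. For \<open>t = 1\<close> the forest \<open>P\<^sub>4 \<union> P\<^sub>1\<close> is always present, and the other two are
  present when \<open>|R| \<ge> 4\<close>. If \<open>|R| = 3\<close>, then either \<open>S\<close> is empty and two components are
  joined to all of \<open>R\<close>, or \<open>S\<close> is a single vertex and exactly one component is; toughness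
  and the absence of the forest then leave only the exceptional graphs, up to the edges
  at \<open>S\<close>.

  The barrier is obtained from Tutte's theorem on perfect matchings, applied to a gadget graph
  whose perfect matchings encode the 2-factors (\<open>two_regular_of_matchable_gadget\<close>). A
  set of gadget vertices with the largest surplus of odd components can be chosen so that it
  projects to a pair \<open>(S, R)\<close> of the required shape (\<open>two_factor_or_barrier\<close>). Tutte's theorem
  itself is proved by Lovasz's argument with an edge-maximal counterexample
  (\<open>matching_exchange\<close>, \<open>tutte_perfect_matching\<close>).
\<close>

section \<open>Components as minimal closed sets\<close>

definition closed_in :: "('b \<Rightarrow> 'b \<Rightarrow> bool) \<Rightarrow> 'b set \<Rightarrow> 'b set \<Rightarrow> bool" where
  "closed_in r U D \<longleftrightarrow> D \<subseteq> U \<and> (\<forall>x\<in>D. \<forall>y\<in>U. r x y \<longrightarrow> y \<in> D)"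

text \<open>When \<open>r\<close> is symmetric, the closed subsets of \<open>U\<close> form a Boolean algebra, and the
  components are its atoms. Working with closed sets avoids walks: a component is compared with a
  given set by checking that the set is closed.\<close>

definition comps :: "('b \<Rightarrow> 'b \<Rightarrow> bool) \<Rightarrow> 'b set \<Rightarrow> 'b set set" where
  "comps r U = {C. C \<noteq> {} \<and> closed_in r U C \<and>
     (\<forall>D. D \<noteq> {} \<longrightarrow> closed_in r U D \<longrightarrow> D \<subseteq> C \<longrightarrow> D = C)}"

definition odd_comps :: "('b \<Rightarrow> 'b \<Rightarrow> bool) \<Rightarrow> 'b set \<Rightarrow> 'b set set" where
  "odd_comps r U = {C \<in> comps r U. odd (card C)}"

definition comp_of :: "('b \<Rightarrow> 'b \<Rightarrow> bool) \<Rightarrow> 'b set \<Rightarrow> 'b \<Rightarrow> 'b set" where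
  "comp_of r U x = \<Inter>{D. closed_in r U D \<and> x \<in> D}"

lemma closed_in_Int: "closed_in r U C \<Longrightarrow> closed_in r U D \<Longrightarrow> closed_in r U (C \<inter> D)"
  unfolding closed_in_def by blast

lemma closed_in_Diff: "symp r \<Longrightarrow> closed_in r U C \<Longrightarrow> closed_in r U D \<Longrightarrow> closed_in r U (C - D)"
  unfolding closed_in_def by (blast dest: sympD)

lemma closed_in_self: "closed_in r U U"
  unfolding closed_in_def by blast

lemma comps_subset: "C \<in> comps r U \<Longrightarrow> C \<subseteq> U"
  unfolding comps_def closed_in_def by blast

lemma comps_closed: "C \<in> comps r U \<Longrightarrow> closed_in r U C"
  unfolding comps_def by blast

lemma comps_nonempty: "C \<in> comps r U \<Longrightarrow> C \<noteq> {}"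
  unfolding comps_def by blast

lemma comps_minimal:
  "C \<in> comps r U \<Longrightarrow> D \<noteq> {} \<Longrightarrow> closed_in r U D \<Longrightarrow> D \<subseteq> C \<Longrightarrow> D = C"
  unfolding comps_def by simp

lemma comps_le_closed:
  "C \<in> comps r U \<Longrightarrow> closed_in r U D \<Longrightarrow> C \<inter> D \<noteq> {} \<Longrightarrow> C \<subseteq> D"
  using closed_in_Int[of r U C D] comps_closed[of C r U] comps_minimal[of C r U "C \<inter> D"]
  by auto

lemma comps_eqI:
  "C \<in> comps r U \<Longrightarrow> D \<in> comps r U \<Longrightarrow> x \<in> C \<Longrightarrow> x \<in> D \<Longrightarrow> C = D"
  using comps_le_closed[of C r U D] comps_le_closed[of D r U C]
    comps_closed[of C r U] comps_closed[of D r U] by auto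

lemma finite_comps: "finite U \<Longrightarrow> finite (comps r U)"
  by (rule finite_subset[of _ "Pow U"]) (auto dest: comps_subset)

lemma finite_odd_comps: "finite U \<Longrightarrow> finite (odd_comps r U)"
  unfolding odd_comps_def using finite_comps by fastforce

lemma comp_of_self: "x \<in> comp_of r U x"
  unfolding comp_of_def by blast

text \<open>A closed set properly inside the least closed set around \<open>x\<close> would either contain \<open>x\<close> or
  leave a closed complement that contains \<open>x\<close>.\<close>

lemma comp_of_in_comps:
  assumes "symp r" "x \<in> U"
  shows "comp_of r U x \<in> comps r U"
proof -
  let ?C = "comp_of r U x"
  have ne: "{D. closed_in r U D \<and> x \<in> D} \<noteq> {}" using assms(2) closed_in_self by blast
  have cl: "closed_in r U ?C"
    using ne unfolding comp_of_def closed_in_def by blast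
  have "D = ?C" if D: "D \<noteq> {}" "closed_in r U D" "D \<subseteq> ?C" for D
  proof (cases "x \<in> D")
    case True
    then show ?thesis using D unfolding comp_of_def by blast
  next
    case False
    have "closed_in r U (?C - D)" by (rule closed_in_Diff[OF assms(1) cl D(2)])
    moreover have "x \<in> ?C - D" using False comp_of_self[of x r U] by blast
    ultimately have "?C \<subseteq> ?C - D" unfolding comp_of_def by blast
    then show ?thesis using D by blast
  qed
  then show ?thesis unfolding comps_def using cl comp_of_self[of x r U] by blast
qed

lemma comp_of_eq:
  "symp r \<Longrightarrow> C \<in> comps r U \<Longrightarrow> x \<in> C \<Longrightarrow> comp_of r U x = C"
  by (metis comp_of_in_comps comp_of_self comps_eqI comps_subset subsetD)

lemma closed_eq_Union_comps:
  assumes "symp r" "closed_in r U D"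
  shows "D = \<Union>{C \<in> comps r U. C \<subseteq> D}"
proof -
  have "x \<in> \<Union>{C \<in> comps r U. C \<subseteq> D}" if "x \<in> D" for x
  proof -
    have "x \<in> U" using that assms(2) unfolding closed_in_def by blast
    then have "comp_of r U x \<in> comps r U" using comp_of_in_comps assms(1) by metis
    moreover have "comp_of r U x \<subseteq> D" using that assms(2) unfolding comp_of_def by blast
    ultimately show ?thesis using comp_of_self[of x r U] by blast
  qed
  then show ?thesis by blast
qed

text \<open>A closed set is the disjoint union of the components inside it.\<close>

lemma card_closed_parity:
  assumes "symp r" "finite U" "closed_in r U D"
  shows "even (card D) \<longleftrightarrow> even (card {C \<in> odd_comps r U. C \<subseteq> D})"
proof -
  let ?F = "{C \<in> comps r U. C \<subseteq> D}"
  have fin: "finite ?F" using finite_comps[OF assms(2)] by simp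
  have finC: "\<And>C. C \<in> ?F \<Longrightarrow> finite C"
    using finite_subset[OF comps_subset[of _ r] assms(2)] by simp
  have "card D = card (\<Union>?F)" using closed_eq_Union_comps[OF assms(1,3)] by simp
  also have "\<dots> = (\<Sum>C\<in>?F. card C)"
    by (rule card_Union_disjoint) (auto simp: pairwise_def disjnt_def finC dest: comps_eqI)
  finally have "even (card D) \<longleftrightarrow> even (card {C \<in> ?F. odd (card C)})"
    using even_sum_iff[OF fin, of card] by simp
  moreover have "{C \<in> ?F. odd (card C)} = {C \<in> odd_comps r U. C \<subseteq> D}"
    unfolding odd_comps_def by blast
  ultimately show ?thesis by simp
qed

lemma card_odd_comps_parity:
  assumes "symp r" "finite U"
  shows "even (card U) \<longleftrightarrow> even (card (odd_comps r U))"
proof -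
  have "{C \<in> odd_comps r U. C \<subseteq> U} = odd_comps r U"
    unfolding odd_comps_def using comps_subset by blast
  then show ?thesis using card_closed_parity[OF assms closed_in_self] by simp
qed

text \<open>Every odd closed set contains an odd component. This bounds the number of odd components from
  below without proving that any set is connected.\<close>

lemma card_odd_closed_family_le:
  assumes "symp r" "finite U"
    and "\<And>i. i \<in> I \<Longrightarrow> closed_in r U (D i)"
    and "\<And>i. i \<in> I \<Longrightarrow> odd (card (D i))"
    and "\<And>i j. i \<in> I \<Longrightarrow> j \<in> I \<Longrightarrow> i \<noteq> j \<Longrightarrow> D i \<inter> D j = {}"
  shows "card I \<le> card (odd_comps r U)"
proof -
  have "\<exists>C. C \<in> odd_comps r U \<and> C \<subseteq> D i" if "i \<in> I" for i
  proof -
    have "odd (card {C \<in> odd_comps r U. C \<subseteq> D i})"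
      using card_closed_parity[OF assms(1,2) assms(3)[OF that]] assms(4)[OF that] by simp
    then have "{C \<in> odd_comps r U. C \<subseteq> D i} \<noteq> {}" by (rule odd_card_imp_not_empty)
    then show ?thesis by blast
  qed
  then obtain g where g: "\<And>i. i \<in> I \<Longrightarrow> g i \<in> odd_comps r U \<and> g i \<subseteq> D i" by metis
  have "inj_on g I"
  proof (rule inj_onI)
    fix i j assume ij: "i \<in> I" "j \<in> I" "g i = g j"
    have "g i \<noteq> {}" using g[OF ij(1)] comps_nonempty unfolding odd_comps_def by blast
    then show "i = j" using assms(5)[OF ij(1,2)] g[OF ij(1)] g[OF ij(2)] ij(3) by blast
  qed
  then show ?thesis
    by (rule card_inj_on_le) (use g finite_odd_comps[OF assms(2)] in auto)
qed

text \<open>Odd components that are not adjacent to a set \<open>B\<close> survive when \<open>B\<close> is put back; this is how the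
  effect of shrinking a barrier is estimated.\<close>

lemma comps_enlarge:
  assumes "C \<in> comps r U" and "\<And>x y. x \<in> C \<Longrightarrow> y \<in> B \<Longrightarrow> \<not> r x y"
  shows "C \<in> comps r (U \<union> B)"
proof -
  have "closed_in r (U \<union> B) C"
    using assms comps_closed[OF assms(1)] unfolding closed_in_def by blast
  moreover have "D = C" if "D \<noteq> {}" "closed_in r (U \<union> B) D" "D \<subseteq> C" for D
  proof -
    have "closed_in r U D"
      using that comps_subset[OF assms(1)] unfolding closed_in_def by blast
    then show ?thesis using comps_minimal[OF assms(1)] that by simp
  qed
  ultimately show ?thesis using comps_nonempty[OF assms(1)] unfolding comps_def by blast
qed

section \<open>Tutte's theorem on perfect matchings\<close>

text \<open>The function maps every vertex to its partner, so matchings are merged and exchanged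
  pointwise.\<close>

definition perfect_matching :: "('b \<Rightarrow> 'b \<Rightarrow> bool) \<Rightarrow> 'b set \<Rightarrow> ('b \<Rightarrow> 'b) \<Rightarrow> bool" where
  "perfect_matching r N f \<longleftrightarrow> (\<forall>x\<in>N. f x \<in> N \<and> f (f x) = x \<and> r x (f x))"

definition matchable :: "('b \<Rightarrow> 'b \<Rightarrow> bool) \<Rightarrow> 'b set \<Rightarrow> bool" where
  "matchable r N \<longleftrightarrow> (\<exists>f. perfect_matching r N f)"

lemma even_card_involution:
  assumes "finite K" "\<And>x. x \<in> K \<Longrightarrow> f x \<in> K \<and> f (f x) = x \<and> f x \<noteq> x"
  shows "even (card K)"
  using assms
proof (induction K rule: finite_psubset_induct)
  case (psubset K)
  show ?case
  proof (cases "K = {}")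
    case False
    then obtain x where x: "x \<in> K" by blast
    let ?K = "K - {x, f x}"
    have fx: "f x \<in> K" "f (f x) = x" "f x \<noteq> x" using psubset.prems[OF x] by auto
    have "even (card ?K)"
    proof (rule psubset.IH)
      show "?K \<subset> K" using x by blast
      show "f y \<in> ?K \<and> f (f y) = y \<and> f y \<noteq> y" if "y \<in> ?K" for y
        using psubset.prems[of y] that fx by auto
    qed
    moreover have "card K = card ?K + 2"
      using card_Diff_subset[of "{x, f x}" K] x fx psubset.hyps
        card_mono[of K "{x, f x}"] by (auto simp: card_insert_if)
    ultimately show ?thesis by simp
  qed simp
qed

lemma matchable_even: "finite N \<Longrightarrow> irreflp r \<Longrightarrow> matchable r N \<Longrightarrow> even (card N)"
  unfolding matchable_def perfect_matching_def
  by (metis even_card_involution irreflpD)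

lemma matchable_empty: "matchable r {}"
  unfolding matchable_def perfect_matching_def by simp

lemma matchable_Un:
  assumes "matchable r N" "matchable r W" "N \<inter> W = {}"
  shows "matchable r (N \<union> W)"
proof -
  obtain f g where f: "perfect_matching r N f" and g: "perfect_matching r W g"
    using assms unfolding matchable_def by blast
  have "perfect_matching r (N \<union> W) (\<lambda>x. if x \<in> N then f x else g x)"
    using f g assms(3) unfolding perfect_matching_def by (auto; metis disjoint_iff)
  then show ?thesis unfolding matchable_def by blast
qed

lemma matchable_pair:
  assumes "symp r" "r x y"
  shows "matchable r {x, y}"
proof -
  have "perfect_matching r {x, y} (\<lambda>z. if z = x then y else x)"
    using assms unfolding perfect_matching_def by (auto dest: sympD)
  then show ?thesis unfolding matchable_def by blast
qed

lemma matchable_insert_pair: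
  assumes "symp r" "matchable r P" "r x y" "x \<notin> P" "y \<notin> P"
  shows "matchable r (insert x (insert y P))"
  using matchable_Un[OF matchable_pair[OF assms(1,3)] assms(2)] assms(4,5) by simp

lemma matchable_complete:
  assumes "symp r" "finite A" "even (card A)" "\<And>x y. x \<in> A \<Longrightarrow> y \<in> A \<Longrightarrow> x \<noteq> y \<Longrightarrow> r x y"
  shows "matchable r A"
  using assms(2-4)
proof (induction A rule: finite_psubset_induct)
  case (psubset A)
  show ?case
  proof (cases "A = {}")
    case True
    then show ?thesis by (simp add: matchable_empty)
  next
    case False
    then obtain x where x: "x \<in> A" by blast
    have "A \<noteq> {x}" using psubset.prems(1) by auto
    then obtain y where y: "y \<in> A" "y \<noteq> x" using x by blast
    let ?A = "A - {x, y}"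
    have "card A = card ?A + 2"
      using card_Diff_subset[of "{x, y}" A] x y psubset.hyps
        card_mono[of A "{x, y}"] by (auto simp: card_insert_if)
    then have "matchable r ?A"
      using psubset.IH[of ?A] psubset.prems x by auto
    then have "matchable r (insert x (insert y ?A))"
      using matchable_insert_pair[OF assms(1), of ?A x y] psubset.prems(2) x y by auto
    moreover have "insert x (insert y ?A) = A" using x y by blast
    ultimately show ?thesis by simp
  qed
qed

text \<open>Give each vertex of \<open>L\<close> its own partner in \<open>A\<close>; what is left of \<open>A\<close> is complete and even.\<close>

lemma matchable_dominated:
  assumes "symp r" "finite L" "finite A" "A \<inter> L = {}" "card L \<le> card A" "even (card A + card L)"
    and "\<And>x y. x \<in> A \<Longrightarrow> y \<in> A \<union> L \<Longrightarrow> x \<noteq> y \<Longrightarrow> r x y"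
  shows "matchable r (A \<union> L)"
  using assms(2-)
proof (induction L arbitrary: A rule: finite_induct)
  case empty
  then show ?case using matchable_complete[OF assms(1), of A] by simp
next
  case (insert l L)
  then have "A \<noteq> {}" by auto
  then obtain a where a: "a \<in> A" by blast
  have cA: "card A = Suc (card (A - {a}))" using a insert.prems(1) by (metis card.remove)
  have "matchable r ((A - {a}) \<union> L)"
  proof (rule insert.IH)
    show "card L \<le> card (A - {a})" "even (card (A - {a}) + card L)"
      using insert.prems(3,4) insert.hyps unfolding cA by simp_all
    show "finite (A - {a})" "(A - {a}) \<inter> L = {}" using insert.prems(1,2) by auto
    show "r x y" if "x \<in> A - {a}" "y \<in> A - {a} \<union> L" "x \<noteq> y" for x y
      using insert.prems(5)[of x y] that by blast
  qed
  then have "matchable r (insert a (insert l ((A - {a}) \<union> L)))"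
  proof (rule matchable_insert_pair[OF assms(1)])
    show "r a l" using insert.prems(2) insert.prems(5)[of a l] a by auto
    show "a \<notin> A - {a} \<union> L" "l \<notin> A - {a} \<union> L" using insert.prems(2) insert.hyps a by auto
  qed
  moreover have "insert a (insert l ((A - {a}) \<union> L)) = A \<union> insert l L" using a by blast
  ultimately show ?case by simp
qed

text \<open>The exchange step of Lovasz's proof. Start at \<open>d\<close> and alternately follow \<open>f\<close> and \<open>g\<close>. If
  the walk never meets \<open>a\<close> or \<open>c\<close>, it closes up into a set containing the pair \<open>b, d\<close>, on which
  \<open>f\<close> may replace \<open>g\<close>. Otherwise stop at the first visit \<open>e\<close> to \<open>{a, c}\<close>: before \<open>e\<close> use \<open>f\<close>,
  match \<open>e\<close> with \<open>b\<close>, and use \<open>g\<close> elsewhere. Either way both added pairs are avoided.\<close>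

lemma matching_exchange:
  fixes r :: "'b \<Rightarrow> 'b \<Rightarrow> bool"
  assumes fin: "finite N" and sym: "symp r" and irr: "irreflp r"
    and N: "a \<in> N" "b \<in> N" "c \<in> N" "d \<in> N"
    and ab: "r a b" and bc: "r b c" and ac: "a \<noteq> c" and bd: "\<not> r b d" "b \<noteq> d"
    and f: "perfect_matching (\<lambda>x y. r x y \<or> {x, y} = {a, c}) N f"
    and g: "perfect_matching (\<lambda>x y. r x y \<or> {x, y} = {b, d}) N g"
  shows "matchable r N"
proof (cases "f a = c \<and> g b = d")
  case False
  then consider "f a \<noteq> c" | "g b \<noteq> d" by blast
  then show ?thesis
  proof cases
    case 1
    then have "perfect_matching r N f"
      using f unfolding perfect_matching_def by (metis doubleton_eq_iff)
    then show ?thesis unfolding matchable_def by blast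
  next
    case 2
    then have "perfect_matching r N g"
      using g unfolding perfect_matching_def by (metis doubleton_eq_iff)
    then show ?thesis unfolding matchable_def by blast
  qed
next
  case True
  then have fa: "f a = c" and gb: "g b = d" by auto
  have fV: "\<And>x. x \<in> N \<Longrightarrow> f x \<in> N" and ff: "\<And>x. x \<in> N \<Longrightarrow> f (f x) = x"
    and fr: "\<And>x. x \<in> N \<Longrightarrow> x \<noteq> a \<Longrightarrow> x \<noteq> c \<Longrightarrow> r x (f x)"
    using f unfolding perfect_matching_def by (auto simp: doubleton_eq_iff)
  have gV: "\<And>x. x \<in> N \<Longrightarrow> g x \<in> N" and gg: "\<And>x. x \<in> N \<Longrightarrow> g (g x) = x"
    and gr: "\<And>x. x \<in> N \<Longrightarrow> x \<noteq> b \<Longrightarrow> x \<noteq> d \<Longrightarrow> r x (g x)"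
    using g unfolding perfect_matching_def by (auto simp: doubleton_eq_iff)
  have fc: "f c = a" using fa ff N by metis
  have gd: "g d = b" using gb gg N by metis
  have fne: "f x \<noteq> x" if "x \<in> N" for x
    using fr[OF that] irr fa fc ac by (metis irreflpD)
  have gne: "g x \<noteq> x" if "x \<in> N" for x
    using gr[OF that] irr gb gd bd by (metis irreflpD)
  have dac: "d \<noteq> a" "d \<noteq> c" using ab bc bd sym by (metis sympD)+
  have bac: "b \<noteq> a" "b \<noteq> c" using ab bc irr by (metis irreflpD)+
  define p where "p i = ((g \<circ> f) ^^ i) d" for i
  have p0: "p 0 = d" and pS: "\<And>i. p (Suc i) = g (f (p i))" unfolding p_def by simp_all
  have pV: "p i \<in> N" for i by (induction i) (auto simp: p0 pS N fV gV)
  have gpS: "g (p (Suc i)) = f (p i)" for i using gg fV pV pS by metis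
  define L where "L I = p ` I \<union> (\<lambda>i. f (p i)) ` I" for I
  have LV: "L I \<subseteq> N" for I unfolding L_def using pV fV by blast
  have Lfin: "finite (L I)" for I using LV fin finite_subset by blast
  have Lf: "f x \<in> L I" if "x \<in> L I" for x I
    using that unfolding L_def using ff pV by auto
  have Lac: "x \<noteq> a \<and> x \<noteq> c" if "x \<in> L I" "\<And>i. i \<in> I \<Longrightarrow> p i \<notin> {a, c}" for x I
  proof -
    from that(1) obtain i where i: "i \<in> I" "x = p i \<or> x = f (p i)" unfolding L_def by blast
    have "p i \<noteq> a" "p i \<noteq> c" using that(2)[OF i(1)] by auto
    then have "f (p i) \<noteq> a" "f (p i) \<noteq> c" using ff[OF pV, of i] fa fc by auto
    then show ?thesis using i(2) \<open>p i \<noteq> a\<close> \<open>p i \<noteq> c\<close> by blast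
  qed
  have Leven: "even (card (L I))" for I
    by (rule even_card_involution[of _ f, OF Lfin]) (use Lf LV ff fne in blast)
  show ?thesis
  proof (cases "\<exists>i. p i \<in> {a, c}")
    case False
    define K where "K = L UNIV"
    have Kac: "a \<notin> K" "c \<notin> K"
      using Lac[of _ UNIV] False unfolding K_def by blast+
    have dK: "d \<in> K" unfolding K_def L_def using p0 by (metis UnI1 rangeI)
    have Kg: "g x \<in> K" if xK: "x \<in> K" and xd: "x \<noteq> d" for x
    proof -
      from xK obtain i where "x = p i \<or> x = f (p i)" unfolding K_def L_def by blast
      then show ?thesis
      proof
        assume x: "x = p i"
        then obtain j where "i = Suc j" using xd p0 by (cases i) auto
        then show ?thesis using x gpS unfolding K_def L_def by auto
      next
        assume "x = f (p i)"
        then show ?thesis using pS[of i] unfolding K_def L_def by (metis UnI1 rangeI)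
      qed
    qed
    \<comment> \<open>Otherwise \<open>g\<close> would pair up \<open>K\<close> without \<open>d\<close>, while \<open>f\<close> pairs up all of \<open>K\<close>.\<close>
    have bK: "b \<in> K"
    proof (rule ccontr)
      assume nb: "b \<notin> K"
      have "even (card (K - {d}))"
      proof (rule even_card_involution[of _ g])
        show "finite (K - {d})" using Lfin unfolding K_def by simp
        show "g x \<in> K - {d} \<and> g (g x) = x \<and> g x \<noteq> x" if "x \<in> K - {d}" for x
        proof -
          have "x \<in> N" using that LV unfolding K_def by blast
          moreover have "g x \<noteq> d" using nb gd gg \<open>x \<in> N\<close> that by (metis DiffD1)
          ultimately show ?thesis using Kg that gg gne by blast
        qed
      qed
      moreover have "even (card K)" unfolding K_def by (rule Leven)
      moreover have "card K = Suc (card (K - {d}))"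
        using dK Lfin unfolding K_def by (metis card.remove)
      ultimately show False by simp
    qed
    have Kg': "g x \<in> K" if "x \<in> K" for x using Kg[OF that] bK gd by metis
    have "perfect_matching r N (\<lambda>x. if x \<in> K then f x else g x)"
      unfolding perfect_matching_def
    proof
      fix x assume x: "x \<in> N"
      show "(if x \<in> K then f x else g x) \<in> N \<and>
         (if (if x \<in> K then f x else g x) \<in> K then f (if x \<in> K then f x else g x)
          else g (if x \<in> K then f x else g x)) = x \<and> r x (if x \<in> K then f x else g x)"
      proof (cases "x \<in> K")
        case True
        then have "f x \<in> K" using Lf unfolding K_def by blast
        then show ?thesis using True x fV ff fr Kac by auto
      next
        case False
        then have "g x \<notin> K" using Kg' gg x by metis
        moreover have "r x (g x)" using gr[OF x] False bK dK by blast
        ultimately show ?thesis using False x gV gg by auto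
      qed
    qed
    then show ?thesis unfolding matchable_def by blast
  next
    case True
    define n where "n = (LEAST i. p i \<in> {a, c})"
    define e where "e = p n"
    have e: "e \<in> {a, c}" unfolding n_def e_def by (rule LeastI_ex[OF True])
    have less: "p i \<notin> {a, c}" if "i < n" for i using that not_less_Least unfolding n_def by blast
    have n0: "n \<noteq> 0"
    proof
      assume "n = 0"
      then show False using e p0 dac unfolding e_def by simp
    qed
    define K where "K = L {..<n}"
    have Kac: "a \<notin> K" "c \<notin> K"
      using Lac[of _ "{..<n}"] less unfolding K_def by blast+
    have eK: "e \<notin> K" using e Kac by blast
    have dK: "d \<in> K" unfolding K_def L_def using p0 n0 by force
    have re: "r e b" "e \<noteq> b" "e \<in> N" using e ab bc sym bac N by (auto dest: sympD)
    have ed: "e \<noteq> d" using e dac by blast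
    have Kg: "g x \<in> K \<union> {e}" if xK: "x \<in> K" and xd: "x \<noteq> d" for x
    proof -
      from xK obtain i where i: "i < n" "x = p i \<or> x = f (p i)"
        unfolding K_def L_def by blast
      from i(2) show ?thesis
      proof
        assume x: "x = p i"
        then obtain j where "i = Suc j" using xd p0 by (cases i) auto
        then show ?thesis using x gpS i(1) unfolding K_def L_def by auto
      next
        assume x: "x = f (p i)"
        then have "g x = p (Suc i)" using pS by simp
        moreover have "Suc i < n \<or> Suc i = n" using i(1) by linarith
        ultimately show ?thesis unfolding K_def L_def e_def by auto
      qed
    qed
    have ge: "g e \<in> K"
    proof -
      obtain m where "n = Suc m" using n0 by (cases n) auto
      then show ?thesis using gpS unfolding e_def K_def L_def by auto
    qed
    \<comment> \<open>Otherwise \<open>g\<close> would pair up \<open>K\<close> together with \<open>e\<close>, while \<open>f\<close> pairs up \<open>K\<close>.\<close>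
    have bK: "b \<notin> K"
    proof
      assume b: "b \<in> K"
      have "even (card (insert e K))"
      proof (rule even_card_involution[of _ g])
        show "finite (insert e K)" using Lfin unfolding K_def by simp
        show "g x \<in> insert e K \<and> g (g x) = x \<and> g x \<noteq> x" if "x \<in> insert e K" for x
        proof -
          have "x \<in> N" using that LV re unfolding K_def by blast
          moreover have "g x \<in> insert e K" using that ge Kg gd b by (cases "x = d") auto
          ultimately show ?thesis using gg gne by blast
        qed
      qed
      moreover have "even (card K)" unfolding K_def by (rule Leven)
      ultimately show False using eK Lfin unfolding K_def by simp
    qed
    define M where "M = insert e (insert b K)"
    have MV: "M \<subseteq> N" using LV re N unfolding M_def K_def by blast
    have Mg: "g x \<in> M" if "x \<in> M" for x
      using that ge Kg gb gd dK unfolding M_def by (cases "x = d") auto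
    have "matchable r K"
      unfolding matchable_def perfect_matching_def
      using Lf LV ff fr Kac unfolding K_def by blast
    then have "matchable r M"
      unfolding M_def using matchable_insert_pair[OF sym] re eK bK by blast
    moreover have "matchable r (N - M)"
    proof -
      have "g x \<in> N - M \<and> g (g x) = x \<and> r x (g x)" if "x \<in> N - M" for x
      proof -
        have x: "x \<in> N" "x \<notin> M" using that by auto
        have "g x \<notin> M" using Mg gg[OF x(1)] x(2) by metis
        moreover have "x \<noteq> b" "x \<noteq> d" using x(2) dK unfolding M_def by auto
        ultimately show ?thesis using gV gg gr x by blast
      qed
      then show ?thesis unfolding matchable_def perfect_matching_def by blast
    qed
    moreover have "M \<union> (N - M) = N" using MV by blast
    ultimately show ?thesis using matchable_Un[of r M "N - M"] by auto
  qed
qed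

text \<open>A component for the larger relation is closed for the smaller one.\<close>

lemma odd_comps_antimono:
  assumes "symp r" "finite U" "\<And>x y. r x y \<Longrightarrow> s x y"
  shows "card (odd_comps s U) \<le> card (odd_comps r U)"
proof (rule card_odd_closed_family_le[of r U _ "\<lambda>C. C", OF assms(1,2)])
  show "closed_in r U C" if "C \<in> odd_comps s U" for C
    using that assms(3) unfolding odd_comps_def comps_def closed_in_def by blast
  show "odd (card C)" if "C \<in> odd_comps s U" for C
    using that unfolding odd_comps_def by blast
  show "C \<inter> D = {}" if "C \<in> odd_comps s U" "D \<in> odd_comps s U" "C \<noteq> D" for C D
    using that comps_eqI[of C s U D] unfolding odd_comps_def by blast
qed

text \<open>A maximal matching inside the cliques of \<open>N - A\<close> leaves an independent set \<open>L\<close>. The clique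
  around a leftover vertex is matched internally apart from that vertex, so it is odd; hence
  \<open>|L| \<le> |A|\<close>, and the leftover vertices can be matched into \<open>A\<close>.\<close>

lemma matchable_if_clique_components:
  assumes fin: "finite N" and sym: "symp r" and irr: "irreflp r"
    and AV: "A \<subseteq> N" and dom: "\<And>x y. x \<in> A \<Longrightarrow> y \<in> N \<Longrightarrow> x \<noteq> y \<Longrightarrow> r x y"
    and tr: "\<And>x y z. x \<in> N - A \<Longrightarrow> y \<in> N - A \<Longrightarrow> z \<in> N - A \<Longrightarrow> r x y \<Longrightarrow> r y z \<Longrightarrow> x \<noteq> z \<Longrightarrow> r x z"
    and ev: "even (card N)" and bar: "card (odd_comps r (N - A)) \<le> card A"
  shows "matchable r N"
proof -
  let ?U = "N - A"
  have finU: "finite ?U" using fin by simp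
  let ?\<P> = "{P. P \<subseteq> ?U \<and> matchable r P}"
  have "finite ?\<P>" using finU by simp
  moreover have "{} \<in> ?\<P>" by (simp add: matchable_empty)
  ultimately obtain P where P: "P \<in> ?\<P>" "\<And>Q. Q \<in> ?\<P> \<Longrightarrow> P \<subseteq> Q \<Longrightarrow> Q = P"
    using finite_has_maximal2[of ?\<P> "{}"] by metis
  define L where "L = ?U - P"
  have Lind: "\<not> r x y" if "x \<in> L" "y \<in> L" for x y
  proof
    assume "r x y"
    then have "matchable r (insert x (insert y P))"
      using matchable_insert_pair[OF sym, of P x y] P(1) that unfolding L_def by simp
    then show False using P(1) P(2)[of "insert x (insert y P)"] that unfolding L_def by auto
  qed
  obtain f where f: "perfect_matching r P f" using P(1) unfolding matchable_def by blast
  define K where "K x = {y \<in> ?U. y = x \<or> r x y}" for x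
  have finK: "finite (K x)" for x
    by (rule finite_subset[OF _ finU]) (auto simp: K_def)
  have "card L \<le> card (odd_comps r ?U)"
  proof (rule card_odd_closed_family_le[of r _ _ K, OF sym finU])
    show "closed_in r ?U (K x)" if "x \<in> L" for x
      using that tr sym unfolding closed_in_def K_def L_def by (auto dest: sympD)
    show "odd (card (K x))" if "x \<in> L" for x
    proof -
      have xU: "x \<in> ?U" "x \<notin> P" using that unfolding L_def by auto
      have "even (card (K x - {x}))"
      proof (rule even_card_involution[of _ f])
        show "finite (K x - {x})" using finK by simp
        fix y assume y: "y \<in> K x - {x}"
        then have ry: "r x y" "y \<in> ?U" unfolding K_def by auto
        then have yP: "y \<in> P" using Lind[OF that] unfolding L_def by blast
        then have fy: "f y \<in> P" "f (f y) = y" "r y (f y)"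
          using f unfolding perfect_matching_def by auto
        have "f y \<in> ?U" "f y \<noteq> x" using fy(1) P(1) xU by auto
        then have "r x (f y)" using tr[of x y "f y"] xU ry fy by auto
        then show "f y \<in> K x - {x} \<and> f (f y) = y \<and> f y \<noteq> y"
          using fy \<open>f y \<in> ?U\<close> \<open>f y \<noteq> x\<close> irr unfolding K_def by (auto dest: irreflpD)
      qed
      moreover have "card (K x) = Suc (card (K x - {x}))"
        using xU finK by (intro card.remove) (auto simp: K_def)
      ultimately show ?thesis by simp
    qed
    show "K x \<inter> K y = {}" if xy: "x \<in> L" "y \<in> L" "x \<noteq> y" for x y
    proof (rule ccontr)
      assume "K x \<inter> K y \<noteq> {}"
      then obtain z where z: "z \<in> K x" "z \<in> K y" by blast
      have "z \<in> ?U" "x \<in> ?U" "y \<in> ?U" using z xy unfolding K_def L_def by auto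
      then have "r x y" using z tr[of x z y] sym xy unfolding K_def by (auto dest: sympD)
      then show False using Lind xy by blast
    qed
  qed
  then have le: "card L \<le> card A" using bar by simp
  have disj: "A \<inter> L = {}" "P \<inter> (A \<union> L) = {}" using P(1) unfolding L_def by auto
  have Veq: "N = P \<union> (A \<union> L)" using P(1) AV unfolding L_def by blast
  have finA: "finite A" "finite L" "finite P"
    using fin AV P(1) finite_subset unfolding L_def by auto
  have "even (card P)" using matchable_even[OF finA(3) irr] P(1) by blast
  moreover have "card N = card P + (card A + card L)"
    unfolding Veq using disj finA by (simp add: card_Un_disjoint)
  ultimately have "even (card A + card L)" using ev by simp
  then have "matchable r (A \<union> L)"
    by (intro matchable_dominated[OF sym finA(2,1) disj(1) le]) (use dom AV Veq in auto)
  then show ?thesis using matchable_Un[of r P "A \<union> L"] P(1) disj(2) Veq by auto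
qed

text \<open>Lovasz's proof, by induction on the number of non-adjacent pairs. Adding a pair keeps the
  hypothesis, so by induction the enlarged relations have perfect matchings. If adjacency is
  transitive away from the set \<open>A\<close> of universal vertices, the components outside \<open>A\<close> are cliques.
  If not, there are two missing pairs \<open>a, c\<close> and \<open>b, d\<close> with \<open>b\<close> adjacent to \<open>a\<close> and \<open>c\<close>, and the
  exchange step applies.\<close>

theorem tutte_perfect_matching:
  assumes "finite N" "symp r" "irreflp r"
    and "\<And>A. A \<subseteq> N \<Longrightarrow> card (odd_comps r (N - A)) \<le> card A"
  shows "matchable r N"
  using assms(2-)
proof (induction "card {(x, y). x \<in> N \<and> y \<in> N \<and> \<not> r x y}" arbitrary: r rule: less_induct)
  case less
  note fin = assms(1) and sym = less.prems(1) and irr = less.prems(2) and bar = less.prems(3)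
  have ev: "even (card N)"
    using bar[of "{}"] card_odd_comps_parity[OF sym fin] by simp
  define A where "A = {x \<in> N. \<forall>y\<in>N. x \<noteq> y \<longrightarrow> r x y}"
  have add_edge: "matchable (\<lambda>x y. r x y \<or> {x, y} = {u, v}) N"
    if uv: "u \<in> N" "v \<in> N" "u \<noteq> v" "\<not> r u v" for u v
  proof (rule less.hyps)
    let ?s = "\<lambda>x y. r x y \<or> {x, y} = {u, v}"
    show "card {(x, y). x \<in> N \<and> y \<in> N \<and> \<not> ?s x y} < card {(x, y). x \<in> N \<and> y \<in> N \<and> \<not> r x y}"
    proof (rule psubset_card_mono)
      show "finite {(x, y). x \<in> N \<and> y \<in> N \<and> \<not> r x y}"
        by (rule finite_subset[of _ "N \<times> N"]) (use fin in auto)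
      have "(u, v) \<in> {(x, y). x \<in> N \<and> y \<in> N \<and> \<not> r x y}" using uv by simp
      moreover have "(u, v) \<notin> {(x, y). x \<in> N \<and> y \<in> N \<and> \<not> ?s x y}" by simp
      ultimately show "{(x, y). x \<in> N \<and> y \<in> N \<and> \<not> ?s x y} \<subset> {(x, y). x \<in> N \<and> y \<in> N \<and> \<not> r x y}"
        by blast
    qed
    show "symp ?s" using sym by (auto simp: symp_def insert_commute)
    show "irreflp ?s" using irr uv(3) by (auto simp: irreflp_def doubleton_eq_iff)
    show "card (odd_comps ?s (N - B)) \<le> card B" if "B \<subseteq> N" for B
      by (rule order_trans[OF odd_comps_antimono bar[OF that]]) (use sym fin in auto)
  qed
  show ?case
  proof (cases "\<exists>a\<in>N. \<exists>b\<in>N - A. \<exists>c\<in>N. r a b \<and> r b c \<and> a \<noteq> c \<and> \<not> r a c")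
    case True
    then obtain a b c where abc: "a \<in> N" "b \<in> N - A" "c \<in> N" "r a b" "r b c" "a \<noteq> c" "\<not> r a c"
      by blast
    then obtain d where d: "d \<in> N" "b \<noteq> d" "\<not> r b d" unfolding A_def by blast
    have "matchable (\<lambda>x y. r x y \<or> {x, y} = {a, c}) N" using add_edge[of a c] abc by auto
    moreover have "matchable (\<lambda>x y. r x y \<or> {x, y} = {b, d}) N" using add_edge[of b d] abc d by auto
    ultimately show ?thesis
      using matching_exchange[OF fin sym irr, of a b c d] abc d unfolding matchable_def by blast
  next
    case False
    show ?thesis
    proof (rule matchable_if_clique_components[OF fin sym irr, of A])
      show "A \<subseteq> N" unfolding A_def by blast
      show "\<And>x y. x \<in> A \<Longrightarrow> y \<in> N \<Longrightarrow> x \<noteq> y \<Longrightarrow> r x y" unfolding A_def by blast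
      show "\<And>x y z. x \<in> N - A \<Longrightarrow> y \<in> N - A \<Longrightarrow> z \<in> N - A \<Longrightarrow> r x y \<Longrightarrow> r y z \<Longrightarrow> x \<noteq> z \<Longrightarrow> r x z"
        using False by blast
      show "even (card N)" by (rule ev)
      show "card (odd_comps r (N - A)) \<le> card A" using bar[of A] unfolding A_def by blast
    qed
  qed
qed

section \<open>Finite graphs as adjacency relations\<close>

locale finite_graph =
  fixes N :: "'a set" and adj :: "'a \<Rightarrow> 'a \<Rightarrow> bool"
  assumes finite_N: "finite N"
    and sym_adj: "symp adj"
    and irrefl_adj: "irreflp adj"
    and adj_in: "\<And>u v. adj u v \<Longrightarrow> u \<in> N \<and> v \<in> N"
begin

lemma adj_sym: "adj u v \<Longrightarrow> adj v u"
  using sym_adj by (rule sympD)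

lemma adj_irrefl: "\<not> adj v v"
  using irrefl_adj by (rule irreflpD)

end

section \<open>The gadget graph for 2-factors\<close>

text \<open>\<open>Port v w\<close> is the end at \<open>v\<close> of the edge \<open>vw\<close>. In a perfect matching, an edge whose two ports are
  matched to each other is left out; the two copies of a vertex select its two edges.\<close>

datatype 'a gadget = Copy 'a bool | Port 'a 'a

text \<open>The condition \<open>v \<noteq> w\<close> in the last equation keeps the relation irreflexive for arbitrary
  arguments.\<close>

fun gadj :: "'a gadget \<Rightarrow> 'a gadget \<Rightarrow> bool" where
  "gadj (Copy v i) (Copy u j) \<longleftrightarrow> False"
| "gadj (Copy v i) (Port u w) \<longleftrightarrow> u = v"
| "gadj (Port u w) (Copy v i) \<longleftrightarrow> u = v"
| "gadj (Port v w) (Port u z) \<longleftrightarrow> u = w \<and> z = v \<and> v \<noteq> w"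

definition attach :: "('a \<Rightarrow> 'a \<Rightarrow> bool) \<Rightarrow> 'a set \<Rightarrow> 'a set \<Rightarrow> 'a set" where
  "attach adj R C = {y \<in> R. \<exists>u\<in>C. adj u y}"

lemma symp_gadj: "symp gadj"
proof (rule sympI)
  show "gadj y x" if "gadj x y" for x y :: "'a gadget"
    using that by (cases x; cases y) auto
qed

lemma irreflp_gadj: "irreflp gadj"
proof (rule irreflpI)
  show "\<not> gadj x x" for x :: "'a gadget" by (cases x) auto
qed

context finite_graph
begin

definition GV :: "'a gadget set" where
  "GV = {Copy v i | v i. v \<in> N} \<union> {Port v w | v w. adj v w}"

lemma Copy_GV [simp]: "Copy v i \<in> GV \<longleftrightarrow> v \<in> N"
  unfolding GV_def by auto

lemma Port_GV [simp]: "Port v w \<in> GV \<longleftrightarrow> adj v w"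
  unfolding GV_def by auto

lemma finite_GV: "finite GV"
proof (rule finite_subset)
  show "GV \<subseteq> case_prod Copy ` (N \<times> UNIV) \<union> case_prod Port ` (N \<times> N)"
    unfolding GV_def using adj_in by force
  show "finite (case_prod Copy ` (N \<times> UNIV) \<union> case_prod Port ` (N \<times> N))"
    using finite_N by simp
qed

lemma even_card_GV: "even (card GV)"
proof -
  define f :: "'a gadget \<Rightarrow> 'a gadget"
    where "f x = (case x of Copy v i \<Rightarrow> Copy v (\<not> i) | Port v w \<Rightarrow> Port w v)" for x
  show ?thesis
  proof (rule even_card_involution[of _ f, OF finite_GV])
    show "f x \<in> GV \<and> f (f x) = x \<and> f x \<noteq> x" if "x \<in> GV" for x
      using that adj_sym adj_irrefl by (cases x) (auto simp: f_def)
  qed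
qed

text \<open>The edges whose ports are not matched to each other form the factor: a port that is not
  matched to its counterpart is matched to a copy of its own vertex.\<close>

lemma two_regular_of_matchable_gadget:
  assumes "matchable gadj GV"
  shows "\<exists>F. symp F \<and> (\<forall>u v. F u v \<longrightarrow> adj u v) \<and> (\<forall>v\<in>N. card {w. F v w} = 2)"
proof -
  obtain f where f: "\<And>x. x \<in> GV \<Longrightarrow> f x \<in> GV" "\<And>x. x \<in> GV \<Longrightarrow> f (f x) = x"
      "\<And>x. x \<in> GV \<Longrightarrow> gadj x (f x)"
    using assms unfolding matchable_def perfect_matching_def by blast
  define F where "F v w \<longleftrightarrow> adj v w \<and> f (Port v w) \<noteq> Port w v" for v w
  have "F w v" if "F v w" for v w
  proof -
    have vw: "adj v w" "adj w v" using that adj_sym unfolding F_def by auto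
    have "f (Port w v) \<noteq> Port v w" using f(2)[of "Port w v"] that vw unfolding F_def by auto
    then show ?thesis using vw unfolding F_def by simp
  qed
  then have "symp F" by (auto intro: sympI)
  moreover have "card {w. F v w} = 2" if v: "v \<in> N" for v
  proof -
    have "\<exists>w. f (Copy v i) = Port v w" for i
      using f(3)[of "Copy v i"] v by (cases "f (Copy v i)") auto
    then obtain w where w: "\<And>i. f (Copy v i) = Port v (w i)" by metis
    have a: "adj v (w i)" for i using f(1)[of "Copy v i"] w[of i] v by simp
    have fw: "f (Port v (w i)) = Copy v i" for i using f(2)[of "Copy v i"] w[of i] v by simp
    have "w True \<noteq> w False" using fw[of True] fw[of False] by auto
    moreover have "{z. F v z} = {w True, w False}"
    proof
      show "{w True, w False} \<subseteq> {z. F v z}" using a fw unfolding F_def by auto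
      show "{z. F v z} \<subseteq> {w True, w False}"
      proof
        fix z assume "z \<in> {z. F v z}"
        then have z: "adj v z" "f (Port v z) \<noteq> Port z v" unfolding F_def by auto
        then obtain i where "f (Port v z) = Copy v i"
          using f(3)[of "Port v z"] by (cases "f (Port v z)") auto
        then have "f (Copy v i) = Port v z" using f(2)[of "Port v z"] z(1) by simp
        then show "z \<in> {w True, w False}" using w[of i] by (cases i) auto
      qed
    qed
    ultimately show ?thesis by simp
  qed
  ultimately show ?thesis unfolding F_def by blast
qed

text \<open>Positive surplus is the obstruction in Tutte's theorem; the gadget graph has an even number
  of vertices, so the surplus is always even.\<close>

definition surplus :: "'a gadget set \<Rightarrow> int" where
  "surplus A = int (card (odd_comps gadj (GV - A))) - int (card A)"

definition both_copies :: "'a gadget set \<Rightarrow> 'a set" where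
  "both_copies A = {v \<in> N. Copy v True \<in> A \<and> Copy v False \<in> A}"

lemma even_surplus: "A \<subseteq> GV \<Longrightarrow> even (surplus A)"
proof -
  assume A: "A \<subseteq> GV"
  have "card (GV - A) + card A = card GV"
    using A finite_GV by (metis add.commute card_Diff_subset card_mono finite_subset le_add_diff_inverse)
  then have "even (card (GV - A)) \<longleftrightarrow> even (card A)" using even_card_GV by (metis even_add)
  then show ?thesis
    using card_odd_comps_parity[OF symp_gadj, of "GV - A"] finite_GV unfolding surplus_def by simp
qed

text \<open>Among the sets of maximum surplus, one with the most vertices both of whose copies are chosen,
  and then of least size. Removing elements from it without changing the set of such vertices
  therefore loses surplus, and by parity at least \<open>2\<close>.\<close>

lemma extremal_surplus_set:
  assumes "\<not> matchable gadj GV"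
  obtains A where "A \<subseteq> GV" "surplus A \<ge> 2"
    "\<And>B. B \<subseteq> GV \<Longrightarrow> surplus B \<le> surplus A"
    "\<And>B. B \<subseteq> GV \<Longrightarrow> surplus B = surplus A \<Longrightarrow> card (both_copies B) \<le> card (both_copies A)"
    "\<And>B. B \<subset> A \<Longrightarrow> both_copies B = both_copies A \<Longrightarrow> surplus B \<le> surplus A - 2"
proof -
  obtain A0 where A0: "A0 \<subseteq> GV" "surplus A0 \<ge> 1"
    using tutte_perfect_matching[OF finite_GV symp_gadj irreflp_gadj] assms
    unfolding surplus_def by force
  define m where "m = Max (surplus ` Pow GV)"
  have m: "surplus B \<le> m" if "B \<subseteq> GV" for B
    unfolding m_def using that finite_GV by (intro Max_ge) auto
  have "m \<in> surplus ` Pow GV" unfolding m_def using finite_GV by (intro Max_in) auto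
  then obtain A1 where A1: "A1 \<subseteq> GV" "surplus A1 = m" by auto
  let ?P = "\<lambda>B. B \<subseteq> GV \<and> surplus B = m"
  have "\<exists>A. ?P A \<and> (\<forall>B. ?P B \<longrightarrow> card (both_copies B) \<le> card (both_copies A))"
  proof (rule ex_has_greatest_nat[of ?P A1 "\<lambda>B. card (both_copies B)" "Suc (card N)"])
    show "?P A1" using A1 by simp
    show "\<forall>B. ?P B \<longrightarrow> card (both_copies B) < Suc (card N)"
      unfolding both_copies_def using finite_N by (auto intro!: card_mono simp: less_Suc_eq_le)
  qed
  then obtain A2 where A2: "?P A2" "\<And>B. ?P B \<Longrightarrow> card (both_copies B) \<le> card (both_copies A2)"
    by blast
  let ?Q = "\<lambda>B. ?P B \<and> card (both_copies B) = card (both_copies A2)"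
  obtain A where A: "?Q A" "\<And>B. ?Q B \<Longrightarrow> card A \<le> card B"
    using ex_has_least_nat[of ?Q A2 card] A2 by blast
  show ?thesis
  proof (rule that[of A])
    show "A \<subseteq> GV" using A(1) by blast
    show "surplus A \<ge> 2"
    proof -
      have "even (surplus A)" "surplus A \<ge> 1" using even_surplus[of A] A(1) m[OF A0(1)] A0(2) by auto
      then show ?thesis by presburger
    qed
    show "surplus B \<le> surplus A" if "B \<subseteq> GV" for B using m[OF that] A(1) by simp
    show "card (both_copies B) \<le> card (both_copies A)"
      if "B \<subseteq> GV" "surplus B = surplus A" for B using A2(2)[of B] A(1) that by simp
    show "surplus B \<le> surplus A - 2" if B: "B \<subset> A" "both_copies B = both_copies A" for B
    proof -
      have BGV: "B \<subseteq> GV" using B A(1) by blast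
      have "card B < card A"
        using B(1) A(1) finite_GV by (meson finite_subset psubset_card_mono)
      then have "surplus B \<noteq> m" using A(2)[of B] A(1) B(2) BGV by auto
      then have "surplus B < surplus A" "even (surplus B)" "even (surplus A)"
        using m[OF BGV] even_surplus[OF BGV] even_surplus[of A] A(1) by auto
      then show ?thesis by presburger
    qed
  qed
qed

end

section \<open>Structure of an extremal set of gadget vertices\<close>

locale extremal_set = finite_graph +
  fixes A :: "'a gadget set"
  assumes A_GV: "A \<subseteq> GV"
    and surplus_A: "surplus A \<ge> 2"
    and surplus_max: "\<And>B. B \<subseteq> GV \<Longrightarrow> surplus B \<le> surplus A"
    and copies_max: "\<And>B. B \<subseteq> GV \<Longrightarrow> surplus B = surplus A \<Longrightarrow>
      card (both_copies B) \<le> card (both_copies A)"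
    and card_min: "\<And>B. B \<subset> A \<Longrightarrow> both_copies B = both_copies A \<Longrightarrow> surplus B \<le> surplus A - 2"
    and no_isolated: "\<And>v. v \<in> N \<Longrightarrow> \<exists>w. adj v w"
begin

abbreviation K :: "'a gadget \<Rightarrow> 'a gadget set" where
  "K \<equiv> comp_of gadj (GV - A)"

text \<open>The odd components that can disappear when \<open>B\<close> is removed from \<open>A\<close>.\<close>

definition hit :: "'a gadget set \<Rightarrow> 'a gadget set set" where
  "hit B = {C \<in> odd_comps gadj (GV - A). \<exists>x\<in>C. \<exists>y\<in>B. gadj x y}"

lemma finite_rest: "finite (GV - A)"
  using finite_GV by simp

lemma finite_A: "finite A"
  using A_GV finite_GV finite_subset by blast

lemma K_comps: "x \<in> GV \<Longrightarrow> x \<notin> A \<Longrightarrow> K x \<in> comps gadj (GV - A)"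
  by (rule comp_of_in_comps[OF symp_gadj]) simp

lemma K_eq: "C \<in> comps gadj (GV - A) \<Longrightarrow> x \<in> C \<Longrightarrow> K x = C"
  by (rule comp_of_eq[OF symp_gadj])

lemma K_step:
  assumes "x \<in> GV" "x \<notin> A" "y \<in> GV" "y \<notin> A" "gadj x y"
  shows "K y = K x"
proof -
  have "K x \<in> comps gadj (GV - A)" by (rule K_comps[OF assms(1,2)])
  moreover have "y \<in> K x"
    using comps_closed[OF calculation] comp_of_self[of x gadj "GV - A"] assms
    unfolding closed_in_def by blast
  ultimately show ?thesis by (rule K_eq)
qed

text \<open>Removing \<open>B\<close> from \<open>A\<close> gains \<open>|B|\<close> and must lose at least \<open>2\<close> in surplus, and only components
  adjacent to \<open>B\<close> can be lost.\<close>

lemma card_hit: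
  assumes "B \<subseteq> A" "B \<noteq> {}" "both_copies (A - B) = both_copies A"
  shows "card (hit B) \<ge> card B + 2"
proof -
  let ?O = "odd_comps gadj (GV - A)"
  have finB: "finite B" using assms(1) finite_A finite_subset by blast
  have sub: "A - B \<subset> A" using assms by blast
  have "(GV - A) \<union> B = GV - (A - B)" using assms(1) A_GV by blast
  then have "?O - hit B \<subseteq> odd_comps gadj (GV - (A - B))"
    using comps_enlarge[of _ gadj "GV - A" B] unfolding odd_comps_def hit_def by auto
  then have "card (?O - hit B) \<le> card (odd_comps gadj (GV - (A - B)))"
    by (rule card_mono[rotated]) (simp add: finite_odd_comps finite_GV)
  moreover have "card (?O - hit B) = card ?O - card (hit B)" "card (hit B) \<le> card ?O"
    using finite_odd_comps[OF finite_rest]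
    by (auto intro!: card_Diff_subset card_mono simp: hit_def)
  moreover have "card (A - B) = card A - card B" "card B \<le> card A"
    using assms(1) finB finite_A by (auto intro: card_Diff_subset card_mono)
  ultimately show ?thesis
    using card_min[OF sub assms(3)] unfolding surplus_def by linarith
qed

text \<open>If \<open>B\<close> has at most \<open>|B| + 2\<close> neighbours, the bound above is attained: the neighbours lie outside
  \<open>A\<close>, in distinct components, all of them odd. This is applied to a single port and to all ports
  of a vertex.\<close>

lemma hit_tight:
  assumes "B \<subseteq> A" "B \<noteq> {}" "both_copies (A - B) = both_copies A"
    and "finite Z" "card Z \<le> card B + 2"
    and nb: "\<And>x y. x \<in> GV \<Longrightarrow> y \<in> B \<Longrightarrow> gadj x y \<Longrightarrow> x \<in> Z"
  shows "Z \<inter> A = {}" "inj_on K Z" "\<And>x. x \<in> Z \<Longrightarrow> odd (card (K x))"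
proof -
  have hit: "hit B \<subseteq> K ` (Z - A)"
  proof
    fix C assume C: "C \<in> hit B"
    then obtain x y where xy: "x \<in> C" "y \<in> B" "gadj x y" and Cc: "C \<in> comps gadj (GV - A)"
      unfolding hit_def odd_comps_def by blast
    have "x \<in> GV - A" using comps_subset[OF Cc] xy by blast
    then have "x \<in> Z - A" using nb xy by blast
    then show "C \<in> K ` (Z - A)" using K_eq[OF Cc xy(1)] by blast
  qed
  have c: "card (hit B) \<ge> card Z" using card_hit[OF assms(1-3)] assms(5) by linarith
  have c2: "card (hit B) \<le> card (K ` (Z - A))" using hit assms(4) by (intro card_mono) auto
  have c3: "card (K ` (Z - A)) \<le> card (Z - A)" using assms(4) by (intro card_image_le) simp
  have c4: "card (Z - A) \<le> card Z" using assms(4) by (intro card_mono) auto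
  have "Z - A = Z" using c c2 c3 c4 assms(4) by (intro card_seteq) auto
  then show ZA: "Z \<inter> A = {}" by blast
  have "card (K ` Z) = card Z" using c c2 c3 c4 \<open>Z - A = Z\<close> by simp
  then show "inj_on K Z" using assms(4) by (simp add: eq_card_imp_inj_on)
  have "hit B = K ` Z" using c c2 c3 hit \<open>Z - A = Z\<close> assms(4) by (intro card_seteq) auto
  then show "odd (card (K x))" if "x \<in> Z" for x
    using that unfolding hit_def odd_comps_def by blast
qed

text \<open>The projections of \<open>A\<close>: it will turn out to consist of both copies of each vertex of \<open>SS\<close> and of
  all ports of each vertex of \<open>TT\<close>.\<close>

definition TT :: "'a set" where
  "TT = {v \<in> N. \<exists>w. adj v w \<and> Port v w \<in> A}"

definition SS :: "'a set" where
  "SS = both_copies A"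

abbreviation UU :: "'a set" where
  "UU \<equiv> N - SS - TT"

lemma both_copies_remove_ports:
  assumes "\<And>v i. Copy v i \<notin> B"
  shows "both_copies (A - B) = both_copies A"
  using assms unfolding both_copies_def by auto

text \<open>A port has exactly three neighbours, so they are in different components. The two copies of
  \<open>v\<close> would share a component if some port of \<open>v\<close> were outside \<open>A\<close>.\<close>

lemma Port_in_A:
  assumes "Port v w \<in> A"
  shows "Copy v i \<notin> A" "Port w v \<notin> A" "\<And>u. adj v u \<Longrightarrow> Port v u \<in> A"
proof -
  have vw: "adj v w" "v \<in> N" using assms A_GV adj_in by (auto dest: subsetD)
  let ?Z = "{Copy v True, Copy v False, Port w v}"
  have Z: "x \<in> ?Z" if "x \<in> GV" "y \<in> {Port v w}" "gadj x y" for x y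
    using that by (cases x) auto
  note t = hit_tight[of "{Port v w}" ?Z]
  have ZA: "?Z \<inter> A = {}" and inj: "inj_on K ?Z"
    using t Z assms both_copies_remove_ports[of "{Port v w}"] by auto
  show Cp: "Copy v i \<notin> A" for i using ZA by (cases i) auto
  show "Port w v \<notin> A" using ZA by blast
  show "Port v u \<in> A" if "adj v u" for u
  proof (rule ccontr)
    assume "Port v u \<notin> A"
    then have "K (Copy v i) = K (Port v u)" for i
      using K_step[of "Port v u" "Copy v i"] that vw Cp by simp
    then have "K (Copy v True) = K (Copy v False)" by simp
    then show False using inj unfolding inj_on_def by simp
  qed
qed

text \<open>If one copy is in \<open>A\<close> and the other is not, all components adjacent to the former coincide with
  that of the latter, since both copies have the same neighbours.\<close>

lemma Copy_in_A:
  assumes "Copy v i \<in> A"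
  shows "v \<in> SS"
proof -
  have v: "v \<in> N" using assms A_GV by (auto dest: subsetD)
  have np: "Port v w \<notin> A" for w using Port_in_A(1)[of v w i] assms by blast
  have "Copy v (\<not> i) \<in> A"
  proof (rule ccontr)
    assume n: "Copy v (\<not> i) \<notin> A"
    then have "v \<notin> both_copies A" unfolding both_copies_def by (cases i) auto
    then have "both_copies (A - {Copy v i}) = both_copies A" unfolding both_copies_def by auto
    then have "card (hit {Copy v i}) \<ge> card {Copy v i} + 2"
      using assms by (intro card_hit) auto
    moreover have "hit {Copy v i} \<subseteq> {K (Copy v (\<not> i))}"
    proof
      fix C assume "C \<in> hit {Copy v i}"
      then obtain x where x: "x \<in> C" "gadj x (Copy v i)" and C: "C \<in> comps gadj (GV - A)"
        unfolding hit_def odd_comps_def by blast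
      obtain w where w: "x = Port v w" using x(2) by (cases x) auto
      have "x \<in> GV - A" using comps_subset[OF C] x by blast
      then have "K x = K (Copy v (\<not> i))"
        using K_step[of "Copy v (\<not> i)" x] v n unfolding w by simp
      then show "C \<in> {K (Copy v (\<not> i))}" using K_eq[OF C x(1)] by simp
    qed
    then have "card (hit {Copy v i}) \<le> 1" by (metis card.empty card.insert card_mono
      empty_iff finite.emptyI finite.insertI One_nat_def)
    ultimately show False by simp
  qed
  then show ?thesis using assms v unfolding SS_def both_copies_def by (cases i) auto
qed

lemma Copy_A: "Copy v i \<in> A \<longleftrightarrow> v \<in> SS"
  using Copy_in_A[of v i] unfolding SS_def both_copies_def by (cases i) auto

lemma Port_A: "adj v w \<Longrightarrow> Port v w \<in> A \<longleftrightarrow> v \<in> TT"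
  using Port_in_A(3) adj_in unfolding TT_def by blast

lemma SS_N: "SS \<subseteq> N" and TT_N: "TT \<subseteq> N"
  unfolding SS_def TT_def both_copies_def by auto

lemma SS_TT: "SS \<inter> TT = {}"
proof -
  have False if "v \<in> SS" "v \<in> TT" for v
  proof -
    obtain w where "Port v w \<in> A" using \<open>v \<in> TT\<close> unfolding TT_def by blast
    then show False using Port_in_A(1)[of v w True] Copy_A \<open>v \<in> SS\<close> by blast
  qed
  then show ?thesis by blast
qed

lemma TT_independent: "y \<in> TT \<Longrightarrow> z \<in> TT \<Longrightarrow> \<not> adj y z"
  using Port_A adj_sym Port_in_A(2) by blast

lemma A_eq: "A = case_prod Copy ` (SS \<times> UNIV) \<union> case_prod Port ` {(y, w). y \<in> TT \<and> adj y w}"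
  (is "A = ?R")
proof
  show "?R \<subseteq> A" using Copy_A Port_A by auto
  show "A \<subseteq> ?R"
  proof
    fix x assume x: "x \<in> A"
    show "x \<in> ?R"
    proof (cases x)
      case (Copy v i)
      then show ?thesis using x Copy_A by (auto simp: image_iff)
    next
      case (Port v w)
      then have "adj v w" using x A_GV by (auto dest: subsetD)
      then show ?thesis using x Port Port_A by (auto simp: image_iff)
    qed
  qed
qed

lemma card_A: "card A = 2 * card SS + card {(y, w). y \<in> TT \<and> adj y w}"
proof -
  have fin: "finite {(y, w). y \<in> TT \<and> adj y w}"
    by (rule finite_subset[of _ "N \<times> N"]) (use finite_N adj_in in auto)
  have "card A = card (case_prod Copy ` (SS \<times> (UNIV :: bool set)))
      + card (case_prod Port ` {(y, w). y \<in> TT \<and> adj y w})"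
    by (subst A_eq, rule card_Un_disjoint) (use fin finite_subset[OF SS_N finite_N] in auto)
  also have "card (case_prod Copy ` (SS \<times> (UNIV :: bool set))) = card (SS \<times> (UNIV :: bool set))"
    by (rule card_image) (auto simp: inj_on_def)
  also have "card (case_prod Port ` {(y, w). y \<in> TT \<and> adj y w}) = card {(y, w). y \<in> TT \<and> adj y w}"
    by (rule card_image) (auto simp: inj_on_def)
  finally show ?thesis by (simp add: card_cartesian_product)
qed

text \<open>Take for \<open>B\<close> all ports of \<open>y\<close>: its neighbours are the two copies of \<open>y\<close> and one opposite port
  for each port.\<close>

lemma K_ports_inj:
  assumes y: "y \<in> TT"
  shows "inj_on (\<lambda>w. K (Port w y)) {w. adj y w}"
    and "adj y w \<Longrightarrow> odd (card (K (Port w y)))"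
proof -
  let ?W = "{w. adj y w}"
  have finW: "finite ?W" by (rule finite_subset[OF _ finite_N]) (use adj_in in blast)
  let ?B = "Port y ` ?W"
  let ?Z = "insert (Copy y True) (insert (Copy y False) ((\<lambda>w. Port w y) ` ?W))"
  have cB: "card ?B = card ?W" by (rule card_image) (auto simp: inj_on_def)
  have cP: "card ((\<lambda>w. Port w y) ` ?W) = card ?W" by (rule card_image) (auto simp: inj_on_def)
  have B: "?B \<subseteq> A" using Port_A y by blast
  have ne: "?B \<noteq> {}" using no_isolated[of y] y TT_N by blast
  have same: "both_copies (A - ?B) = both_copies A"
    by (rule both_copies_remove_ports) auto
  have cZ: "card ?Z \<le> card ?B + 2"
    using finW by (subst card_insert_disjoint, auto)+ (simp add: cB cP)
  have nb: "x \<in> ?Z" if "x \<in> GV" "z \<in> ?B" "gadj x z" for x z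
    using that by (cases x) auto
  have finZ: "finite ?Z" using finW by simp
  have *: "inj_on K ?Z" "\<And>x. x \<in> ?Z \<Longrightarrow> odd (card (K x))"
    by (rule hit_tight[OF B ne same finZ cZ nb]; assumption)+
  show "inj_on (\<lambda>w. K (Port w y)) {w. adj y w}"
    using *(1) unfolding inj_on_def by auto
  show "adj y w \<Longrightarrow> odd (card (K (Port w y)))" using *(2) by blast
qed

text \<open>The component of the gadget graph outside \<open>A\<close> that belongs to a component \<open>C\<close> of the graph induced
  on \<open>UU\<close>.\<close>

definition blob :: "'a set \<Rightarrow> 'a gadget set" where
  "blob C = {Copy u i | u i. u \<in> C} \<union> {Port u w | u w. u \<in> C \<and> adj u w}
     \<union> {Port s u | s u. s \<in> SS \<and> u \<in> C \<and> adj s u}"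

lemma UU_notin_A:
  assumes "u \<in> UU"
  shows "Copy u i \<notin> A" "adj u w \<Longrightarrow> Port u w \<notin> A"
  using assms Copy_A Port_A by auto

lemma SS_port_notin_A: "s \<in> SS \<Longrightarrow> adj s w \<Longrightarrow> Port s w \<notin> A"
  using Port_A SS_TT by blast

lemma K_Port_eq_Copy: "u \<in> UU \<Longrightarrow> adj u w \<Longrightarrow> K (Port u w) = K (Copy u i)"
  using K_step[of "Copy u i" "Port u w"] UU_notin_A by simp

lemma K_Copy_eq: "u \<in> UU \<Longrightarrow> K (Copy u i) = K (Copy u j)"
  using K_Port_eq_Copy no_isolated by (metis DiffD1)

lemma K_comp:
  assumes C: "C \<in> comps adj UU" and "u \<in> C" "v \<in> C"
  shows "K (Copy u i) = K (Copy v j)"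
proof -
  let ?D = "{v \<in> UU. K (Copy v True) = K (Copy u True)}"
  have "closed_in adj UU ?D"
    unfolding closed_in_def
  proof (intro conjI ballI impI)
    fix x z assume x: "x \<in> ?D" and z: "z \<in> UU" and xz: "adj x z"
    have "K (Port z x) = K (Port x z)"
      using K_step[of "Port x z" "Port z x"] UU_notin_A xz adj_sym[OF xz] x z adj_irrefl by auto
    then have "K (Copy z True) = K (Copy x True)"
      using K_Port_eq_Copy[of x z True] K_Port_eq_Copy[of z x True] x z xz adj_sym[OF xz] by auto
    then show "z \<in> ?D" using x z by simp
  qed blast
  moreover have "u \<in> C \<inter> ?D" using assms(2) comps_subset[OF C] by blast
  ultimately have "C \<subseteq> ?D" using comps_le_closed[OF C] by blast
  then have "K (Copy v True) = K (Copy u True)" using assms(3) by blast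
  then show ?thesis using K_Copy_eq comps_subset[OF C] assms(2,3) by (metis subsetD)
qed

lemma blob_closed:
  assumes C: "C \<in> comps adj UU"
  shows "closed_in gadj (GV - A) (blob C)"
proof -
  have CU: "C \<subseteq> UU" by (rule comps_subset[OF C])
  have cl: "w \<in> C" if "u \<in> C" "w \<in> UU" "adj u w" for u w
    using comps_closed[OF C] that unfolding closed_in_def by blast
  have "blob C \<subseteq> GV - A"
    using CU UU_notin_A SS_port_notin_A SS_N unfolding blob_def by auto
  moreover have "y \<in> blob C" if x: "x \<in> blob C" and y: "y \<in> GV - A" "gadj x y" for x y
  proof -
    consider (1) u i where "x = Copy u i" "u \<in> C" | (2) u w where "x = Port u w" "u \<in> C" "adj u w"
      | (3) s u where "x = Port s u" "s \<in> SS" "u \<in> C" "adj s u"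
      using x unfolding blob_def by blast
    then show ?thesis
    proof cases
      case 1
      then show ?thesis using y unfolding blob_def by (cases y) auto
    next
      case 2
      show ?thesis
      proof (cases y)
        case (Copy v i)
        then show ?thesis using y 2 unfolding blob_def by auto
      next
        case (Port v z)
        then have vz: "v = w" "z = u" "adj w u" using y 2 adj_sym by auto
        have "w \<notin> TT" using y Port vz Port_A by auto
        then have "w \<in> SS \<or> w \<in> C" using cl[of u w] 2 adj_in[OF vz(3)] by blast
        then show ?thesis using Port vz 2 unfolding blob_def by auto
      qed
    next
      case 3
      show ?thesis
      proof (cases y)
        case (Copy v i)
        then show ?thesis using y 3 Copy_A by auto
      next
        case (Port v z)
        then show ?thesis using y 3 adj_sym unfolding blob_def by auto
      qed
    qed
  qed
  ultimately show ?thesis unfolding closed_in_def by blast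
qed

text \<open>A closed set that contains a component also lies in it as soon as all its elements have the same
  component.\<close>

lemma blob_eq_K:
  assumes C: "C \<in> comps adj UU" and u: "u \<in> C"
  shows "K (Copy u i) = blob C"
proof
  have uU: "u \<in> UU" using comps_subset[OF C] u by blast
  have Kc: "K (Copy u i) \<in> comps gadj (GV - A)" using K_comps uU UU_notin_A by simp
  have "Copy u i \<in> blob C" using u unfolding blob_def by blast
  then show "K (Copy u i) \<subseteq> blob C"
    using comps_le_closed[OF Kc blob_closed[OF C]] comp_of_self[of "Copy u i" gadj "GV - A"] by blast
  show "blob C \<subseteq> K (Copy u i)"
  proof
    fix x assume x: "x \<in> blob C"
    have UU: "v \<in> UU" if "v \<in> C" for v using comps_subset[OF C] that by blast
    consider (1) v j where "x = Copy v j" "v \<in> C" | (2) v w where "x = Port v w" "v \<in> C" "adj v w"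
      | (3) s v where "x = Port s v" "s \<in> SS" "v \<in> C" "adj s v"
      using x unfolding blob_def by blast
    then have "K x = K (Copy u i)"
    proof cases
      case 1
      then show ?thesis using K_comp[OF C u] by metis
    next
      case 2
      then show ?thesis using K_comp[OF C u, of v i i] K_Port_eq_Copy[OF UU, of v w i] by simp
    next
      case 3
      then have "K x = K (Port v s)"
        using K_step[of "Port v s" "Port s v"] adj_sym adj_irrefl UU UU_notin_A SS_port_notin_A by auto
      then show ?thesis
        using K_comp[OF C u, of v i i] K_Port_eq_Copy[OF UU, of v s i] 3 adj_sym by simp
    qed
    then show "x \<in> K (Copy u i)" using comp_of_self[of x gadj "GV - A"] by simp
  qed
qed

text \<open>Two neighbours of \<open>y\<close> in \<open>C\<close> would put two opposite ports into the same gadget component.\<close>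

lemma TT_neighbours_in_distinct_comps:
  assumes "y \<in> TT" "C \<in> comps adj UU" "u \<in> C" "v \<in> C" "adj u y" "adj v y"
  shows "u = v"
proof -
  have "u \<in> UU" "v \<in> UU" using comps_subset[OF assms(2)] assms(3,4) by auto
  then have "K (Port u y) = K (Port v y)"
    using K_Port_eq_Copy K_comp[OF assms(2-4)] assms(5,6) by metis
  then show ?thesis
    using K_ports_inj(1)[OF assms(1)] assms(5,6) adj_sym unfolding inj_on_def by blast
qed

text \<open>Swapping the copies of each vertex and the two ports of each edge pairs up everything in the blob
  except the ports directed at \<open>TT\<close>, whose counterparts are in \<open>A\<close>.\<close>

lemma card_blob_parity:
  assumes C: "C \<in> comps adj UU"
  shows "odd (card (blob C)) \<longleftrightarrow> odd (card (attach adj TT C))"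
proof -
  let ?P = "{Port u y | u y. u \<in> C \<and> y \<in> TT \<and> adj u y}"
  have CU: "C \<subseteq> UU" by (rule comps_subset[OF C])
  have cl: "w \<in> C" if "u \<in> C" "w \<in> UU" "adj u w" for u w
    using comps_closed[OF C] that unfolding closed_in_def by blast
  have fin: "finite (blob C)"
    using blob_closed[OF C] finite_rest finite_subset unfolding closed_in_def by blast
  have PB: "?P \<subseteq> blob C" unfolding blob_def by blast
  define f :: "'a gadget \<Rightarrow> 'a gadget"
    where "f x = (case x of Copy v i \<Rightarrow> Copy v (\<not> i) | Port v w \<Rightarrow> Port w v)" for x
  have "even (card (blob C - ?P))"
  proof (rule even_card_involution[of _ f])
    show "finite (blob C - ?P)" using fin by simp
    fix x assume x: "x \<in> blob C - ?P"
    show "f x \<in> blob C - ?P \<and> f (f x) = x \<and> f x \<noteq> x"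
    proof (cases x)
      case (Copy v i)
      then show ?thesis using x unfolding blob_def f_def by auto
    next
      case (Port v w)
      then have vw: "adj v w" "v \<noteq> w" "adj w v" using x adj_irrefl adj_sym unfolding blob_def by auto
      have "Port w v \<in> blob C - ?P"
      proof (cases "v \<in> C")
        case True
        then have "w \<notin> TT" using x Port vw by blast
        then have "w \<in> SS \<or> w \<in> C" using cl[OF True _ vw(1)] adj_in[OF vw(1)] by blast
        moreover have "v \<notin> TT" using True CU by blast
        ultimately show ?thesis using True vw unfolding blob_def by blast
      next
        case False
        then have "v \<in> SS" "w \<in> C" using x Port unfolding blob_def by auto
        moreover have "v \<notin> TT" using \<open>v \<in> SS\<close> SS_TT by blast
        ultimately show ?thesis using vw unfolding blob_def by blast
      qed
      then show ?thesis using Port vw unfolding f_def by simp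
    qed
  qed
  moreover have "card (blob C) = card ?P + card (blob C - ?P)"
    using card_Diff_subset[OF finite_subset[OF PB fin] PB] card_mono[OF fin PB] by linarith
  moreover have "card ?P = card (attach adj TT C)"
  proof -
    have "bij_betw (\<lambda>x. case x of Port u y \<Rightarrow> y | Copy u i \<Rightarrow> u) ?P (attach adj TT C)"
      unfolding bij_betw_def
    proof
      show "inj_on (\<lambda>x. case x of Port u y \<Rightarrow> y | Copy u i \<Rightarrow> u) ?P"
        by (rule inj_onI) (auto intro: TT_neighbours_in_distinct_comps[OF _ C])
      show "(\<lambda>x. case x of Port u y \<Rightarrow> y | Copy u i \<Rightarrow> u) ` ?P = attach adj TT C"
        unfolding attach_def by (force simp: image_iff)
    qed
    then show ?thesis by (rule bij_betw_same_card)
  qed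
  ultimately show ?thesis by simp
qed

lemma odd_attach:
  assumes C: "C \<in> comps adj UU" and ne: "attach adj TT C \<noteq> {}"
  shows "odd (card (attach adj TT C))"
proof -
  obtain y u where yu: "y \<in> TT" "u \<in> C" "adj u y" using ne unfolding attach_def by blast
  have "u \<in> UU" using comps_subset[OF C] yu by blast
  then have "K (Port u y) = blob C" using K_Port_eq_Copy yu blob_eq_K[OF C] by metis
  then show ?thesis using K_ports_inj(2)[OF yu(1) adj_sym[OF yu(3)]] card_blob_parity[OF C] by simp
qed

text \<open>If \<open>u\<close> had two neighbours in \<open>TT\<close>, adding both copies of \<open>u\<close> to \<open>A\<close> would cost \<open>2\<close>, destroy at most
  one odd component and isolate two ports of \<open>u\<close>. By parity the surplus would not drop, against
  the choice of \<open>A\<close> with the most doubly chosen vertices.\<close>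

lemma UU_at_most_one_TT:
  assumes u: "u \<in> UU" and y: "y \<in> TT" "adj u y" and z: "z \<in> TT" "adj u z"
  shows "y = z"
proof (rule ccontr)
  assume yz: "y \<noteq> z"
  let ?A = "A \<union> {Copy u True, Copy u False}"
  let ?O = "odd_comps gadj (GV - A)"
  let ?I = "(?O - {K (Copy u True)}) \<union> {{Port u y}, {Port u z}}"
  have uN: "u \<in> N" using u by blast
  have AGV: "?A \<subseteq> GV" using A_GV uN by simp
  have Ku: "{Copy u True, Copy u False, Port u y, Port u z} \<subseteq> K (Copy u True)"
    using K_Copy_eq[OF u] K_Port_eq_Copy[OF u y(2)] K_Port_eq_Copy[OF u z(2)]
      comp_of_self[of _ gadj "GV - A"] by (metis insert_subset empty_subsetI)
  have Kc: "K (Copy u True) \<in> comps gadj (GV - A)" using K_comps uN UU_notin_A[OF u] by simp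
  have finO: "finite ?O" using finite_odd_comps finite_rest by blast
  have out: "C \<inter> K (Copy u True) = {}" "C \<in> comps gadj (GV - A)" if "C \<in> ?O - {K (Copy u True)}" for C
    using that Kc comps_eqI[of C gadj "GV - A" "K (Copy u True)"] unfolding odd_comps_def by auto
  have portcl: "closed_in gadj (GV - ?A) {Port u t}" if "t \<in> TT" "adj u t" for t
  proof -
    have "Port u t \<in> GV - ?A" using UU_notin_A[OF u] that by simp
    moreover have "x \<in> {Port u t}" if "x \<in> GV - ?A" "gadj (Port u t) x" for x
    proof (cases x)
      case (Copy v i)
      then show ?thesis using that by (cases i) auto
    next
      case (Port v w)
      then show ?thesis using that Port_A \<open>t \<in> TT\<close> by auto
    qed
    ultimately show ?thesis unfolding closed_in_def by blast
  qed
  have "card ?I \<le> card (odd_comps gadj (GV - ?A))"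
  proof (rule card_odd_closed_family_le[of gadj _ ?I "\<lambda>C. C", OF symp_gadj])
    show "finite (GV - ?A)" using finite_GV by simp
    show "closed_in gadj (GV - ?A) C" if "C \<in> ?I" for C
    proof (cases "C \<in> ?O - {K (Copy u True)}")
      case True
      have "closed_in gadj (GV - A) C" by (rule comps_closed[OF out(2)[OF True]])
      then show ?thesis using out(1)[OF True] Ku unfolding closed_in_def by blast
    next
      case False
      then have "C = {Port u y} \<or> C = {Port u z}" using that by blast
      then show ?thesis using portcl[OF y] portcl[OF z] by auto
    qed
    show "odd (card C)" if "C \<in> ?I" for C
    proof (cases "C \<in> ?O")
      case True
      then show ?thesis unfolding odd_comps_def by simp
    next
      case False
      then show ?thesis using that by auto
    qed
    show "C \<inter> D = {}" if "C \<in> ?I" "D \<in> ?I" "C \<noteq> D" for C D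
    proof -
      have 1: "X' \<inter> Y' = {}" if "X' \<in> ?O - {K (Copy u True)}" "Y' \<in> {{Port u y}, {Port u z}}" for X' Y'
        using out(1)[OF that(1)] Ku that(2) by blast
      have 2: "C \<inter> D = {}" if "C \<in> ?O" "D \<in> ?O" "C \<noteq> D"
        using that comps_eqI[of C gadj "GV - A" D] unfolding odd_comps_def by blast
      have 3: "C \<inter> D = {}" if "C \<in> {{Port u y}, {Port u z}}" "D \<in> {{Port u y}, {Port u z}}" "C \<noteq> D"
        using that yz by auto
      from that(1,2) show ?thesis
      proof (elim UnE)
        assume "C \<in> ?O - {K (Copy u True)}" "D \<in> ?O - {K (Copy u True)}"
        then show ?thesis using 2 that(3) by simp
      next
        assume "C \<in> ?O - {K (Copy u True)}" "D \<in> {{Port u y}, {Port u z}}"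
        then show ?thesis by (rule 1)
      next
        assume "C \<in> {{Port u y}, {Port u z}}" "D \<in> ?O - {K (Copy u True)}"
        then show ?thesis using 1[of D C] by (simp add: Int_commute)
      next
        assume "C \<in> {{Port u y}, {Port u z}}" "D \<in> {{Port u y}, {Port u z}}"
        then show ?thesis using 3 that(3) by simp
      qed
    qed
  qed
  moreover have "card ?I = card (?O - {K (Copy u True)}) + 2"
  proof -
    have "(?O - {K (Copy u True)}) \<inter> {{Port u y}, {Port u z}} = {}"
      using out(1) Ku by blast
    moreover have "card {{Port u y}, {Port u z}} = 2" using yz by simp
    ultimately show ?thesis using finO by (subst card_Un_disjoint) auto
  qed
  moreover have "card ?O \<le> Suc (card (?O - {K (Copy u True)}))"
    using finO by (metis card_Diff1_le card_Suc_Diff1 Diff_empty Diff_insert0 le_SucI order_refl)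
  moreover have "card ?A = card A + 2"
    using UU_notin_A[OF u] finite_A by simp
  ultimately have "surplus ?A \<ge> surplus A - 1" unfolding surplus_def by linarith
  then have eq: "surplus ?A = surplus A"
    using surplus_max[OF AGV] even_surplus[OF AGV] even_surplus[OF A_GV] by presburger
  have "both_copies A \<subset> both_copies ?A"
    using uN u unfolding both_copies_def SS_def by auto
  then have "card (both_copies A) < card (both_copies ?A)"
    using finite_N by (intro psubset_card_mono) (auto simp: both_copies_def)
  then show False using copies_max[OF AGV eq] by simp
qed

text \<open>The odd components are isolated copies of \<open>TT\<close> vertices, isolated ports at \<open>SS\<close> directed at \<open>TT\<close>, and
  blobs. The two ports of an edge inside \<open>SS\<close> form an even component.\<close>

lemma odd_comps_cover:
  "odd_comps gadj (GV - A) \<subseteq>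
     (\<lambda>(y, i). {Copy y i}) ` (TT \<times> UNIV) \<union> (\<lambda>(s, y). {Port s y}) ` {(s, y). s \<in> SS \<and> y \<in> TT \<and> adj s y}
     \<union> blob ` {C \<in> comps adj UU. attach adj TT C \<noteq> {}}"
  (is "_ \<subseteq> ?R1 \<union> ?R2 \<union> ?R3")
proof
  fix D assume "D \<in> odd_comps gadj (GV - A)"
  then have D: "D \<in> comps gadj (GV - A)" "odd (card D)" unfolding odd_comps_def by auto
  obtain x where x: "x \<in> D" using comps_nonempty[OF D(1)] by blast
  have xG: "x \<in> GV" "x \<notin> A" using comps_subset[OF D(1)] x by auto
  have blobcase: "D \<in> ?R3" if "u \<in> UU" "K x = K (Copy u True)" for u
  proof -
    let ?C = "comp_of adj UU u"
    have C: "?C \<in> comps adj UU" by (rule comp_of_in_comps[OF sym_adj that(1)])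
    have "D = blob ?C"
      using K_eq[OF D(1) x] that(2) blob_eq_K[OF C comp_of_self] by simp
    moreover have "attach adj TT ?C \<noteq> {}"
      using D(2) card_blob_parity[OF C] calculation by auto
    ultimately show ?thesis using C by blast
  qed
  have sub: "D \<subseteq> E" if "closed_in gadj (GV - A) E" "x \<in> E" for E
    using comps_le_closed[OF D(1) that(1)] x that(2) by blast
  have Dx: "D = {x}" if "closed_in gadj (GV - A) {x}"
    using sub[OF that] x by blast
  show "D \<in> ?R1 \<union> ?R2 \<union> ?R3"
  proof (cases x)
    case (Copy v i)
    have v: "v \<in> N" "v \<notin> SS" using xG Copy Copy_A by auto
    show ?thesis
    proof (cases "v \<in> TT")
      case True
      have "z \<in> {x}" if "z \<in> GV - A" "gadj x z" for z
        using that Copy Port_A True by (cases z) auto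
      then have "D = {Copy v i}" using Dx xG Copy unfolding closed_in_def by auto
      then show ?thesis using True by (auto simp: image_iff)
    next
      case False
      then show ?thesis using blobcase[of v] v K_Copy_eq[of v i True] Copy by blast
    qed
  next
    case (Port v w)
    have vw: "adj v w" "adj w v" "v \<in> N" "w \<in> N" "v \<noteq> w" "v \<notin> TT"
      using xG Port adj_sym adj_in adj_irrefl Port_A by auto
    show ?thesis
    proof (cases "v \<in> SS")
      case False
      then have "v \<in> UU" using vw by blast
      then show ?thesis using blobcase[of v] K_Port_eq_Copy[of v w True] vw Port by blast
    next
      case vS: True
      have Cv: "Copy v i \<in> A" for i using vS Copy_A by blast
      consider "w \<in> TT" | "w \<in> SS" | "w \<in> UU" using vw by blast
      then show ?thesis
      proof cases
        case 1
        have "z \<in> {x}" if "z \<in> GV - A" "gadj x z" for z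
          using that Port Port_A 1 Cv by (cases z) auto
        then have "D = {Port v w}" using Dx xG Port unfolding closed_in_def by auto
        then show ?thesis using 1 vS vw by (auto simp: image_iff)
      next
        case 2
        have Cw: "Copy w i \<in> A" for i using 2 Copy_A by blast
        have wv: "Port w v \<in> GV - A" using SS_port_notin_A[OF 2 vw(2)] vw by simp
        let ?E = "{Port v w, Port w v}"
        have "closed_in gadj (GV - A) ?E"
          unfolding closed_in_def
        proof (intro conjI ballI impI)
          show "?E \<subseteq> GV - A" using wv xG Port by simp
          fix e z assume "e \<in> ?E" "z \<in> GV - A" "gadj e z"
          then show "z \<in> ?E" using Cv Cw by (cases z) auto
        qed
        then have "D \<subseteq> ?E" using sub Port by blast
        moreover have "Port w v \<in> D"
          using comps_closed[OF D(1)] x wv vw unfolding closed_in_def Port by fastforce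
        ultimately have "D = ?E" using x Port by blast
        then show ?thesis using D(2) vw by simp
      next
        case 3
        have "K (Port v w) = K (Port w v)"
          using K_step[of "Port w v" "Port v w"] vw UU_notin_A(2)[OF 3 vw(2)] SS_port_notin_A[OF vS vw(1)] by simp
        then show ?thesis using blobcase[OF 3] K_Port_eq_Copy[OF 3 vw(2), of True] Port by simp
      qed
    qed
  qed
qed

text \<open>Compare \<open>|A|\<close> with the number of odd components. Edges between \<open>SS\<close> and \<open>TT\<close> contribute to
  both and cancel; the edges from \<open>TT\<close> into \<open>UU\<close> are counted component by component.\<close>

lemma barrier_inequality:
  "2 * card SS + (\<Sum>C\<in>comps adj UU. card (attach adj TT C) - 1) + 2 \<le> 2 * card TT"
proof -
  let ?T = "{C \<in> comps adj UU. attach adj TT C \<noteq> {}}"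
  let ?E = "{(s, y). s \<in> SS \<and> y \<in> TT \<and> adj s y}"
  let ?F = "{(y, u). y \<in> TT \<and> u \<in> UU \<and> adj y u}"
  have finU: "finite UU" using finite_N by simp
  have finT: "finite ?T" using finite_comps[OF finU] by simp
  have finTT: "finite TT" "finite SS" using finite_N TT_N SS_N finite_subset by auto
  have finE: "finite ?E" by (rule finite_subset[of _ "SS \<times> TT"]) (use finTT in auto)
  have finF: "finite ?F" by (rule finite_subset[of _ "TT \<times> UU"]) (use finTT finU in auto)
  have "card (odd_comps gadj (GV - A)) \<le> card ((\<lambda>(y, i). {Copy y i}) ` (TT \<times> (UNIV :: bool set))
      \<union> (\<lambda>(s, y). {Port s y}) ` ?E \<union> blob ` ?T)"
    by (rule card_mono[OF _ odd_comps_cover]) (use finTT finE finT in simp)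
  also have "\<dots> \<le> card ((\<lambda>(y, i). {Copy y i}) ` (TT \<times> (UNIV :: bool set)))
      + card ((\<lambda>(s, y). {Port s y}) ` ?E) + card (blob ` ?T)"
    by (meson add_le_mono card_Un_le order_refl order_trans)
  also have "\<dots> \<le> card (TT \<times> (UNIV :: bool set)) + card ?E + card ?T"
    by (intro add_mono card_image_le) (use finTT finE finT in auto)
  finally have up: "card (odd_comps gadj (GV - A)) \<le> 2 * card TT + card ?E + card ?T"
    by (simp add: card_cartesian_product)
  have "card {(y, w). y \<in> TT \<and> adj y w} = card ((\<lambda>(s, y). (y, s)) ` ?E \<union> ?F)"
  proof (rule arg_cong[where f = card])
    show "{(y, w). y \<in> TT \<and> adj y w} = (\<lambda>(s, y). (y, s)) ` ?E \<union> ?F"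
      using TT_independent adj_in adj_sym TT_N SS_TT by (auto simp: image_iff)
  qed
  also have "\<dots> = card ((\<lambda>(s, y). (y, s)) ` ?E) + card ?F"
    by (rule card_Un_disjoint) (use finE finF in auto)
  also have "card ((\<lambda>(s, y). (y, s)) ` ?E) = card ?E"
    by (rule card_image) (auto simp: inj_on_def)
  finally have cA: "card A = 2 * card SS + (card ?E + card ?F)" using card_A by simp
  have "card ?F = (\<Sum>C\<in>?T. card (attach adj TT C))"
  proof -
    have "card ?F = card (\<Union>C\<in>?T. {(y, u). y \<in> TT \<and> u \<in> C \<and> adj y u})"
    proof (rule arg_cong[where f = card])
      show "?F = (\<Union>C\<in>?T. {(y, u). y \<in> TT \<and> u \<in> C \<and> adj y u})"
      proof
        show "?F \<subseteq> (\<Union>C\<in>?T. {(y, u). y \<in> TT \<and> u \<in> C \<and> adj y u})"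
        proof
          fix p assume "p \<in> ?F"
          then obtain y u where p: "p = (y, u)" "y \<in> TT" "u \<in> UU" "adj y u" by blast
          have "comp_of adj UU u \<in> comps adj UU" by (rule comp_of_in_comps[OF sym_adj p(3)])
          then show "p \<in> (\<Union>C\<in>?T. {(y, u). y \<in> TT \<and> u \<in> C \<and> adj y u})"
            using p comp_of_self[of u adj UU] adj_sym unfolding attach_def by blast
        qed
        show "(\<Union>C\<in>?T. {(y, u). y \<in> TT \<and> u \<in> C \<and> adj y u}) \<subseteq> ?F"
          using comps_subset by blast
      qed
    qed
    also have "\<dots> = (\<Sum>C\<in>?T. card {(y, u). y \<in> TT \<and> u \<in> C \<and> adj y u})"
    proof (rule card_UN_disjoint[OF finT])
      show "\<forall>C\<in>?T. finite {(y, u). y \<in> TT \<and> u \<in> C \<and> adj y u}"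
        using comps_subset by (intro ballI finite_subset[OF _ finF]) blast
      show "\<forall>C\<in>?T. \<forall>D\<in>?T. C \<noteq> D \<longrightarrow>
          {(y, u). y \<in> TT \<and> u \<in> C \<and> adj y u} \<inter> {(y, u). y \<in> TT \<and> u \<in> D \<and> adj y u} = {}"
        using comps_eqI[of _ adj UU] by blast
    qed
    also have "\<dots> = (\<Sum>C\<in>?T. card (attach adj TT C))"
    proof (rule sum.cong[OF refl])
      fix C assume C: "C \<in> ?T"
      have "bij_betw fst {(y, u). y \<in> TT \<and> u \<in> C \<and> adj y u} (attach adj TT C)"
        unfolding bij_betw_def
      proof
        show "inj_on fst {(y, u). y \<in> TT \<and> u \<in> C \<and> adj y u}"
          using TT_neighbours_in_distinct_comps C adj_sym by (fastforce intro!: inj_onI)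
        show "fst ` {(y, u). y \<in> TT \<and> u \<in> C \<and> adj y u} = attach adj TT C"
          using adj_sym unfolding attach_def by (force simp: image_iff)
      qed
      then show "card {(y, u). y \<in> TT \<and> u \<in> C \<and> adj y u} = card (attach adj TT C)"
        by (rule bij_betw_same_card)
    qed
    finally show ?thesis .
  qed
  also have "\<dots> = (\<Sum>C\<in>?T. (card (attach adj TT C) - 1) + 1)"
  proof (rule sum.cong[OF refl])
    fix C assume "C \<in> ?T"
    then have "card (attach adj TT C) \<noteq> 0" using odd_attach[of C] by force
    then show "card (attach adj TT C) = card (attach adj TT C) - 1 + 1" by simp
  qed
  also have "\<dots> = (\<Sum>C\<in>?T. card (attach adj TT C) - 1) + card ?T"
    by (simp only: sum.distrib) simp
  also have "(\<Sum>C\<in>?T. card (attach adj TT C) - 1) = (\<Sum>C\<in>comps adj UU. card (attach adj TT C) - 1)"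
    by (rule sum.mono_neutral_left[OF finite_comps[OF finU]]) auto
  finally have "card ?F = (\<Sum>C\<in>comps adj UU. card (attach adj TT C) - 1) + card ?T" .
  then show ?thesis using surplus_A up cA unfolding surplus_def by linarith
qed

end

section \<open>Barriers against 2-factors\<close>

text \<open>The set called \<open>R\<close> is the one usually called \<open>T\<close>. Truncated subtraction makes components without
  edges to \<open>R\<close> contribute zero to the sum.\<close>

locale tutte_barrier = finite_graph +
  fixes S R :: "'a set"
  assumes S_N: "S \<subseteq> N" and R_N: "R \<subseteq> N" and S_R: "S \<inter> R = {}"
    and R_independent: "\<And>y z. y \<in> R \<Longrightarrow> z \<in> R \<Longrightarrow> \<not> adj y z"
    and R_one_per_comp: "\<And>y C u v. y \<in> R \<Longrightarrow> C \<in> comps adj (N - S - R) \<Longrightarrow>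
      u \<in> C \<Longrightarrow> v \<in> C \<Longrightarrow> adj u y \<Longrightarrow> adj v y \<Longrightarrow> u = v"
    and rest_one_R: "\<And>u y z. u \<in> N - S - R \<Longrightarrow> y \<in> R \<Longrightarrow> z \<in> R \<Longrightarrow> adj u y \<Longrightarrow> adj u z \<Longrightarrow> y = z"
    and attach_odd: "\<And>C. C \<in> comps adj (N - S - R) \<Longrightarrow> attach adj R C \<noteq> {} \<Longrightarrow>
      odd (card (attach adj R C))"
    and deficit: "2 * card S + (\<Sum>C\<in>comps adj (N - S - R). card (attach adj R C) - 1) + 2
      \<le> 2 * card R"

text \<open>Tutte's 2-factor theorem, in the direction that produces an obstruction, together with the
  structure of an extremal obstruction.\<close>

theorem (in finite_graph) two_factor_or_barrier:
  assumes "\<And>v. v \<in> N \<Longrightarrow> \<exists>w. adj v w"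
  shows "(\<exists>F. symp F \<and> (\<forall>u v. F u v \<longrightarrow> adj u v) \<and> (\<forall>v\<in>N. card {w. F v w} = 2)) \<or>
    (\<exists>S R. tutte_barrier N adj S R)"
proof (cases "matchable gadj GV")
  case True
  then show ?thesis using two_regular_of_matchable_gadget by blast
next
  case False
  then obtain A where A: "A \<subseteq> GV" "surplus A \<ge> 2"
    "\<And>B. B \<subseteq> GV \<Longrightarrow> surplus B \<le> surplus A"
    "\<And>B. B \<subseteq> GV \<Longrightarrow> surplus B = surplus A \<Longrightarrow> card (both_copies B) \<le> card (both_copies A)"
    "\<And>B. B \<subset> A \<Longrightarrow> both_copies B = both_copies A \<Longrightarrow> surplus B \<le> surplus A - 2"
    using extremal_surplus_set by blast
  interpret extremal_set N adj A
    by unfold_locales (use A assms in auto)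
  have "tutte_barrier N adj SS TT"
    by unfold_locales
      (use SS_N TT_N SS_TT TT_independent TT_neighbours_in_distinct_comps UU_at_most_one_TT
        odd_attach barrier_inequality in \<open>blast+\<close>)
  then show ?thesis by blast
qed

section \<open>Graphs, toughness and forbidden patterns\<close>

definition adjacent :: "'a graph \<Rightarrow> 'a \<Rightarrow> 'a \<Rightarrow> bool" where
  "adjacent G u v \<longleftrightarrow> {u, v} \<in> edges G"

lemma finite_graph_adjacent:
  assumes "simple_graph G"
  shows "finite_graph (verts G) (adjacent G)"
proof
  show "finite (verts G)" using assms unfolding simple_graph_def by blast
  show "symp (adjacent G)" by (rule sympI) (simp add: adjacent_def insert_commute)
  show "irreflp (adjacent G)"
    using assms unfolding simple_graph_def adjacent_def by (intro irreflpI) force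
  show "u \<in> verts G \<and> v \<in> verts G" if "adjacent G u v" for u v
    using assms that unfolding simple_graph_def adjacent_def by blast
qed

lemma has_two_factor_of_relation:
  assumes G: "simple_graph G" and F: "symp F" "\<And>u v. F u v \<Longrightarrow> adjacent G u v"
    "\<And>v. v \<in> verts G \<Longrightarrow> card {w. F v w} = 2"
  shows "has_two_factor G"
proof -
  interpret finite_graph "verts G" "adjacent G" by (rule finite_graph_adjacent[OF G])
  let ?F = "\<lparr>verts = verts G, edges = {{u, v} | u v. F u v}\<rparr>"
  have sub: "edges ?F \<subseteq> edges G" using F(2) unfolding adjacent_def by auto
  have "\<forall>e\<in>edges ?F. e \<subseteq> verts G \<and> card e = 2"
    using subsetD[OF sub] G unfolding simple_graph_def by blast
  then have "spanning_subgraph ?F G"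
    using G sub unfolding spanning_subgraph_def simple_graph_def by simp
  moreover have "degree ?F v = 2" if v: "v \<in> verts G" for v
  proof -
    have "{e \<in> edges ?F. v \<in> e} = (\<lambda>w. {v, w}) ` {w. F v w}"
      using F(1) by (auto simp: insert_commute dest: sympD)
    moreover have "inj_on (\<lambda>w. {v, w}) {w. F v w}" by (auto simp: inj_on_def doubleton_eq_iff)
    ultimately show ?thesis unfolding degree_def using F(3)[OF v] by (simp add: card_image)
  qed
  ultimately show ?thesis unfolding has_two_factor_def by (intro exI[of _ ?F]) simp
qed

text \<open>Disjoint nonempty closed sets contain different components, so toughness can be applied to any
  such family.\<close>

lemma tough_closed_family:
  fixes G :: "'a graph"
  assumes G: "simple_graph G" and t: "tough t G" "t \<ge> 0" and W: "W \<subseteq> verts G"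
    and cl: "\<And>D. D \<in> \<D> \<Longrightarrow> closed_in (adjacent G) (verts G - W) D"
    and ne: "\<And>D. D \<in> \<D> \<Longrightarrow> D \<noteq> {}" and dj: "pairwise disjnt \<D>" and two: "card \<D> \<ge> 2"
  shows "t * card \<D> \<le> card W"
proof -
  let ?H = "induced_subgraph G (verts G - W)"
  let ?r = "connected_rel ?H"
  have fin: "finite (verts ?H)" using G unfolding simple_graph_def induced_subgraph_def by simp
  have "\<exists>x. x \<in> D" if "D \<in> \<D>" for D using ne[OF that] by blast
  then obtain g where g: "\<And>D. D \<in> \<D> \<Longrightarrow> g D \<in> D" by metis
  have sub: "D \<subseteq> verts ?H" if "D \<in> \<D>" for D
    using cl[OF that] unfolding closed_in_def induced_subgraph_def by simp
  have cls: "?r `` {g D} \<subseteq> D" if D: "D \<in> \<D>" for D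
  proof
    fix y assume "y \<in> ?r `` {g D}"
    then have "(g D, y) \<in> {(x, y). {x, y} \<in> edges ?H}\<^sup>*" unfolding connected_rel_def by blast
    then show "y \<in> D"
    proof (induction rule: rtrancl_induct)
      case base
      then show ?case using g[OF D] .
    next
      case (step y z)
      then have "{y, z} \<in> edges G" "z \<in> verts G - W" unfolding induced_subgraph_def by auto
      then show ?case using step.IH cl[OF D] unfolding closed_in_def adjacent_def by blast
    qed
  qed
  have self: "g D \<in> ?r `` {g D}" if "D \<in> \<D>" for D
    using sub[OF that] g[OF that] unfolding connected_rel_def by auto
  have "inj_on (\<lambda>D. ?r `` {g D}) \<D>"
  proof (rule inj_onI)
    fix D E assume DE: "D \<in> \<D>" "E \<in> \<D>" "?r `` {g D} = ?r `` {g E}"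
    then have "g D \<in> D \<inter> E" using self[OF DE(1)] cls[OF DE(2)] g[OF DE(1)] by auto
    then show "D = E" using dj DE(1,2) unfolding pairwise_def disjnt_def by auto
  qed
  moreover have "(\<lambda>D. ?r `` {g D}) ` \<D> \<subseteq> verts ?H // ?r"
    using sub g by (auto intro!: quotientI)
  moreover have "finite (verts ?H // ?r)"
    unfolding quotient_def using fin by simp
  ultimately have le: "card \<D> \<le> num_components ?H"
    unfolding num_components_def by (rule card_inj_on_le)
  then have "t * real (num_components ?H) \<le> real (card W)"
    using t(1) W two unfolding tough_def by auto
  moreover have "t * real (card \<D>) \<le> t * real (num_components ?H)"
    using le t(2) by (intro mult_left_mono) auto
  ultimately show ?thesis by linarith
qed

text \<open>The list \<open>xs\<close> induces the graph on its positions whose edges, written with the smaller position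
  first, are the pairs in \<open>E\<close>.\<close>

definition induced_pattern ::
  "('a \<Rightarrow> 'a \<Rightarrow> bool) \<Rightarrow> 'a set \<Rightarrow> (nat \<times> nat) set \<Rightarrow> 'a list \<Rightarrow> bool" where
  "induced_pattern r N E xs \<longleftrightarrow> distinct xs \<and> set xs \<subseteq> N \<and>
     (\<forall>i<length xs. \<forall>j<i. r (xs ! j) (xs ! i) \<longleftrightarrow> (j, i) \<in> E)"

lemma isomorphic_sym: "G \<simeq> H \<Longrightarrow> H \<simeq> G"
proof -
  assume "G \<simeq> H"
  then obtain f where f: "bij_betw f (verts G) (verts H)"
    and e: "\<And>u v. u \<in> verts G \<Longrightarrow> v \<in> verts G \<Longrightarrow> {u, v} \<in> edges G \<longleftrightarrow> {f u, f v} \<in> edges H"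
    unfolding isomorphic_def graph_isomorphism_def by blast
  let ?g = "inv_into (verts G) f"
  have g: "bij_betw ?g (verts H) (verts G)" by (rule bij_betw_inv_into[OF f])
  have "{u, v} \<in> edges H \<longleftrightarrow> {?g u, ?g v} \<in> edges G" if "u \<in> verts H" "v \<in> verts H" for u v
    using e[of "?g u" "?g v"] bij_betw_inv_into_right[OF f that(1)]
      bij_betw_inv_into_right[OF f that(2)] bij_betwE[OF g] that by simp
  then show ?thesis unfolding isomorphic_def graph_isomorphism_def using g by blast
qed

lemma isomorphic_trans: "G \<simeq> H \<Longrightarrow> H \<simeq> K \<Longrightarrow> G \<simeq> K"
proof -
  assume "G \<simeq> H" "H \<simeq> K"
  then obtain f g where f: "bij_betw f (verts G) (verts H)" and g: "bij_betw g (verts H) (verts K)"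
    and e: "\<And>u v. u \<in> verts G \<Longrightarrow> v \<in> verts G \<Longrightarrow> {u, v} \<in> edges G \<longleftrightarrow> {f u, f v} \<in> edges H"
    and e': "\<And>u v. u \<in> verts H \<Longrightarrow> v \<in> verts H \<Longrightarrow> {u, v} \<in> edges H \<longleftrightarrow> {g u, g v} \<in> edges K"
    unfolding isomorphic_def graph_isomorphism_def by blast
  have "graph_isomorphism (g \<circ> f) G K"
    unfolding graph_isomorphism_def
    using bij_betw_trans[OF f g] e e' bij_betwE[OF f] by auto
  then show ?thesis unfolding isomorphic_def by blast
qed

lemma isomorphic_pattern_graph:
  assumes "distinct xs" "verts H = set xs" "\<And>v. {v} \<notin> edges H"
    and E: "\<And>i j. i < length xs \<Longrightarrow> j < i \<Longrightarrow> {xs ! j, xs ! i} \<in> edges H \<longleftrightarrow> (j, i) \<in> E"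
  shows "\<lparr>verts = {..<length xs}, edges = {{j, i} | j i. j < i \<and> (j, i) \<in> E}\<rparr> \<simeq> H"
    (is "?P \<simeq> H")
proof -
  have b: "bij_betw ((!) xs) {..<length xs} (set xs)" using bij_betw_nth[OF assms(1)] by simp
  have lt: "{j, i} \<in> edges ?P \<longleftrightarrow> {xs ! j, xs ! i} \<in> edges H" if "j < i" "i < length xs" for i j
    using E[OF that(2,1)] that(1) by (auto simp: doubleton_eq_iff)
  have "{i, j} \<in> edges ?P \<longleftrightarrow> {xs ! i, xs ! j} \<in> edges H"
    if "i < length xs" "j < length xs" for i j
  proof (cases i j rule: linorder_cases)
    case equal
    then show ?thesis using assms(3) by (auto simp: doubleton_eq_iff)
  next
    case less
    then show ?thesis by (rule lt[OF _ that(2)])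
  next
    case greater
    show ?thesis
      by (subst insert_commute[of i j], subst insert_commute[of "xs ! i" "xs ! j"])
        (rule lt[OF greater that(1)])
  qed
  then show ?thesis
    unfolding isomorphic_def graph_isomorphism_def using b assms(2) by (intro exI[of _ "(!) xs"]) auto
qed

text \<open>The list \<open>vs\<close> numbers the vertices of \<open>H\<close>; both \<open>H\<close> and the induced subgraph are isomorphic to
  the graph on positions described by \<open>E\<close>.\<close>

lemma induced_free_no_pattern:
  assumes G: "simple_graph G" and free: "induced_free R G" and R: "R \<simeq> H"
    and H: "distinct vs" "verts H = set vs" "\<And>v. {v} \<notin> edges H"
      "\<And>i j. i < length vs \<Longrightarrow> j < i \<Longrightarrow> {vs ! j, vs ! i} \<in> edges H \<longleftrightarrow> (j, i) \<in> E"
    and len: "length xs = length vs"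
  shows "\<not> induced_pattern (adjacent G) (verts G) E xs"
proof
  assume pat: "induced_pattern (adjacent G) (verts G) E xs"
  let ?P = "\<lparr>verts = {..<length vs}, edges = {{j, i} | j i. j < i \<and> (j, i) \<in> E}\<rparr>"
  let ?I = "induced_subgraph G (set xs)"
  have PH: "?P \<simeq> H" by (rule isomorphic_pattern_graph[OF H])
  have PI: "?P \<simeq> ?I"
    unfolding len[symmetric]
  proof (rule isomorphic_pattern_graph)
    show "distinct xs" using pat unfolding induced_pattern_def by blast
    show "verts ?I = set xs" unfolding induced_subgraph_def by simp
    show "{v} \<notin> edges ?I" for v
      using G unfolding simple_graph_def induced_subgraph_def by force
    show "{xs ! j, xs ! i} \<in> edges ?I \<longleftrightarrow> (j, i) \<in> E" if "i < length xs" "j < i" for i j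
      using pat that unfolding induced_pattern_def induced_subgraph_def adjacent_def by auto
  qed
  have "?I \<simeq> R"
    by (rule isomorphic_trans[OF isomorphic_trans[OF isomorphic_sym[OF PI] PH] isomorphic_sym[OF R]])
  moreover have "set xs \<subseteq> verts G" using pat unfolding induced_pattern_def by blast
  ultimately show False using free unfolding induced_free_def by blast
qed

lemma induced_pattern5:
  "induced_pattern r N E [a, b, c, d, e] \<longleftrightarrow>
     distinct [a, b, c, d, e] \<and> {a, b, c, d, e} \<subseteq> N \<and>
     (r a b \<longleftrightarrow> (0, 1) \<in> E) \<and> (r a c \<longleftrightarrow> (0, 2) \<in> E) \<and> (r a d \<longleftrightarrow> (0, 3) \<in> E) \<and>
     (r a e \<longleftrightarrow> (0, 4) \<in> E) \<and> (r b c \<longleftrightarrow> (1, 2) \<in> E) \<and> (r b d \<longleftrightarrow> (1, 3) \<in> E) \<and>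
     (r b e \<longleftrightarrow> (1, 4) \<in> E) \<and> (r c d \<longleftrightarrow> (2, 3) \<in> E) \<and> (r c e \<longleftrightarrow> (2, 4) \<in> E) \<and>
     (r d e \<longleftrightarrow> (3, 4) \<in> E)"
proof -
  have "length [a, b, c, d, e] = Suc (Suc (Suc (Suc (Suc 0))))" by simp
  then show ?thesis
    unfolding induced_pattern_def
    by (simp only: All_less_Suc eval_nat_numeral nth_Cons_0 nth_Cons_Suc list.set not_less_zero
        simp_thms One_nat_def BitM.simps) blast
qed

section \<open>Barriers in tough graphs\<close>

locale tough_graph = finite_graph +
  fixes t :: real
  assumes t_ge_1: "t \<ge> 1" and three_vertices: "card N \<ge> 3"
    and toughness: "\<And>W \<D>. W \<subseteq> N \<Longrightarrow> (\<And>D. D \<in> \<D> \<Longrightarrow> closed_in adj (N - W) D) \<Longrightarrow>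
      (\<And>D. D \<in> \<D> \<Longrightarrow> D \<noteq> {}) \<Longrightarrow> pairwise disjnt \<D> \<Longrightarrow> card \<D> \<ge> 2 \<Longrightarrow> t * card \<D> \<le> card W"
begin

lemma toughness_family:
  assumes "W \<subseteq> N" "finite I" "card I \<ge> 2"
    and "\<And>i. i \<in> I \<Longrightarrow> closed_in adj (N - W) (D i)" "\<And>i. i \<in> I \<Longrightarrow> D i \<noteq> {}"
    and "\<And>i j. i \<in> I \<Longrightarrow> j \<in> I \<Longrightarrow> i \<noteq> j \<Longrightarrow> D i \<inter> D j = {}"
  shows "t * card I \<le> card W"
proof -
  have "inj_on D I" using assms(5,6) by (metis inf.idem inj_onI)
  then have c: "card (D ` I) = card I" by (rule card_image)
  have "pairwise disjnt (D ` I)"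
    using assms(6) unfolding pairwise_def disjnt_def by blast
  then have "t * card (D ` I) \<le> card W"
    by (rule toughness[OF assms(1), rotated 2]) (use assms(3-5) c in auto)
  then show ?thesis using c by simp
qed

lemma toughness2:
  assumes "W \<subseteq> N" "closed_in adj (N - W) D1" "D1 \<noteq> {}" "closed_in adj (N - W) D2" "D2 \<noteq> {}"
    "D1 \<inter> D2 = {}"
  shows "t * 2 \<le> card W"
proof -
  have "t * card {0, 1 :: nat} \<le> card W"
    by (rule toughness_family[of _ _ "\<lambda>i. if i = 0 then D1 else D2"]) (use assms in auto)
  then show ?thesis by simp
qed

lemma toughness3:
  assumes "W \<subseteq> N" "closed_in adj (N - W) D1" "D1 \<noteq> {}" "closed_in adj (N - W) D2" "D2 \<noteq> {}"
    "closed_in adj (N - W) D3" "D3 \<noteq> {}" "D1 \<inter> D2 = {}" "D1 \<inter> D3 = {}" "D2 \<inter> D3 = {}"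
  shows "t * 3 \<le> card W"
proof -
  have "t * card {0, 1, 2 :: nat} \<le> card W"
    by (rule toughness_family[of _ _ "\<lambda>i. if i = 0 then D1 else if i = 1 then D2 else D3"])
      (use assms in auto)
  then show ?thesis by simp
qed

lemma finite_neighbours: "finite {w. adj v w}"
  by (rule finite_subset[OF _ finite_N]) (use adj_in in blast)

text \<open>The neighbourhood of \<open>v\<close> separates \<open>v\<close> from \<open>w\<close>.\<close>

lemma degree_tough:
  assumes v: "v \<in> N" "w \<in> N" "w \<noteq> v" "\<not> adj v w"
  shows "t * 2 \<le> card {u. adj v u}"
proof (rule toughness2[of _ "{v}" "N - {u. adj v u} - {v}"])
  show "{u. adj v u} \<subseteq> N" using adj_in by blast
  show c: "closed_in adj (N - {u. adj v u}) {v}"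
    using v adj_irrefl unfolding closed_in_def by blast
  show "closed_in adj (N - {u. adj v u}) (N - {u. adj v u} - {v})"
    by (rule closed_in_Diff[OF sym_adj closed_in_self c])
  show "N - {u. adj v u} - {v} \<noteq> {}" using v by blast
qed auto

text \<open>Either some vertex is not adjacent to \<open>v\<close>, and its neighbourhood is a cutset, or \<open>v\<close> is adjacent
  to all others.\<close>

lemma degree_ge_2:
  assumes v: "v \<in> N"
  shows "card {u. adj v u} \<ge> 2"
proof (cases "\<exists>w\<in>N. w \<noteq> v \<and> \<not> adj v w")
  case True
  then obtain w where "w \<in> N" "w \<noteq> v" "\<not> adj v w" by blast
  then have "t * 2 \<le> card {u. adj v u}" using degree_tough[OF v] by blast
  then show ?thesis using t_ge_1 by linarith
next
  case False
  then have "N - {v} \<subseteq> {u. adj v u}" by blast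
  then have "card (N - {v}) \<le> card {u. adj v u}" by (rule card_mono[OF finite_neighbours])
  then show ?thesis using three_vertices v finite_N by simp
qed

lemma second_neighbour:
  assumes "v \<in> N" obtains w where "adj v w" "w \<noteq> u"
proof -
  have "\<not> {w. adj v w} \<subseteq> {u}"
  proof
    assume "{w. adj v w} \<subseteq> {u}"
    then have "card {w. adj v w} \<le> card {u}" by (rule card_mono[rotated]) simp
    then show False using degree_ge_2[OF assms] by simp
  qed
  then show ?thesis using that by blast
qed

end

locale tough_barrier = tough_graph + tutte_barrier
begin

abbreviation U :: "'a set" where "U \<equiv> N - S - R"

abbreviation components :: "'a set set" where "components \<equiv> comps adj U"

abbreviation att :: "'a set \<Rightarrow> 'a set" where "att \<equiv> attach adj R"

text \<open>The number of vertices that are deleted, besides \<open>S\<close>, in order to separate the vertices of \<open>R\<close>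
  from each other.\<close>

definition load :: nat where
  "load = (\<Sum>C\<in>components. card (att C) - 1)"

definition big :: "'a set \<Rightarrow> bool" where
  "big C \<longleftrightarrow> C \<in> components \<and> card (att C) \<ge> 3"

lemma finite_SRU: "finite S" "finite R" "finite U" "finite components"
  using finite_N S_N R_N finite_subset finite_comps[of U adj] by auto

lemma att_subset: "att C \<subseteq> R"
  unfolding attach_def by blast

lemma finite_att: "finite (att C)"
  using att_subset finite_SRU(2) finite_subset by blast

lemma attE:
  assumes "y \<in> att C" obtains c where "c \<in> C" "adj c y" "adj y c" "y \<in> R"
  using assms adj_sym unfolding attach_def by blast

lemma comp_elem:
  assumes "C \<in> components" "c \<in> C"
  shows "c \<in> U" "c \<in> N" "c \<notin> S" "c \<notin> R"
  using comps_subset[OF assms(1)] assms(2) by auto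

lemma comp_nbr:
  assumes "C \<in> components" "c \<in> C" "adj c d" "d \<notin> S" "d \<notin> R"
  shows "d \<in> C"
  using comps_closed[OF assms(1)] assms(2-) adj_in[OF assms(3)] unfolding closed_in_def by blast

lemma comps_not_adj:
  assumes "C \<in> components" "D \<in> components" "C \<noteq> D" "c \<in> C" "d \<in> D"
  shows "\<not> adj c d" "c \<noteq> d"
  using comp_nbr[OF assms(1,4), of d] comp_elem[OF assms(2,5)] comps_eqI[OF assms(1,2), of d]
    assms by auto

lemma card_att_bounded:
  assumes "C \<in> components"
  shows "card {c \<in> C. \<exists>y\<in>R. y \<noteq> z \<and> adj c y} \<le> card (att C - {z})"
proof -
  have "\<forall>c\<in>{c \<in> C. \<exists>y\<in>R. y \<noteq> z \<and> adj c y}. \<exists>y. y \<in> R \<and> y \<noteq> z \<and> adj c y" by blast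
  from bchoice[OF this] obtain g
    where g: "\<And>c. c \<in> {c \<in> C. \<exists>y\<in>R. y \<noteq> z \<and> adj c y} \<Longrightarrow> g c \<in> R \<and> g c \<noteq> z \<and> adj c (g c)"
    by blast
  show ?thesis
  proof (rule card_inj_on_le[of g])
    show "inj_on g {c \<in> C. \<exists>y\<in>R. y \<noteq> z \<and> adj c y}"
    proof (rule inj_onI)
      fix c d assume c: "c \<in> {c \<in> C. \<exists>y\<in>R. y \<noteq> z \<and> adj c y}"
        and d: "d \<in> {c \<in> C. \<exists>y\<in>R. y \<noteq> z \<and> adj c y}" and eq: "g c = g d"
      then show "c = d" using R_one_per_comp[of "g c" C c d] g[OF c] g[OF d] assms by auto
    qed
    show "g ` {c \<in> C. \<exists>y\<in>R. y \<noteq> z \<and> adj c y} \<subseteq> att C - {z}"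
      using g unfolding attach_def by blast
    show "finite (att C - {z})" using finite_att by simp
  qed
qed

text \<open>In every component keep the end of one edge to \<open>R\<close>, leading to \<open>rep C\<close>, and delete the other ends
  as well as \<open>S\<close>. The part \<open>D y\<close> around \<open>y\<close> then consists of \<open>y\<close> and of what is left of the components
  with representative \<open>y\<close>.\<close>

lemma R_tough:
  assumes "card R \<ge> 2"
  shows "t * card R \<le> card S + load"
proof -
  have "\<exists>z. att C \<noteq> {} \<longrightarrow> z \<in> att C" for C by blast
  then obtain rep where rep: "\<And>C. att C \<noteq> {} \<Longrightarrow> rep C \<in> att C" by metis
  define co where "co = comp_of adj U"
  have co: "co c \<in> components" "c \<in> co c" if "c \<in> U" for c
    unfolding co_def using comp_of_in_comps[OF sym_adj that] comp_of_self by auto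
  have co_eq: "co c = C" if "C \<in> components" "c \<in> C" for c C
    unfolding co_def by (rule comp_of_eq[OF sym_adj that])
  \<comment> \<open>\<open>B C\<close> contains the ends in \<open>C\<close> of all edges to \<open>R\<close> but the one leading to \<open>rep C\<close>.\<close>
  define B where "B C = {c \<in> C. \<exists>y\<in>R. y \<noteq> rep C \<and> adj c y}" for C
  define W where "W = S \<union> (\<Union>C\<in>components. B C)"
  have BC: "B C \<subseteq> C" for C unfolding B_def by blast
  have WN: "W \<subseteq> N" "W \<inter> R = {}"
    unfolding W_def using S_N S_R comps_subset[of _ adj U] BC by blast+
  have cB: "card (B C) \<le> card (att C) - 1" if C: "C \<in> components" for C
  proof (cases "att C = {}")
    case True
    then have "B C = {}" unfolding B_def attach_def by blast
    then show ?thesis by simp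
  next
    case False
    then have "card (att C - {rep C}) = card (att C) - 1" using rep by (simp add: finite_att)
    then show ?thesis using card_att_bounded[OF C, of "rep C"] unfolding B_def by simp
  qed
  have finB: "finite (B C)" if "C \<in> components" for C
    using BC comps_subset[OF that] finite_SRU(3) by (meson finite_subset)
  have "card W \<le> card S + card (\<Union>C\<in>components. B C)" unfolding W_def by (rule card_Un_le)
  also have "card (\<Union>C\<in>components. B C) \<le> (\<Sum>C\<in>components. card (B C))"
    by (rule card_UN_le[OF finite_SRU(4)])
  also have "\<dots> \<le> load" unfolding load_def by (rule sum_mono) (rule cB)
  finally have cW: "card W \<le> card S + load" by simp
  define D where "D y = insert y {c \<in> U - W. rep (co c) = y}" for y
  have "t * card R \<le> card W"
  proof (rule toughness_family[of W R D, OF WN(1) finite_SRU(2) assms])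
    fix y assume y: "y \<in> R"
    show "D y \<noteq> {}" unfolding D_def by blast
    show "closed_in adj (N - W) (D y)"
      unfolding closed_in_def
    proof (intro conjI ballI impI)
      show "D y \<subseteq> N - W" unfolding D_def using y R_N WN by blast
      fix a b assume a: "a \<in> D y" and b: "b \<in> N - W" and ab: "adj a b"
      have bS: "b \<notin> S" using b unfolding W_def by blast
      show "b \<in> D y"
      proof (cases "a = y")
        case True
        then have "b \<notin> R" using R_independent y ab by blast
        then have bU: "b \<in> U" using b bS by blast
        have "b \<notin> B (co b)" using b co[OF bU] unfolding W_def by blast
        then have "y = rep (co b)" using co[OF bU] y ab True adj_sym unfolding B_def by blast
        then show ?thesis using bU b unfolding D_def by blast
      next
        case False
        then have aU: "a \<in> U" "a \<notin> W" "rep (co a) = y" using a unfolding D_def by auto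
        show ?thesis
        proof (cases "b \<in> R")
          case True
          have "a \<notin> B (co a)" using aU co[OF aU(1)] unfolding W_def by blast
          then have "b = rep (co a)" using co[OF aU(1)] True ab unfolding B_def by blast
          then show ?thesis using aU(3) unfolding D_def by simp
        next
          case False
          then have "b \<in> co a" using comp_nbr[OF co(1)[OF aU(1)] co(2)[OF aU(1)] ab bS] by blast
          then have "co b = co a" by (rule co_eq[OF co(1)[OF aU(1)]])
          then show ?thesis using aU(3) b bS False unfolding D_def by simp
        qed
      qed
    qed
    show "D y \<inter> D z = {}" if "z \<in> R" "y \<noteq> z" for z
      using y that unfolding D_def by blast
  qed
  then show ?thesis using cW by linarith
qed

lemma deficit_load: "2 * card S + load + 2 \<le> 2 * card R"
  using deficit unfolding load_def .

text \<open>With \<open>R = {y}\<close> the deficit forces \<open>S\<close> to be empty, and the neighbours of \<open>y\<close> lie in different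
  components, so \<open>y\<close> would be a cut vertex.\<close>

lemma card_R_ge_2: "card R \<ge> 2"
proof (rule ccontr)
  assume "\<not> card R \<ge> 2"
  then have "card R = 1" "card S = 0" using deficit_load by linarith+
  then have S: "S = {}" using finite_SRU(1) by simp
  from \<open>card R = 1\<close> obtain y where y: "R = {y}" using card_1_singletonE by blast
  have yN: "y \<in> N" using y R_N by blast
  obtain u where u: "adj y u" using second_neighbour[OF yN] by blast
  obtain v where v: "adj y v" "v \<noteq> u" using second_neighbour[OF yN, of u] by blast
  have uv: "u \<in> U" "v \<in> U" using u v adj_in adj_irrefl S y by auto
  let ?C = "comp_of adj U u" and ?D = "comp_of adj U v"
  have CD: "?C \<in> components" "?D \<in> components" using comp_of_in_comps[OF sym_adj] uv by auto
  have "?C \<noteq> ?D"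
  proof
    assume "?C = ?D"
    then have "v \<in> ?C" using comp_of_self[of v adj U] by simp
    then have "u = v" using R_one_per_comp[OF _ CD(1) comp_of_self[of u adj U], of y v] y u v adj_sym by blast
    then show False using v by simp
  qed
  then have "?C \<inter> ?D = {}" using comps_eqI[OF CD] by blast
  then have "t * 2 \<le> card R"
    using toughness2[of R ?C ?D] CD comps_closed[of _ adj U] comps_nonempty[of _ adj U] S R_N by simp
  then show False using t_ge_1 \<open>card R = 1\<close> by simp
qed

lemma load_bound: "t * card R \<le> card S + load"
  by (rule R_tough[OF card_R_ge_2])

lemma card_att_le: "card (att C) \<le> card R"
  by (rule card_mono[OF finite_SRU(2) att_subset])

text \<open>The number of edges to \<open>R\<close> is never \<open>2\<close>, being zero or odd.\<close>

lemma big_iff: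
  assumes "C \<in> components"
  shows "big C \<longleftrightarrow> card (att C) - 1 \<noteq> 0"
proof -
  have "card (att C) \<noteq> 2" using attach_odd[OF assms] by force
  then show ?thesis unfolding big_def using assms by auto
qed

lemma load_big: "load = (\<Sum>C | big C. card (att C) - 1)"
  unfolding load_def
proof (rule sum.mono_neutral_right[OF finite_SRU(4)])
  show "{C. big C} \<subseteq> components" unfolding big_def by blast
  show "\<forall>C\<in>components - {C. big C}. card (att C) - 1 = 0" using big_iff by blast
qed

lemma finite_big: "finite {C. big C}"
  by (rule finite_subset[OF _ finite_SRU(4)]) (auto simp: big_def)

text \<open>Without big components \<open>load\<close> vanishes, and \<open>|R| \<le> |S|\<close> contradicts the deficit.\<close>

lemma ex_big: "\<exists>C. big C"
proof (rule ccontr)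
  assume "\<nexists>C. big C"
  then have "{C. big C} = {}" by blast
  then have "load = 0" unfolding load_big by (simp only: sum.empty)
  moreover have "card R \<le> t * card R" using t_ge_1 by (simp add: mult_le_cancel_right1)
  ultimately have "card R \<le> card S" using load_bound by linarith
  then show False using deficit_load by linarith
qed

lemma card_R_ge_3: "card R \<ge> 3"
  using ex_big card_att_le unfolding big_def by (meson order_trans)

lemma other_R:
  obtains y where "y \<in> R" "y \<noteq> a" "y \<noteq> b"
proof -
  have "\<not> R \<subseteq> {a, b}"
  proof
    assume "R \<subseteq> {a, b}"
    then have "card R \<le> card {a, b}" by (rule card_mono[rotated]) simp
    also have "\<dots> \<le> 2" by (simp add: card_insert_if)
    finally show False using card_R_ge_3 by simp
  qed
  then show ?thesis using that by blast
qed

lemma other_att: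
  assumes "big C" obtains y where "y \<in> att C" "y \<noteq> a" "y \<noteq> b"
proof -
  have "\<not> att C \<subseteq> {a, b}"
  proof
    assume "att C \<subseteq> {a, b}"
    then have "card (att C) \<le> card {a, b}" by (rule card_mono[rotated]) simp
    also have "\<dots> \<le> 2" by (simp add: card_insert_if)
    finally show False using assms unfolding big_def by simp
  qed
  then show ?thesis using that by blast
qed

lemma R_neighbour_unique:
  assumes "u \<in> U" obtains y where "\<And>z. z \<in> R \<Longrightarrow> adj u z \<Longrightarrow> z = y"
  using rest_one_R[OF assms] by metis

text \<open>\<open>S\<close> and the attachments of \<open>C\<close> in \<open>R\<close> separate \<open>C\<close> from the rest of \<open>R\<close>.\<close>

lemma comp_cut:
  assumes C: "C \<in> components" and ne: "att C \<noteq> R"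
  shows "t * 2 \<le> card S + card (att C)"
proof -
  let ?W = "S \<union> att C"
  have c: "closed_in adj (N - ?W) C"
    unfolding closed_in_def
  proof (intro conjI ballI impI)
    show "C \<subseteq> N - ?W" using comps_subset[OF C] att_subset by blast
    fix a b assume "a \<in> C" "b \<in> N - ?W" "adj a b"
    then show "b \<in> C" using comp_nbr[OF C, of a b] unfolding attach_def by blast
  qed
  have "t * 2 \<le> card ?W"
  proof (rule toughness2[of _ C "N - ?W - C"])
    show "?W \<subseteq> N" using S_N R_N att_subset by blast
    show "closed_in adj (N - ?W) C" by (rule c)
    show "closed_in adj (N - ?W) (N - ?W - C)"
      by (rule closed_in_Diff[OF sym_adj closed_in_self c])
    show "C \<noteq> {}" by (rule comps_nonempty[OF C])
    obtain y where "y \<in> R" "y \<notin> att C" using ne att_subset by blast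
    then have "y \<in> N - ?W - C" using R_N S_R comps_subset[OF C] by blast
    then show "N - ?W - C \<noteq> {}" by blast
  qed blast
  moreover have "card ?W \<le> card S + card (att C)" by (rule card_Un_le)
  ultimately show ?thesis by linarith
qed

lemma comp_neighbour:
  assumes C: "C \<in> components" and "c \<in> C" "d \<in> C" "c \<noteq> d"
  obtains x where "x \<in> C" "adj c x"
proof -
  have "\<exists>x\<in>C. adj c x"
  proof (rule ccontr)
    assume no: "\<not> (\<exists>x\<in>C. adj c x)"
    have "closed_in adj U {c}"
      using no comp_nbr[OF C assms(2)] comp_elem[OF C assms(2)] unfolding closed_in_def by blast
    then have "{c} = C" using comps_minimal[OF C, of "{c}"] assms(2) by blast
    then show False using assms by blast
  qed
  then show ?thesis using that by blast
qed

text \<open>If no vertex had distance two from \<open>c\<close>, then \<open>c\<close> and its neighbours in \<open>C\<close> would form a closed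
  set missing \<open>d\<close>.\<close>

lemma comp_distance_2:
  assumes C: "C \<in> components" and cd: "c \<in> C" "d \<in> C" "c \<noteq> d" "\<not> adj c d"
  obtains x z where "x \<in> C" "z \<in> C" "adj c x" "adj x z" "z \<noteq> c" "\<not> adj c z"
proof -
  let ?D = "{x \<in> C. x = c \<or> adj c x}"
  have "\<not> closed_in adj U ?D"
  proof
    assume "closed_in adj U ?D"
    then have "?D = C" using comps_minimal[OF C, of ?D] cd(1) by blast
    then have "d \<in> ?D" using cd(2) by (simp only:)
    then show False using cd by blast
  qed
  then obtain x z where xz: "x \<in> ?D" "z \<in> U" "adj x z" "z \<notin> ?D"
    using comps_subset[OF C] unfolding closed_in_def by blast
  have "z \<in> C" using comp_nbr[OF C, of x z] xz by blast
  then show ?thesis using that[of x z] xz by blast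
qed

end

context tough_barrier
begin

section \<open>Linear forests forced by a barrier\<close>

lemma one_R_neighbour: "c \<in> C \<Longrightarrow> C \<in> components \<Longrightarrow> adj c y \<Longrightarrow> y \<in> R \<Longrightarrow> z \<in> R \<Longrightarrow> z \<noteq> y \<Longrightarrow> \<not> adj c z"
  using rest_one_R[of c y z] comp_elem(1) by blast

lemma one_C_neighbour: "C \<in> components \<Longrightarrow> c \<in> C \<Longrightarrow> d \<in> C \<Longrightarrow> adj c y \<Longrightarrow> y \<in> R \<Longrightarrow> d \<noteq> c \<Longrightarrow> \<not> adj d y"
  using R_one_per_comp[of y C c d] by blast

lemma bigD: "big C \<Longrightarrow> C \<in> components"
  unfolding big_def by blast

lemma R_elem: "y \<in> R \<Longrightarrow> y \<in> N \<and> y \<notin> S"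
  using R_N S_R by blast

text \<open>If \<open>|R| \<le> 4\<close>, big components have exactly three attachments, and the two inequalities leave
  \<open>|S| \<le> 1\<close>. Components with a single attachment would give a cutset of size at most \<open>2\<close>. Every
  vertex of \<open>R\<close> has degree at least \<open>3\<close>, hence at least \<open>3 - |S|\<close> neighbours in different big
  components. This forces \<open>|R| = 4\<close> and exactly \<open>3 - |S|\<close> big components, so all of \<open>R\<close> is
  attached to each of them, which is one attachment too many.\<close>

lemma card_R_ge_5:
  assumes t: "t > 1" shows "card R \<ge> 5"
proof (rule ccontr)
  assume "\<not> card R \<ge> 5"
  then have n4: "card R \<le> 4" by simp
  let ?n = "card R" and ?s = "card S"
  have three: "k = 3" if "odd k" "k \<le> 4" "k \<noteq> 1" for k :: nat using that by presburger
  have touching3: "card (att C) = 3" if C: "C \<in> components" "att C \<noteq> {}" and s: "?s \<le> 1" for C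
  proof -
    have "odd (card (att C))" using attach_odd[OF C] .
    moreover have "card (att C) \<le> 4" using card_att_le[of C] n4 by linarith
    moreover have "card (att C) \<noteq> 1"
    proof
      assume one: "card (att C) = 1"
      then have "att C \<noteq> R" using card_R_ge_3 by force
      then have "t * 2 \<le> ?s + card (att C)" by (rule comp_cut[OF C(1)])
      then show False using t s one by simp
    qed
    ultimately show ?thesis by (rule three)
  qed
  have big3: "card (att C) = 3" if "big C" for C
  proof -
    have "odd (card (att C))" using attach_odd[of C] that unfolding big_def by force
    moreover have "card (att C) \<le> 4" "card (att C) \<noteq> 1"
      using that card_att_le[of C] n4 unfolding big_def by linarith+
    ultimately show ?thesis by (rule three)
  qed
  let ?m = "card {C. big C}"
  have load: "load = 2 * ?m" unfolding load_big using big3 by simp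
  have "real ?n < t * ?n" using t card_R_ge_3 by simp
  then have up: "?n + 1 \<le> ?s + load" using load_bound by linarith
  have s1: "?s \<le> 1" and sm: "?s + ?m + 1 \<le> ?n" and "?m \<ge> 2"
    using up deficit_load n4 unfolding load by linarith+
  define Tc where "Tc = {C \<in> components. att C \<noteq> {}}"
  have Tc_big: "Tc = {C. big C}"
    unfolding Tc_def big_def using touching3 s1 by force
  have finTc: "finite Tc" unfolding Tc_def using finite_SRU(4) by simp
  \<comment> \<open>The neighbours of \<open>y\<close> outside \<open>S\<close> lie in different components, and each of these is big.\<close>
  have nbrs: "comp_of adj U ` {u \<in> U. adj y u} \<subseteq> Tc \<and> inj_on (comp_of adj U) {u \<in> U. adj y u}
      \<and> 3 - ?s \<le> card {u \<in> U. adj y u}" if y: "y \<in> R" for y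
  proof (intro conjI)
    show "comp_of adj U ` {u \<in> U. adj y u} \<subseteq> Tc"
    proof (rule image_subsetI)
      fix u assume u: "u \<in> {u \<in> U. adj y u}"
      then have "y \<in> att (comp_of adj U u)"
        using y adj_sym comp_of_self[of u adj U] unfolding attach_def by blast
      then show "comp_of adj U u \<in> Tc" using u comp_of_in_comps[OF sym_adj, of u U] unfolding Tc_def by blast
    qed
    show "inj_on (comp_of adj U) {u \<in> U. adj y u}"
    proof (rule inj_onI)
      fix u v assume u: "u \<in> {u \<in> U. adj y u}" and v: "v \<in> {u \<in> U. adj y u}"
        and eq: "comp_of adj U u = comp_of adj U v"
      have Cu: "comp_of adj U u \<in> components" using u comp_of_in_comps[OF sym_adj, of u U] by blast
      have "v \<in> comp_of adj U u" using eq comp_of_self[of v adj U] by simp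
      moreover have "adj u y" "adj v y" using u v adj_sym by auto
      ultimately show "u = v" using R_one_per_comp[OF y Cu comp_of_self[of u adj U]] by blast
    qed
    obtain z where z: "z \<in> R" "z \<noteq> y" using other_R by blast
    have "t * 2 \<le> card {u. adj y u}"
      using degree_tough[of y z] R_independent[OF y z(1)] z(2) R_elem[OF y] R_elem[OF z(1)] by blast
    then have d: "card {u. adj y u} \<ge> 3" using t by linarith
    have "{u. adj y u} \<subseteq> S \<union> {u \<in> U. adj y u}"
      using R_independent[OF y] adj_in by blast
    then have "card {u. adj y u} \<le> card (S \<union> {u \<in> U. adj y u})"
      by (rule card_mono[rotated]) (use finite_SRU in auto)
    also have "\<dots> \<le> ?s + card {u \<in> U. adj y u}" by (rule card_Un_le)
    finally show "3 - ?s \<le> card {u \<in> U. adj y u}" using d by linarith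
  qed
  have le: "3 - ?s \<le> ?m"
  proof -
    obtain y where y: "y \<in> R" using other_R by blast
    have "card {u \<in> U. adj y u} \<le> card Tc" by (rule card_inj_on_le[of "comp_of adj U"]) (use nbrs[OF y] finTc in auto)
    then show ?thesis using nbrs[OF y] Tc_big by simp
  qed
  have n: "?n = 4" and m: "?m = 3 - ?s" using le sm n4 s1 by linarith+
  obtain C where C: "big C" using ex_big by blast
  have "R \<subseteq> att C"
  proof
    fix y assume y: "y \<in> R"
    have im: "comp_of adj U ` {u \<in> U. adj y u} = Tc"
    proof (rule card_seteq[OF finTc])
      have "card (comp_of adj U ` {u \<in> U. adj y u}) = card {u \<in> U. adj y u}"
        using nbrs[OF y] by (intro card_image) simp
      then show "card Tc \<le> card (comp_of adj U ` {u \<in> U. adj y u})"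
        using nbrs[OF y] m Tc_big by simp
    qed (use nbrs[OF y] in simp)
    have "C \<in> comp_of adj U ` {u \<in> U. adj y u}" unfolding im Tc_big using C by simp
    then obtain u where u: "adj y u" "C = comp_of adj U u" by auto
    then have "u \<in> C" using comp_of_self[of u adj U] by simp
    then show "y \<in> att C" using y adj_sym[OF u(1)] unfolding attach_def by blast
  qed
  then have "att C = R" using att_subset by blast
  then show False using big3[OF C] n by simp
qed

lemma pattern_5P1:
  assumes "t > 1" shows "\<exists>xs. length xs = 5 \<and> induced_pattern adj N {} xs"
proof -
  obtain B where B: "B \<subseteq> R" "card B = 5" using obtain_subset_with_card_n[OF card_R_ge_5[OF assms]] by metis
  then have "finite B" using finite_SRU(2) finite_subset by blast
  then obtain xs where xs: "set xs = B" "distinct xs" using finite_distinct_list by blast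
  have "length xs = 5" using distinct_card[OF xs(2)] xs(1) B(2) by simp
  moreover have "\<not> adj (xs ! j) (xs ! i)" if "i < length xs" "j < i" for i j
    using R_independent B(1) xs(1) nth_mem[of i xs] nth_mem[of j xs] that by auto
  ultimately show ?thesis
    unfolding induced_pattern_def using xs B(1) R_N by (intro exI[of _ xs]) auto
qed

text \<open>If the big components had disjoint sets of attachments, \<open>load\<close> would be at most \<open>|R|\<close>; for
  \<open>t = 3/2\<close> the two inequalities make it at least \<open>|R| + 2\<close>.\<close>

lemma big_comps_share:
  assumes t: "t = 3 / 2"
  obtains C D y where "big C" "big D" "C \<noteq> D" "y \<in> att C" "y \<in> att D"
proof -
  have "\<exists>C D. big C \<and> big D \<and> C \<noteq> D \<and> att C \<inter> att D \<noteq> {}"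
  proof (rule ccontr)
    assume no: "\<not> ?thesis"
    have "load \<le> (\<Sum>C | big C. card (att C))" unfolding load_big by (rule sum_mono) simp
    also have "\<dots> = card (\<Union>C\<in>{C. big C}. att C)"
      by (rule card_UN_disjoint[symmetric]) (use finite_big finite_att no in auto)
    also have "\<dots> \<le> card R" by (rule card_mono[OF finite_SRU(2)]) (use att_subset in blast)
    finally have "real load \<le> real (card R)" by simp
    moreover have "3 / 2 * real (card R) \<le> real (card S) + real load" using load_bound t by simp
    moreover have "2 * real (card S) + real load + 2 \<le> 2 * real (card R)"
      using deficit_load by linarith
    ultimately show False by linarith
  qed
  then show ?thesis using that by blast
qed

text \<open>Two big components that share \<open>y\<close>: walk from \<open>D\<close> through \<open>y\<close> to its neighbour \<open>c\<close> in \<open>C\<close>, and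
  continue for two more steps, inside \<open>C\<close> or from \<open>C\<close> back into \<open>R\<close>.\<close>

lemma pattern_P5:
  assumes t: "t = 3 / 2"
  shows "\<exists>a b c d e. induced_pattern adj N {(0, 1), (1, 2), (2, 3), (3, 4)} [a, b, c, d, e]"
proof -
  obtain C D y where CD: "big C" "big D" "C \<noteq> D" "y \<in> att C" "y \<in> att D"
    using big_comps_share[OF t] .
  note Cc = bigD[OF CD(1)] and Dc = bigD[OF CD(2)]
  obtain c where c: "c \<in> C" "adj c y" "adj y c" "y \<in> R" using attE[OF CD(4)] .
  obtain d where d: "d \<in> D" "adj d y" "adj y d" using attE[OF CD(5)] by blast
  obtain z where z: "z \<in> att C" "z \<noteq> y" using other_att[OF CD(1)] by blast
  obtain b where b: "b \<in> C" "adj b z" "adj z b" "z \<in> R" using attE[OF z(1)] .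
  have bc: "c \<noteq> b" using one_R_neighbour[OF c(1) Cc c(2,4) b(4) z(2)] b(2) by blast
  note nadj = comps_not_adj[OF Dc Cc CD(3)[symmetric] d(1)]
  note yN = R_elem[OF c(4)] and zN = R_elem[OF b(4)]
  note dN = comp_elem[OF Dc d(1)]
  show ?thesis
  proof (cases "adj c b")
    case True
    have "induced_pattern adj N {(0, 1), (1, 2), (2, 3), (3, 4)} [d, y, c, b, z]"
      unfolding induced_pattern5
      using True d c b z bc nadj[OF c(1)] nadj[OF b(1)] yN zN dN comp_elem[OF Cc c(1)] comp_elem[OF Cc b(1)]
        one_C_neighbour[OF Cc c(1) b(1) c(2,4) bc[symmetric]] adj_sym[of y b]
        one_R_neighbour[OF d(1) Dc d(2) c(4) b(4) z(2)] one_R_neighbour[OF c(1) Cc c(2,4) b(4) z(2)]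
        R_independent[OF c(4) b(4)] by auto
    then show ?thesis by blast
  next
    case False
    obtain x w where x: "x \<in> C" "w \<in> C" "adj c x" "adj x w" "w \<noteq> c" "\<not> adj c w"
      using comp_distance_2[OF Cc c(1) b(1) bc False] .
    have xc: "x \<noteq> c" "x \<noteq> w" using x adj_irrefl by auto
    have "induced_pattern adj N {(0, 1), (1, 2), (2, 3), (3, 4)} [d, y, c, x, w]"
      unfolding induced_pattern5
      using d c x xc nadj[OF c(1)] nadj[OF x(1)] nadj[OF x(2)] yN dN
        comp_elem[OF Cc c(1)] comp_elem[OF Cc x(1)] comp_elem[OF Cc x(2)] adj_sym[of y x] adj_sym[of y w]
        one_C_neighbour[OF Cc c(1) x(1) c(2,4) xc(1)] one_C_neighbour[OF Cc c(1) x(2) c(2,4) x(5)] by auto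
    then show ?thesis by blast
  qed
qed

text \<open>The path leaves \<open>R\<close> at \<open>y\<close> and continues in \<open>C\<close> to \<open>c\<close> and \<open>x\<close>. Among three attachments of \<open>D\<close> one
  differs from \<open>y\<close> and from the only possible neighbour \<open>q\<close> of \<open>x\<close> in \<open>R\<close>.\<close>

lemma pattern_P3_P2:
  assumes t: "t = 3 / 2"
  shows "\<exists>a b c d e. induced_pattern adj N {(0, 1), (1, 2), (3, 4)} [a, b, c, d, e]"
proof -
  obtain C D y where CD: "big C" "big D" "C \<noteq> D" "y \<in> att C"
    using big_comps_share[OF t] by metis
  note Cc = bigD[OF CD(1)] and Dc = bigD[OF CD(2)]
  obtain c where c: "c \<in> C" "adj c y" "adj y c" "y \<in> R" using attE[OF CD(4)] .
  obtain z where z: "z \<in> att C" "z \<noteq> y" using other_att[OF CD(1)] by blast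
  obtain b where b: "b \<in> C" "adj b z" "z \<in> R" using attE[OF z(1)] by blast
  have bc: "c \<noteq> b" using one_R_neighbour[OF c(1) Cc c(2,4) b(3) z(2)] b(2) by blast
  obtain x where x: "x \<in> C" "adj c x" using comp_neighbour[OF Cc c(1) b(1) bc] .
  have xc: "x \<noteq> c" using x adj_irrefl by auto
  obtain q where q: "\<And>z. z \<in> R \<Longrightarrow> adj x z \<Longrightarrow> z = q"
    using R_neighbour_unique[OF comp_elem(1)[OF Cc x(1)]] by blast
  obtain w where w: "w \<in> att D" "w \<noteq> y" "w \<noteq> q" using other_att[OF CD(2)] .
  obtain d where d: "d \<in> D" "adj d w" "adj w d" "w \<in> R" using attE[OF w(1)] .
  have "induced_pattern adj N {(0, 1), (1, 2), (3, 4)} [y, c, x, w, d]"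
    unfolding induced_pattern5
    using c x xc w d q[OF d(4)] R_elem[OF c(4)] R_elem[OF d(4)] adj_sym[of y x] adj_sym[of y d]
      comp_elem[OF Cc c(1)] comp_elem[OF Cc x(1)] comp_elem[OF Dc d(1)]
      comps_not_adj[OF Cc Dc CD(3) c(1) d(1)] comps_not_adj[OF Cc Dc CD(3) x(1) d(1)]
      one_C_neighbour[OF Cc c(1) x(1) c(2,4) xc] R_independent[OF c(4) d(4)]
      one_R_neighbour[OF d(1) Dc d(2,4) c(4) w(2)[symmetric]]
      one_R_neighbour[OF c(1) Cc c(2,4) d(4) w(2)] by auto
  then show ?thesis by blast
qed

lemma pattern_2P2_P1:
  assumes t: "t = 3 / 2"
  shows "\<exists>a b c d e. induced_pattern adj N {(0, 1), (2, 3)} [a, b, c, d, e]"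
proof -
  obtain C D y where CD: "big C" "big D" "C \<noteq> D" "y \<in> att C"
    using big_comps_share[OF t] by metis
  note Cc = bigD[OF CD(1)] and Dc = bigD[OF CD(2)]
  obtain c where c: "c \<in> C" "adj c y" "adj y c" "y \<in> R" using attE[OF CD(4)] .
  obtain w where w: "w \<in> att D" "w \<noteq> y" using other_att[OF CD(2)] by blast
  obtain d where d: "d \<in> D" "adj d w" "adj w d" "w \<in> R" using attE[OF w(1)] .
  obtain z where z: "z \<in> R" "z \<noteq> y" "z \<noteq> w" using other_R .
  have "induced_pattern adj N {(0, 1), (2, 3)} [y, c, w, d, z]"
    unfolding induced_pattern5
    using c w d z R_elem[OF c(4)] R_elem[OF d(4)] R_elem[OF z(1)] adj_sym[of y d]
      comp_elem[OF Cc c(1)] comp_elem[OF Dc d(1)]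
      comps_not_adj[OF Cc Dc CD(3) c(1) d(1)] R_independent[OF c(4) d(4)]
      R_independent[OF c(4) z(1)] R_independent[OF d(4) z(1)]
      one_R_neighbour[OF d(1) Dc d(2,4) c(4) w(2)[symmetric]]
      one_R_neighbour[OF d(1) Dc d(2,4) z(1) z(3)]
      one_R_neighbour[OF c(1) Cc c(2,4) z(1) z(2)]
      one_R_neighbour[OF c(1) Cc c(2,4) d(4) w(2)] by auto
  then show ?thesis by blast
qed

text \<open>If two adjacent vertices of a big component both have neighbours in \<open>R\<close>, these four vertices and a
  third vertex of \<open>R\<close> induce \<open>P\<^sub>4 \<union> P\<^sub>1\<close>. Otherwise start at \<open>y\<close> and walk \<open>c, x, w\<close> inside the
  component; then \<open>x\<close> has no neighbour in \<open>R\<close>, \<open>w\<close> has at most one, and some vertex of \<open>R\<close> is free.\<close>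

lemma pattern_P4_P1:
  "\<exists>a b c d e. induced_pattern adj N {(0, 1), (1, 2), (2, 3)} [a, b, c, d, e]"
proof -
  obtain C where C: "big C" using ex_big by blast
  note Cc = bigD[OF C]
  have joined: ?thesis if c: "c \<in> C" "adj c y" "y \<in> R" and d: "d \<in> C" "adj d z" "z \<in> R"
    and cd: "adj c d" for c d y z
  proof -
    have ne: "c \<noteq> d" using cd adj_irrefl by auto
    have yz: "z \<noteq> y" using one_C_neighbour[OF Cc c(1) d(1) c(2,3) ne[symmetric]] d(2) by blast
    obtain w where w: "w \<in> R" "w \<noteq> y" "w \<noteq> z" using other_R .
    have "induced_pattern adj N {(0, 1), (1, 2), (2, 3)} [y, c, d, z, w]"
      unfolding induced_pattern5
      using c d cd ne yz w R_elem[OF c(3)] R_elem[OF d(3)] R_elem[OF w(1)]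
        adj_sym[OF c(2)] adj_sym[of y d] comp_elem[OF Cc c(1)] comp_elem[OF Cc d(1)]
        one_C_neighbour[OF Cc c(1) d(1) c(2,3) ne[symmetric]]
        one_R_neighbour[OF c(1) Cc c(2,3) d(3) yz] one_R_neighbour[OF c(1) Cc c(2,3) w(1,2)]
        one_R_neighbour[OF d(1) Cc d(2,3) w(1,3)]
        R_independent[OF c(3) d(3)] R_independent[OF c(3) w(1)] R_independent[OF d(3) w(1)] by auto
    then show ?thesis by blast
  qed
  obtain y where y: "y \<in> att C" using other_att[OF C] by blast
  obtain c where c: "c \<in> C" "adj c y" "adj y c" "y \<in> R" using attE[OF y] .
  obtain z where z: "z \<in> att C" "z \<noteq> y" using other_att[OF C] by blast
  obtain b where b: "b \<in> C" "adj b z" "z \<in> R" using attE[OF z(1)] by blast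
  have bc: "c \<noteq> b" using one_R_neighbour[OF c(1) Cc c(2,4) b(3) z(2)] b(2) by blast
  show ?thesis
  proof (cases "adj c b")
    case True
    then show ?thesis using joined[OF c(1,2,4) b] by blast
  next
    case False
    obtain x w where x: "x \<in> C" "w \<in> C" "adj c x" "adj x w" "w \<noteq> c" "\<not> adj c w"
      using comp_distance_2[OF Cc c(1) b(1) bc False] .
    have xc: "x \<noteq> c" "x \<noteq> w" using x adj_irrefl by auto
    show ?thesis
    proof (cases "\<exists>p\<in>R. adj x p")
      case True
      then show ?thesis using joined[OF c(1,2,4) x(1)] x(3) by blast
    next
      case noR: False
      obtain q where q: "\<And>z. z \<in> R \<Longrightarrow> adj w z \<Longrightarrow> z = q"
        using R_neighbour_unique[OF comp_elem(1)[OF Cc x(2)]] by blast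
      obtain p where p: "p \<in> R" "p \<noteq> y" "p \<noteq> q" using other_R .
      have "induced_pattern adj N {(0, 1), (1, 2), (2, 3)} [y, c, x, w, p]"
        unfolding induced_pattern5
        using c x xc p noR q[OF p(1)] R_elem[OF c(4)] R_elem[OF p(1)]
          adj_sym[of y x] adj_sym[of y w]
          comp_elem[OF Cc c(1)] comp_elem[OF Cc x(1)] comp_elem[OF Cc x(2)]
          one_C_neighbour[OF Cc c(1) x(1) c(2,4) xc(1)] one_C_neighbour[OF Cc c(1) x(2) c(2,4) x(5)]
          one_R_neighbour[OF c(1) Cc c(2,4) p(1,2)] R_independent[OF c(4) p(1)] by auto
      then show ?thesis by blast
    qed
  qed
qed

end

section \<open>Barriers with three vertices in R\<close>

definition H0_shape :: "('a \<Rightarrow> 'a \<Rightarrow> bool) \<Rightarrow> 'a set \<Rightarrow> bool" where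
  "H0_shape adj N \<longleftrightarrow> (\<exists>y1 y2 y3 v1 v2 v3 u1 u2 u3.
     distinct [y1, y2, y3, v1, v2, v3, u1, u2, u3] \<and> N = {y1, y2, y3, v1, v2, v3, u1, u2, u3} \<and>
     (\<forall>p. adj y1 p \<longleftrightarrow> p = v1 \<or> p = u1) \<and> (\<forall>p. adj y2 p \<longleftrightarrow> p = v2 \<or> p = u2) \<and>
     (\<forall>p. adj y3 p \<longleftrightarrow> p = v3 \<or> p = u3) \<and>
     adj v1 v2 \<and> adj v2 v3 \<and> adj v1 v3 \<and> adj u1 u2 \<and> adj u2 u3 \<and> adj u1 u3 \<and>
     (\<forall>v\<in>{v1, v2, v3}. \<forall>u\<in>{u1, u2, u3}. \<not> adj v u))"

definition H1_shape :: "('a \<Rightarrow> 'a \<Rightarrow> bool) \<Rightarrow> 'a set \<Rightarrow> bool" where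
  "H1_shape adj N \<longleftrightarrow> (\<exists>x y1 y2 y3 v1 v2 v3.
     distinct [x, y1, y2, y3, v1, v2, v3] \<and> N = {x, y1, y2, y3, v1, v2, v3} \<and>
     (\<forall>p. adj y1 p \<longleftrightarrow> p = x \<or> p = v1) \<and> (\<forall>p. adj y2 p \<longleftrightarrow> p = x \<or> p = v2) \<and>
     (\<forall>p. adj y3 p \<longleftrightarrow> p = x \<or> p = v3) \<and> adj v1 v2 \<and> adj v2 v3 \<and> adj v1 v3)"

text \<open>The graph \<open>H\<^sub>4\<close> up to edges at \<open>x\<close> and up to the pairs \<open>v1, v3\<close> and \<open>v2, v3\<close>, so that this covers
  \<open>H\<^sub>2\<close>, \<open>H\<^sub>3\<close> and \<open>H\<^sub>4\<close> together.\<close>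

definition kite_shape :: "('a \<Rightarrow> 'a \<Rightarrow> bool) \<Rightarrow> 'a set \<Rightarrow> bool" where
  "kite_shape adj N \<longleftrightarrow> (\<exists>x y1 y2 y3 v1 v2 v3 v4.
     distinct [x, y1, y2, y3, v1, v2, v3, v4] \<and> N = {x, y1, y2, y3, v1, v2, v3, v4} \<and>
     (\<forall>p. adj y1 p \<longleftrightarrow> p = x \<or> p = v3) \<and> (\<forall>p. adj y2 p \<longleftrightarrow> p = x \<or> p = v1) \<and>
     (\<forall>p. adj y3 p \<longleftrightarrow> p = x \<or> p = v2) \<and> adj v1 v2 \<and> adj v1 v4 \<and> adj v2 v4 \<and> adj v3 v4)"

context tough_barrier
begin

lemma closed_single:
  assumes "a \<in> N" "a \<notin> W" "\<And>p. adj a p \<Longrightarrow> p \<in> W"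
  shows "closed_in adj (N - W) {a}"
  using assms unfolding closed_in_def by blast

lemma closed_pair:
  assumes "a \<in> N" "a \<notin> W" "b \<in> N" "b \<notin> W"
    "\<And>p. adj a p \<Longrightarrow> p \<in> W \<or> p = b" "\<And>p. adj b p \<Longrightarrow> p \<in> W \<or> p = a"
  shows "closed_in adj (N - W) {a, b}"
  using assms unfolding closed_in_def by blast

lemma closed_triple:
  assumes "a \<in> N" "a \<notin> W" "b \<in> N" "b \<notin> W" "c \<in> N" "c \<notin> W"
    "\<And>p. adj a p \<Longrightarrow> p \<in> W \<or> p \<in> {a, b, c}" "\<And>p. adj b p \<Longrightarrow> p \<in> W \<or> p \<in> {a, b, c}"
    "\<And>p. adj c p \<Longrightarrow> p \<in> W \<or> p \<in> {a, b, c}"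
  shows "closed_in adj (N - W) {a, b, c}"
  using assms unfolding closed_in_def by blast

lemma component_nbrs:
  assumes "C \<in> components" "c \<in> C" "y \<in> R" "adj c y" "adj c p"
  shows "p \<in> S \<or> p = y \<or> p \<in> C - {c}"
  using comp_nbr[OF assms(1,2,5)] one_R_neighbour[OF assms(2,1,4,3), of p] assms(5) adj_irrefl by blast

lemma R_nbr_comp:
  assumes "C \<in> components" "c \<in> C" "y \<in> R" "adj c y" "adj y p"
  shows "p \<in> S \<or> p = c \<or> p \<in> U - C"
  using one_C_neighbour[OF assms(1,2) _ assms(4,3), of p] adj_in[OF assms(5)] adj_sym[OF assms(5)]
    R_independent[OF assms(3), of p] assms(5) by blast

lemma R_nbrs:
  assumes x: "S = {x}" and C: "C \<in> components" and c: "c \<in> C" "y \<in> R" "adj c y"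
    and none: "\<And>p. p \<in> U - C \<Longrightarrow> \<not> adj y p"
  shows "adj y p \<longleftrightarrow> p = x \<or> p = c"
proof -
  have sub: "q = x \<or> q = c" if "adj y q" for q
    using R_nbr_comp[OF C c that] none that x by blast
  obtain q where "adj y q" "q \<noteq> c" using second_neighbour[of y c] R_elem[OF c(2)] by blast
  then have "adj y x" using sub by blast
  then show ?thesis using sub adj_sym[OF c(3)] by blast
qed

lemma card3E:
  assumes "card A = 3" "a \<in> A"
  obtains b c where "A = {a, b, c}" "a \<noteq> b" "a \<noteq> c" "b \<noteq> c"
proof -
  have "finite A" using assms(1) by (metis card.infinite zero_neq_numeral)
  then have "card (A - {a}) = 2" using assms by simp
  then obtain b c where "A - {a} = {b, c}" "b \<noteq> c" by (meson card_2_iff)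
  then show ?thesis using that[of b c] assms(2) by blast
qed

text \<open>For \<open>|R| = 3\<close> every big component is attached to all of \<open>R\<close>, so \<open>load\<close> is twice their number \<open>m\<close>.
  The inequalities become \<open>3 \<le> |S| + 2m\<close> and \<open>|S| + m \<le> 2\<close>.\<close>

lemma card_R_3_cases:
  assumes n: "card R = 3"
  shows "(\<And>C. big C \<Longrightarrow> att C = R)"
    and "S = {} \<and> (\<exists>C D. C \<noteq> D \<and> {C. big C} = {C, D}) \<or> (\<exists>x C. S = {x} \<and> {C. big C} = {C})"
proof -
  show att: "att C = R" if "big C" for C
    using that n att_subset finite_SRU(2) unfolding big_def by (metis card_seteq)
  have load: "load = 2 * card {C. big C}"
    unfolding load_big using att n by simp
  have "1 * real (card R) \<le> t * real (card R)" using t_ge_1 by (intro mult_right_mono) auto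
  then have "3 \<le> card S + load" using load_bound n by linarith
  then have "(card S = 0 \<and> card {C. big C} = 2) \<or> (card S = 1 \<and> card {C. big C} = 1)"
    using deficit_load n unfolding load by linarith
  then show "S = {} \<and> (\<exists>C D. C \<noteq> D \<and> {C. big C} = {C, D}) \<or> (\<exists>x C. S = {x} \<and> {C. big C} = {C})"
  proof (elim disjE conjE)
    assume "card S = 0" "card {C. big C} = 2"
    then have "S = {}" "\<exists>C D. {C. big C} = {C, D} \<and> C \<noteq> D"
      using finite_SRU(1) by (simp_all only: card_0_eq card_2_iff)
    then show ?thesis by blast
  next
    assume "card S = 1" "card {C. big C} = 1"
    then show ?thesis by (metis card_1_singletonE)
  qed
qed

lemma components_cover:
  assumes "\<And>D. D \<in> components \<Longrightarrow> D \<in> \<D>"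
  shows "U \<subseteq> \<Union>\<D>"
  using closed_eq_Union_comps[OF sym_adj closed_in_self[of adj U]] assms by blast

lemma spokes:
  assumes "card R = 3" "big C"
  obtains y1 y2 y3 v1 v2 v3 where "R = {y1, y2, y3}" "y1 \<noteq> y2" "y1 \<noteq> y3" "y2 \<noteq> y3"
    "v1 \<in> C" "v2 \<in> C" "v3 \<in> C" "adj v1 y1" "adj v2 y2" "adj v3 y3"
proof -
  obtain y1 where "y1 \<in> R" using other_R by blast
  then obtain y2 y3 where R: "R = {y1, y2, y3}" "y1 \<noteq> y2" "y1 \<noteq> y3" "y2 \<noteq> y3"
    using card3E[OF assms(1)] by metis
  have "att C = R" by (rule card_R_3_cases(1)[OF assms])
  then have "y1 \<in> att C" "y2 \<in> att C" "y3 \<in> att C" using R(1) by auto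
  then obtain v1 v2 v3 where "v1 \<in> C" "v2 \<in> C" "v3 \<in> C" "adj v1 y1" "adj v2 y2" "adj v3 y3"
    by (elim attE) blast
  then show ?thesis using that R by blast
qed

lemma spokes_distinct:
  assumes "C \<in> components" "v \<in> C" "w \<in> C" "adj v y" "adj w z" "y \<in> R" "z \<in> R" "y \<noteq> z"
  shows "v \<noteq> w" "\<not> adj v z" "\<not> adj z v"
  using one_R_neighbour[OF assms(2,1,4,6,7)] assms adj_sym[of z v] by auto

lemma unattached_not_adj:
  assumes "C \<in> components" "w \<in> C" "w \<notin> {v1, v2, v3}" "R = {y1, y2, y3}"
    "v1 \<in> C" "v2 \<in> C" "v3 \<in> C" "adj v1 y1" "adj v2 y2" "adj v3 y3" "y \<in> R"
  shows "\<not> adj w y" "\<not> adj y w"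
proof -
  show "\<not> adj w y"
    using one_C_neighbour[OF assms(1,5,2,8)] one_C_neighbour[OF assms(1,6,2,9)]
      one_C_neighbour[OF assms(1,7,2,10)] assms(3,4,11) by blast
  then show "\<not> adj y w" using adj_sym by blast
qed

text \<open>If \<open>va\<close> and \<open>vb\<close> were not adjacent, deleting \<open>x\<close> and \<open>vc\<close> would leave three components.\<close>

lemma single_component_triangle:
  assumes x: "S = {x}" and C: "C \<in> components" and UC: "U = C"
    and R: "R = {a, b, c}" "a \<noteq> b" "a \<noteq> c" "b \<noteq> c"
    and sp: "C = {va, vb, vc}" "adj va a" "adj vb b" "adj vc c"
  shows "adj va vb"
proof (rule ccontr)
  assume no: "\<not> adj va vb"
  have inC: "va \<in> C" "vb \<in> C" "vc \<in> C" and inR: "a \<in> R" "b \<in> R" "c \<in> R" using sp R by auto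
  note dist = spokes_distinct[OF C inC(1,2) sp(2,3) inR(1,2) R(2)]
    spokes_distinct[OF C inC(1,3) sp(2,4) inR(1,3) R(3)]
    spokes_distinct[OF C inC(2,3) sp(3,4) inR(2,3) R(4)]
  note na = R_nbrs[OF x C inC(1) inR(1) sp(2)] and nb = R_nbrs[OF x C inC(2) inR(2) sp(3)]
    and nc = R_nbrs[OF x C inC(3) inR(3) sp(4)]
  note el = comp_elem[OF C inC(1)] comp_elem[OF C inC(2)] comp_elem[OF C inC(3)]
    R_elem[OF inR(1)] R_elem[OF inR(2)] R_elem[OF inR(3)]
  have "t * 3 \<le> card {x, vc}"
  proof (rule toughness3[of _ "{a, va}" "{b, vb}" "{c}"])
    show "{x, vc} \<subseteq> N" using x S_N el by auto
    show "closed_in adj (N - {x, vc}) {a, va}"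
    proof (rule closed_pair)
      show "p \<in> {x, vc} \<or> p = va" if "adj a p" for p using na that UC by blast
      show "p \<in> {x, vc} \<or> p = a" if "adj va p" for p
        using component_nbrs[OF C inC(1) inR(1) sp(2) that] that no x sp(1) by blast
    qed (use el x dist inR in auto)
    show "closed_in adj (N - {x, vc}) {b, vb}"
    proof (rule closed_pair)
      show "p \<in> {x, vc} \<or> p = vb" if "adj b p" for p using nb that UC by blast
      show "p \<in> {x, vc} \<or> p = b" if "adj vb p" for p
        using component_nbrs[OF C inC(2) inR(2) sp(3) that] that no adj_sym x sp(1) by blast
    qed (use el x dist inR in auto)
    show "closed_in adj (N - {x, vc}) {c}"
    proof (rule closed_single)
      show "p \<in> {x, vc}" if "adj c p" for p using nc that UC by blast
    qed (use el x dist inR in auto)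
  qed (use R el dist inR in auto)
  moreover have "card {x, vc} \<le> 2" by (simp add: card_insert_if)
  ultimately show False using t_ge_1 by linarith
qed

lemma single_component_H1:
  assumes x: "S = {x}" and C: "C \<in> components" and UC: "U = C"
    and R: "R = {y1, y2, y3}" "y1 \<noteq> y2" "y1 \<noteq> y3" "y2 \<noteq> y3"
    and sp: "C = {v1, v2, v3}" "adj v1 y1" "adj v2 y2" "adj v3 y3"
  shows "H1_shape adj N"
proof -
  have inC: "v1 \<in> C" "v2 \<in> C" "v3 \<in> C" and inR: "y1 \<in> R" "y2 \<in> R" "y3 \<in> R" using sp R by auto
  note dist = spokes_distinct[OF C inC(1,2) sp(2,3) inR(1,2) R(2)]
    spokes_distinct[OF C inC(1,3) sp(2,4) inR(1,3) R(3)]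
    spokes_distinct[OF C inC(2,3) sp(3,4) inR(2,3) R(4)]
  note el = comp_elem[OF C inC(1)] comp_elem[OF C inC(2)] comp_elem[OF C inC(3)]
    R_elem[OF inR(1)] R_elem[OF inR(2)] R_elem[OF inR(3)]
  have "distinct [x, y1, y2, y3, v1, v2, v3]" using R dist el inR x by auto
  moreover have "N = {x, y1, y2, y3, v1, v2, v3}"
    using UC sp(1) R(1) x S_N R_N by blast
  moreover have "adj y1 p \<longleftrightarrow> p = x \<or> p = v1" "adj y2 p \<longleftrightarrow> p = x \<or> p = v2"
    "adj y3 p \<longleftrightarrow> p = x \<or> p = v3" for p
    using R_nbrs[OF x C inC(1) inR(1) sp(2)] R_nbrs[OF x C inC(2) inR(2) sp(3)]
      R_nbrs[OF x C inC(3) inR(3) sp(4)] UC by blast+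
  moreover have "adj v1 v2" by (rule single_component_triangle[OF x C UC R sp])
  moreover have "adj v2 v3"
    by (rule single_component_triangle[OF x C UC, of y2 y3 y1 v2 v3 v1]) (use R sp in auto)
  moreover have "adj v1 v3"
    by (rule single_component_triangle[OF x C UC, of y1 y3 y2 v1 v3 v2]) (use R sp in auto)
  ultimately show ?thesis unfolding H1_shape_def by blast
qed

text \<open>A vertex \<open>c\<close> attached to \<open>y\<close> and a neighbour \<open>d\<close> of \<open>c\<close> yield the pattern as soon as two further
  vertices of \<open>R\<close> are not adjacent to \<open>d\<close>; this gives \<open>|R| = 3\<close> and excludes vertices of \<open>C\<close>
  without a neighbour in \<open>R\<close>. A vertex of \<open>R\<close> with two neighbours outside \<open>S\<close> is the middle of
  the pattern, so there is just one component.\<close>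

lemma pattern_P3_2P1:
  "H1_shape adj N \<or> (\<exists>a b c d e. induced_pattern adj N {(0, 1), (1, 2)} [a, b, c, d, e])"
proof (rule disjCI)
  assume free: "\<not> (\<exists>a b c d e. induced_pattern adj N {(0, 1), (1, 2)} [a, b, c, d, e])"
  have outside: False if C: "C \<in> components" and c: "c \<in> C" "adj c y" "y \<in> R"
    and d: "d \<in> C" "adj c d" "d \<noteq> c" and z: "z \<in> R" "z \<noteq> y" "\<not> adj d z"
    and w: "w \<in> R" "w \<noteq> y" "\<not> adj d w" and zw: "z \<noteq> w" for C c d y z w
  proof -
    have "induced_pattern adj N {(0, 1), (1, 2)} [y, c, d, z, w]"
      unfolding induced_pattern5
      using c d z w zw R_elem[OF c(3)] R_elem[OF z(1)] R_elem[OF w(1)] adj_sym[OF c(2)] adj_sym[of y d]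
        comp_elem[OF C c(1)] comp_elem[OF C d(1)]
        one_C_neighbour[OF C c(1) d(1) c(2,3) d(3)] one_R_neighbour[OF c(1) C c(2,3) z(1,2)]
        one_R_neighbour[OF c(1) C c(2,3) w(1,2)] R_independent[OF c(3) z(1)]
        R_independent[OF c(3) w(1)] R_independent[OF z(1) w(1)] by auto
    then show False using free by blast
  qed
  obtain C where Cb: "big C" using ex_big by blast
  note C = bigD[OF Cb]
  have n: "card R = 3"
  proof (rule ccontr)
    assume "card R \<noteq> 3"
    then have n4: "card R \<ge> 4" using card_R_ge_3 by simp
    obtain y where y: "y \<in> att C" using other_att[OF Cb] by blast
    obtain c where c: "c \<in> C" "adj c y" "y \<in> R" using attE[OF y] by blast
    obtain z where z: "z \<in> att C" "z \<noteq> y" using other_att[OF Cb] by blast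
    obtain b where b: "b \<in> C" "adj b z" "z \<in> R" using attE[OF z(1)] by blast
    have bc: "c \<noteq> b" using one_R_neighbour[OF c(1) C c(2,3) b(3) z(2)] b(2) by blast
    obtain d where d: "d \<in> C" "adj c d" using comp_neighbour[OF C c(1) b(1) bc] .
    obtain q where q: "\<And>z. z \<in> R \<Longrightarrow> adj d z \<Longrightarrow> z = q"
      using R_neighbour_unique[OF comp_elem(1)[OF C d(1)]] by blast
    have "card {y, q} \<le> 2" by (simp add: card_insert_if)
    then have "card (R - {y, q}) \<ge> 2" using n4 diff_card_le_card_Diff[of "{y, q}" R] by simp
    then obtain z w where "{z, w} \<subseteq> R - {y, q}" "z \<noteq> w"
      by (metis card_2_iff obtain_subset_with_card_n)
    then show False using outside[OF C c d, of z w] q d adj_irrefl by blast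
  qed
  have lone: "c = d" if y: "y \<in> R" and c: "c \<in> U" "adj y c" and d: "d \<in> U" "adj y d" for y c d
  proof (rule ccontr)
    assume cd: "c \<noteq> d"
    have cy: "adj c y" "adj d y" using c d adj_sym by auto
    let ?C = "comp_of adj U c"
    have Cc: "?C \<in> components" by (rule comp_of_in_comps[OF sym_adj c(1)])
    have "d \<notin> ?C" using R_one_per_comp[OF y Cc comp_of_self _ cy] cd by blast
    then have ncd: "\<not> adj c d" using comp_nbr[OF Cc comp_of_self, of d] d by blast
    obtain z w where R: "R = {y, z, w}" "y \<noteq> z" "y \<noteq> w" "z \<noteq> w" using card3E[OF n y] .
    have zw: "z \<in> R" "w \<in> R" using R by auto
    have "induced_pattern adj N {(0, 1), (1, 2)} [c, y, d, z, w]"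
      unfolding induced_pattern5
      using c d cy cd ncd R zw R_elem[OF y] R_elem[OF zw(1)] R_elem[OF zw(2)]
        rest_one_R[OF c(1) y zw(1) cy(1)] rest_one_R[OF c(1) y zw(2) cy(1)]
        rest_one_R[OF d(1) y zw(1) cy(2)] rest_one_R[OF d(1) y zw(2) cy(2)]
        R_independent[OF y zw(1)] R_independent[OF y zw(2)] R_independent[OF zw] by auto
    then show False using free by blast
  qed
  have attC: "att C = R" by (rule card_R_3_cases(1)[OF n Cb])
  have no_other: "att D = {}" if D: "D \<in> components" "D \<noteq> C" for D
  proof (rule ccontr)
    assume "att D \<noteq> {}"
    then obtain y where y: "y \<in> att D" by blast
    obtain d where d: "d \<in> D" "adj y d" "y \<in> R" using attE[OF y] by blast
    obtain c where c: "c \<in> C" "adj y c" using attE[of y C] attC d by blast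
    have "c = d" using lone[OF d(3)] c d comp_elem(1)[OF D(1) d(1)] comp_elem(1)[OF C c(1)] by blast
    then show False using comps_eqI[OF D(1) C, of c] d c D by blast
  qed
  obtain x where x: "S = {x}"
  proof -
    from card_R_3_cases(2)[OF n] show ?thesis
    proof
      assume "S = {} \<and> (\<exists>C D. C \<noteq> D \<and> {C. big C} = {C, D})"
      then obtain D where "big D" "D \<noteq> C" by blast
      then show ?thesis using no_other[of D] unfolding big_def by simp
    qed (use that in blast)
  qed
  have "D = C" if D: "D \<in> components" for D
  proof (rule ccontr)
    assume "D \<noteq> C"
    then have e: "att D = {}" using no_other D by blast
    then have "att D \<noteq> R" using n by auto
    then have "t * 2 \<le> card S + card (att D)" by (rule comp_cut[OF D])
    then show False using e x t_ge_1 by simp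
  qed
  then have UC: "U = C" using components_cover[of "{C}"] comps_subset[OF C] by blast
  obtain y1 y2 y3 v1 v2 v3 where R: "R = {y1, y2, y3}" "y1 \<noteq> y2" "y1 \<noteq> y3" "y2 \<noteq> y3"
    and v: "v1 \<in> C" "v2 \<in> C" "v3 \<in> C" "adj v1 y1" "adj v2 y2" "adj v3 y3"
    using spokes[OF n Cb] .
  have "C = {v1, v2, v3}"
  proof -
    have "closed_in adj U {v1, v2, v3}"
      unfolding closed_in_def
    proof (intro conjI ballI impI)
      show "{v1, v2, v3} \<subseteq> U" using v UC by blast
      fix a w assume a: "a \<in> {v1, v2, v3}" and w: "w \<in> U" and aw: "adj a w"
      show "w \<in> {v1, v2, v3}"
      proof (rule ccontr)
        assume nw: "w \<notin> {v1, v2, v3}"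
        have wC: "w \<in> C" using w UC by simp
        note un = unattached_not_adj(1)[OF C wC nw R(1) v]
        \<comment> \<open>Name the neighbour of \<open>a\<close> in \<open>R\<close> first, whichever of the three it is.\<close>
        have "\<exists>y z u. R = {y, z, u} \<and> y \<noteq> z \<and> y \<noteq> u \<and> z \<noteq> u \<and> adj a y"
        proof -
          have "\<exists>y\<in>R. adj a y" using a v R(1) by auto
          then show ?thesis using card3E[OF n] by metis
        qed
        then obtain y z u where y: "R = {y, z, u}" "y \<noteq> z" "y \<noteq> u" "z \<noteq> u" "adj a y" by blast
        have "a \<in> C" using a v by blast
        then show False
          using outside[OF C, of a y w z u] y un aw wC adj_irrefl[of a] by blast
      qed
    qed
    then show ?thesis using comps_minimal[OF C, of "{v1, v2, v3}"] v by blast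
  qed
  then show "H1_shape adj N" using single_component_H1[OF x C UC R _ v(4-6)] by blast
qed

end

section \<open>Barriers avoiding an edge with three isolated vertices\<close>

text \<open>The pattern is \<open>P\<^sub>2 \<union> 3P\<^sub>1\<close>.\<close>

locale pattern_free_barrier = tough_barrier +
  assumes no_pattern: "\<And>a b c d e. \<not> induced_pattern adj N {(0, 1)} [a, b, c, d, e]"
begin

lemma free:
  assumes "distinct [a, b, c, d, e]" "{a, b, c, d, e} \<subseteq> N" "adj a b"
    "\<not> adj a c" "\<not> adj a d" "\<not> adj a e" "\<not> adj b c" "\<not> adj b d" "\<not> adj b e"
    "\<not> adj c d" "\<not> adj c e" "\<not> adj d e"
  shows False
  using no_pattern[of a b c d e] assms unfolding induced_pattern5 by simp

lemma card_R_eq_3: "card R = 3"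
proof (rule ccontr)
  assume "card R \<noteq> 3"
  then have n4: "card R \<ge> 4" using card_R_ge_3 by simp
  obtain C where Cb: "big C" using ex_big by blast
  note C = bigD[OF Cb]
  obtain y where y: "y \<in> att C" using other_att[OF Cb] by blast
  obtain c where c: "c \<in> C" "adj c y" "adj y c" "y \<in> R" using attE[OF y] .
  have "card (R - {y}) \<ge> 3" using n4 c(4) finite_SRU(2) by simp
  then obtain B where B: "B \<subseteq> R - {y}" "card B = 3" using obtain_subset_with_card_n by metis
  then obtain z w v where B3: "B = {z, w, v}" "z \<noteq> w" "z \<noteq> v" "w \<noteq> v" by (meson card_3_iff)
  then have zwv: "z \<in> R" "z \<noteq> y" "w \<in> R" "w \<noteq> y" "v \<in> R" "v \<noteq> y" using B(1) by auto
  show False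
    by (rule free[of y c z w v])
      (use c zwv B3 R_elem comp_elem[OF C c(1)] R_independent one_R_neighbour[OF c(1) C c(2,4)] in auto)
qed

text \<open>An edge between \<open>R\<close> and a component together with the rest of \<open>R\<close> forms the pattern with any further
  vertex \<open>p\<close> that is not adjacent to any of these four.\<close>

lemma edge_outside:
  assumes "y \<in> R" "z \<in> R" "w \<in> R" "y \<noteq> z" "y \<noteq> w" "z \<noteq> w"
    and C: "C \<in> components" "c \<in> C" "adj c y"
    and p: "p \<in> U" "p \<noteq> c" "\<not> adj c p" "\<not> adj p y" "\<not> adj p z" "\<not> adj p w"
  shows False
proof (rule free[of y c z w p])
  note r = R_elem[OF assms(1)] R_elem[OF assms(2)] R_elem[OF assms(3)] comp_elem[OF C(1,2)]
  show "distinct [y, c, z, w, p]" "{y, c, z, w, p} \<subseteq> N" using assms r by auto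
  show "adj y c" "\<not> adj y z" "\<not> adj y w" "\<not> adj y p" "\<not> adj c z" "\<not> adj c w"
    "\<not> adj z w" "\<not> adj z p" "\<not> adj w p"
    using C p adj_sym R_independent[OF assms(1,2)] R_independent[OF assms(1,3)]
      R_independent[OF assms(2,3)] one_R_neighbour[OF C(2,1,3) assms(1,2)]
      one_R_neighbour[OF C(2,1,3) assms(1,3)] assms(4,5) by blast+
  show "\<not> adj c p" by (rule p(3))
qed

text \<open>A vertex of \<open>C\<close> without a neighbour in \<open>R\<close> would complete the edge from \<open>y1\<close> into \<open>D\<close> to the
  pattern.\<close>

lemma two_components_exact:
  assumes C: "C \<in> components" and D: "D \<in> components" "C \<noteq> D"
    and R: "R = {y1, y2, y3}" "y1 \<noteq> y2" "y1 \<noteq> y3" "y2 \<noteq> y3"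
    and v: "v1 \<in> C" "v2 \<in> C" "v3 \<in> C" "adj v1 y1" "adj v2 y2" "adj v3 y3"
    and u: "u \<in> D" "adj u y1"
  shows "C = {v1, v2, v3}"
proof (rule ccontr)
  assume "C \<noteq> {v1, v2, v3}"
  then obtain w where w: "w \<in> C" "w \<notin> {v1, v2, v3}" using v by blast
  have inR: "y1 \<in> R" "y2 \<in> R" "y3 \<in> R" using R by auto
  note un = unattached_not_adj(1)[OF C w R(1) v]
  show False
    by (rule edge_outside[OF inR R(2-4) D(1) u comp_elem(1)[OF C w(1)]])
      (use comps_not_adj[OF D(1) C D(2)[symmetric] u(1) w(1)] un inR in auto)
qed

text \<open>Suppose \<open>va\<close> and \<open>vb\<close> are not adjacent. If \<open>ua\<close> and \<open>ub\<close> are adjacent, they form the edge of the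
  pattern, with \<open>va\<close>, \<open>vb\<close> and \<open>c\<close> as isolated vertices. If not, deleting \<open>vc\<close> and \<open>uc\<close> leaves three
  components.\<close>

lemma two_components_adj:
  assumes S: "S = {}" and C: "C \<in> components" and D: "D \<in> components" "C \<noteq> D" and UCD: "U = C \<union> D"
    and R: "R = {a, b, c}" "a \<noteq> b" "a \<noteq> c" "b \<noteq> c"
    and sp: "C = {va, vb, vc}" "adj va a" "adj vb b" "adj vc c"
    and su: "D = {ua, ub, uc}" "adj ua a" "adj ub b" "adj uc c"
  shows "adj va vb"
proof (rule ccontr)
  assume no: "\<not> adj va vb"
  have inC: "va \<in> C" "vb \<in> C" "vc \<in> C" and inR: "a \<in> R" "b \<in> R" "c \<in> R"
    and inD: "ua \<in> D" "ub \<in> D" "uc \<in> D" using sp R su by auto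
  note dist = spokes_distinct[OF C inC(1,2) sp(2,3) inR(1,2) R(2)]
    spokes_distinct[OF C inC(1,3) sp(2,4) inR(1,3) R(3)]
    spokes_distinct[OF C inC(2,3) sp(3,4) inR(2,3) R(4)]
    spokes_distinct[OF D(1) inD(1,2) su(2,3) inR(1,2) R(2)]
    spokes_distinct[OF D(1) inD(1,3) su(2,4) inR(1,3) R(3)]
    spokes_distinct[OF D(1) inD(2,3) su(3,4) inR(2,3) R(4)]
  note el = comp_elem[OF C inC(1)] comp_elem[OF C inC(2)] comp_elem[OF C inC(3)]
    comp_elem[OF D(1) inD(1)] comp_elem[OF D(1) inD(2)] comp_elem[OF D(1) inD(3)]
    R_elem[OF inR(1)] R_elem[OF inR(2)] R_elem[OF inR(3)]
  note cd = comps_not_adj[OF C D]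
  have na: "p = va \<or> p = ua" if "adj a p" for p
    using R_nbr_comp[OF C inC(1) inR(1) sp(2) that] R_nbr_comp[OF D(1) inD(1) inR(1) su(2) that]
      S UCD by blast
  have nb: "p = vb \<or> p = ub" if "adj b p" for p
    using R_nbr_comp[OF C inC(2) inR(2) sp(3) that] R_nbr_comp[OF D(1) inD(2) inR(2) su(3) that]
      S UCD by blast
  have nc: "p = vc \<or> p = uc" if "adj c p" for p
    using R_nbr_comp[OF C inC(3) inR(3) sp(4) that] R_nbr_comp[OF D(1) inD(3) inR(3) su(4) that]
      S UCD by blast
  show False
  proof (cases "adj ua ub")
    case True
    have "\<not> adj ua va" "\<not> adj ua vb" "\<not> adj ub va" "\<not> adj ub vb"
      using cd[of va ua] cd[of va ub] cd[of vb ua] cd[of vb ub] inC inD adj_sym by blast+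
    moreover have "ua \<noteq> va" "ua \<noteq> vb" "ub \<noteq> va" "ub \<noteq> vb"
      using cd[of va ua] cd[of va ub] cd[of vb ua] cd[of vb ub] inC inD by blast+
    moreover have "\<not> adj ua c" "\<not> adj ub c" "\<not> adj va c" "\<not> adj vb c" using dist by blast+
    ultimately show False
      using free[of ua ub va vb c] True no el dist inR by auto
  next
    case nou: False
    have "t * 3 \<le> card {vc, uc}"
    proof (rule toughness3[of _ "{a, va, ua}" "{b, vb, ub}" "{c}"])
      show "{vc, uc} \<subseteq> N" using el by auto
      have x: "va \<noteq> uc" "ua \<noteq> vc" "vb \<noteq> uc" "ub \<noteq> vc" "va \<noteq> ub" "ua \<noteq> vb"
        using cd[of va uc] cd[of vc ua] cd[of vb uc] cd[of vc ub] cd[of va ub] cd[of vb ua] inC inD by blast+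
      show "closed_in adj (N - {vc, uc}) {a, va, ua}"
      proof (rule closed_triple)
        show "p \<in> {vc, uc} \<or> p \<in> {a, va, ua}" if "adj a p" for p using na[OF that] by blast
        show "p \<in> {vc, uc} \<or> p \<in> {a, va, ua}" if "adj va p" for p
          using component_nbrs[OF C inC(1) inR(1) sp(2) that] that no S sp(1) by blast
        show "p \<in> {vc, uc} \<or> p \<in> {a, va, ua}" if "adj ua p" for p
          using component_nbrs[OF D(1) inD(1) inR(1) su(2) that] that nou S su(1) by blast
      qed (use el dist inR x in auto)
      show "closed_in adj (N - {vc, uc}) {b, vb, ub}"
      proof (rule closed_triple)
        show "p \<in> {vc, uc} \<or> p \<in> {b, vb, ub}" if "adj b p" for p using nb[OF that] by blast
        show "p \<in> {vc, uc} \<or> p \<in> {b, vb, ub}" if "adj vb p" for p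
          using component_nbrs[OF C inC(2) inR(2) sp(3) that] that no adj_sym S sp(1) by blast
        show "p \<in> {vc, uc} \<or> p \<in> {b, vb, ub}" if "adj ub p" for p
          using component_nbrs[OF D(1) inD(2) inR(2) su(3) that] that nou adj_sym S su(1) by blast
      qed (use el dist inR x in auto)
      show "closed_in adj (N - {vc, uc}) {c}"
      proof (rule closed_single)
        show "p \<in> {vc, uc}" if "adj c p" for p using nc[OF that] by blast
      qed (use el inR in auto)
      show "{a, va, ua} \<inter> {b, vb, ub} = {}" using R el dist inR x by auto
      show "{a, va, ua} \<inter> {c} = {}" "{b, vb, ub} \<inter> {c} = {}" using R el inR by auto
    qed auto
    moreover have "card {vc, uc} \<le> 2" by (simp add: card_insert_if)
    ultimately show False using t_ge_1 by linarith
  qed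
qed

text \<open>Since \<open>S\<close> is empty, a third component would be separated from the rest by at most one vertex.\<close>

lemma two_components_H0:
  assumes S: "S = {}" and CD: "{C. big C} = {C, D}" "C \<noteq> D"
  shows "H0_shape adj N"
proof -
  have bC: "big C" and bD: "big D" using CD by blast+
  note C = bigD[OF bC] and D = bigD[OF bD]
  have "E \<in> {C, D}" if E: "E \<in> components" for E
  proof (rule ccontr)
    assume "E \<notin> {C, D}"
    then have "\<not> big E" using CD(1) by blast
    then have small: "card (att E) \<le> 1" using big_iff[OF E] by linarith
    then have "att E \<noteq> R" using card_R_eq_3 by force
    then have "t * 2 \<le> card S + card (att E)" by (rule comp_cut[OF E])
    then show False using S small t_ge_1 by simp
  qed
  then have UCD: "U = C \<union> D"
    using components_cover[of "{C, D}"] comps_subset[OF C] comps_subset[OF D] by blast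
  obtain y1 y2 y3 v1 v2 v3 where R: "R = {y1, y2, y3}" "y1 \<noteq> y2" "y1 \<noteq> y3" "y2 \<noteq> y3"
    and v: "v1 \<in> C" "v2 \<in> C" "v3 \<in> C" "adj v1 y1" "adj v2 y2" "adj v3 y3"
    using spokes[OF card_R_eq_3 bC] .
  have inR: "y1 \<in> R" "y2 \<in> R" "y3 \<in> R" using R by auto
  have "att D = R" by (rule card_R_3_cases(1)[OF card_R_eq_3 bD])
  then have "y1 \<in> att D" "y2 \<in> att D" "y3 \<in> att D" using inR by auto
  then obtain u1 u2 u3 where u: "u1 \<in> D" "u2 \<in> D" "u3 \<in> D" "adj u1 y1" "adj u2 y2" "adj u3 y3"
    by (elim attE) blast
  have eC: "C = {v1, v2, v3}" by (rule two_components_exact[OF C D CD(2) R v u(1,4)])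
  have eD: "D = {u1, u2, u3}" by (rule two_components_exact[OF D C CD(2)[symmetric] R u v(1,4)])
  note adjC = two_components_adj[OF S C D CD(2) UCD]
  have UDC: "U = D \<union> C" using UCD by blast
  note adjD = two_components_adj[OF S D C CD(2)[symmetric] UDC]
  have "adj v1 v2" by (rule adjC[OF R eC v(4-6) eD u(4-6)])
  moreover have "adj u1 u2" by (rule adjD[OF R eD u(4-6) eC v(4-6)])
  moreover have "adj v2 v3"
    by (rule adjC[of y2 y3 y1 v2 v3 v1 u2 u3 u1]) (use R v u eC eD in auto)
  moreover have "adj u2 u3"
    by (rule adjD[of y2 y3 y1 u2 u3 u1 v2 v3 v1]) (use R v u eC eD in auto)
  moreover have "adj v1 v3"
    by (rule adjC[of y1 y3 y2 v1 v3 v2 u1 u3 u2]) (use R v u eC eD in auto)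
  moreover have "adj u1 u3"
    by (rule adjD[of y1 y3 y2 u1 u3 u2 v1 v3 v2]) (use R v u eC eD in auto)
  moreover have "\<forall>p. adj y p \<longleftrightarrow> p = c \<or> p = d"
    if c: "c \<in> C" "adj c y" and d: "d \<in> D" "adj d y" and y: "y \<in> R" for c d y
    using R_nbr_comp[OF C c(1) y c(2)] R_nbr_comp[OF D d(1) y d(2)] S UCD
      adj_sym[OF c(2)] adj_sym[OF d(2)] by blast
  then have "\<forall>p. adj y1 p \<longleftrightarrow> p = v1 \<or> p = u1" "\<forall>p. adj y2 p \<longleftrightarrow> p = v2 \<or> p = u2"
    "\<forall>p. adj y3 p \<longleftrightarrow> p = v3 \<or> p = u3"
    using v u inR by blast+
  moreover have "distinct [y1, y2, y3, v1, v2, v3, u1, u2, u3]"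
  proof -
    note dist = spokes_distinct(1)[OF C v(1,2,4,5) inR(1,2) R(2)]
      spokes_distinct(1)[OF C v(1,3,4,6) inR(1,3) R(3)]
      spokes_distinct(1)[OF C v(2,3,5,6) inR(2,3) R(4)]
      spokes_distinct(1)[OF D u(1,2,4,5) inR(1,2) R(2)]
      spokes_distinct(1)[OF D u(1,3,4,6) inR(1,3) R(3)]
      spokes_distinct(1)[OF D u(2,3,5,6) inR(2,3) R(4)]
    have "C \<inter> D = {}" using comps_eqI[OF C D] CD(2) by blast
    moreover have "C \<inter> R = {}" "D \<inter> R = {}" using comp_elem(4)[OF C] comp_elem(4)[OF D] by blast+
    ultimately show ?thesis using dist R v u inR by auto
  qed
  moreover have "N = {y1, y2, y3, v1, v2, v3, u1, u2, u3}"
    using UCD eC eD S R(1) R_N by blast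
  moreover have "\<forall>v\<in>{v1, v2, v3}. \<forall>u\<in>{u1, u2, u3}. \<not> adj v u"
    using comps_not_adj(1)[OF C D CD(2)] unfolding eC eD by blast
  ultimately show ?thesis unfolding H0_shape_def by blast
qed

text \<open>If one of the edges were missing, deleting \<open>x\<close> and a vertex of \<open>C\<close> would leave three components:
  \<open>va\<close> for the pair \<open>vb, vc\<close>, and \<open>vc\<close> for the pair \<open>va, vb\<close>.\<close>

lemma pendant_adj:
  assumes x: "S = {x}" and C: "C \<in> components" and D: "{d} \<in> components" "C \<noteq> {d}" and UC: "U = C \<union> {d}"
    and R: "R = {a, b, c}" "a \<noteq> b" "a \<noteq> c" "b \<noteq> c"
    and sp: "C = {va, vb, vc}" "adj va a" "adj vb b" "adj vc c" and d: "adj d a"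
  shows "adj vb vc" "adj va vb"
proof -
  have inC: "va \<in> C" "vb \<in> C" "vc \<in> C" and inR: "a \<in> R" "b \<in> R" "c \<in> R" using sp R by auto
  have dD: "d \<in> {d}" by simp
  note dist = spokes_distinct[OF C inC(1,2) sp(2,3) inR(1,2) R(2)]
    spokes_distinct[OF C inC(1,3) sp(2,4) inR(1,3) R(3)]
    spokes_distinct[OF C inC(2,3) sp(3,4) inR(2,3) R(4)]
  note el = comp_elem[OF C inC(1)] comp_elem[OF C inC(2)] comp_elem[OF C inC(3)]
    comp_elem[OF D(1) dD] R_elem[OF inR(1)] R_elem[OF inR(2)] R_elem[OF inR(3)]
  have dC: "d \<notin> C" using comps_eqI[OF C D(1)] D(2) by blast
  have nd: "p = x \<or> p = a" if "adj d p" for p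
    using component_nbrs[OF D(1) dD inR(1) d that] x by blast
  have nbc: "\<not> adj b d" "\<not> adj c d"
    using one_R_neighbour[OF dD D(1) d inR(1)] inR R adj_sym by blast+
  have na: "p = x \<or> p = va \<or> p = d" if "adj a p" for p
    using R_nbr_comp[OF C inC(1) inR(1) sp(2) that] x UC by blast
  have nb: "p = x \<or> p = vb" if "adj b p" for p
    using R_nbr_comp[OF C inC(2) inR(2) sp(3) that] x UC nbc that by blast
  have nc: "p = x \<or> p = vc" if "adj c p" for p
    using R_nbr_comp[OF C inC(3) inR(3) sp(4) that] x UC nbc that by blast
  have nva: "p = x \<or> p = a \<or> p = vb \<or> p = vc" if "adj va p" for p
    using component_nbrs[OF C inC(1) inR(1) sp(2) that] x sp(1) by blast
  have nvb: "p = x \<or> p = b \<or> p = va \<or> p = vc" if "adj vb p" for p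
    using component_nbrs[OF C inC(2) inR(2) sp(3) that] x sp(1) by blast
  have nvc: "p = x \<or> p = c \<or> p = va \<or> p = vb" if "adj vc p" for p
    using component_nbrs[OF C inC(3) inR(3) sp(4) that] x sp(1) by blast
  have xN: "x \<in> N" using x S_N by blast
  show "adj vb vc"
  proof (rule ccontr)
    assume no: "\<not> adj vb vc"
    have "t * 3 \<le> card {x, va}"
    proof (rule toughness3[of _ "{a, d}" "{b, vb}" "{c, vc}"])
      show "closed_in adj (N - {x, va}) {a, d}"
      proof (rule closed_pair)
        show "p \<in> {x, va} \<or> p = d" if "adj a p" for p using na[OF that] by blast
        show "p \<in> {x, va} \<or> p = a" if "adj d p" for p using nd[OF that] by blast
      qed (use el x dist inR inC dC in auto)
      show "closed_in adj (N - {x, va}) {b, vb}"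
      proof (rule closed_pair)
        show "p \<in> {x, va} \<or> p = vb" if "adj b p" for p using nb[OF that] by blast
        show "p \<in> {x, va} \<or> p = b" if "adj vb p" for p using nvb[OF that] that no by blast
      qed (use el x dist inR in auto)
      show "closed_in adj (N - {x, va}) {c, vc}"
      proof (rule closed_pair)
        show "p \<in> {x, va} \<or> p = vc" if "adj c p" for p using nc[OF that] by blast
        show "p \<in> {x, va} \<or> p = c" if "adj vc p" for p using nvc[OF that] that no adj_sym by blast
      qed (use el x dist inR in auto)
    qed (use R el dist inR xN inC dC in auto)
    moreover have "card {x, va} \<le> 2" by (simp add: card_insert_if)
    ultimately show False using t_ge_1 by linarith
  qed
  show "adj va vb"
  proof (rule ccontr)
    assume no: "\<not> adj va vb"
    have "t * 3 \<le> card {x, vc}"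
    proof (rule toughness3[of _ "{a, d, va}" "{b, vb}" "{c}"])
      show "closed_in adj (N - {x, vc}) {a, d, va}"
      proof (rule closed_triple)
        show "p \<in> {x, vc} \<or> p \<in> {a, d, va}" if "adj a p" for p using na[OF that] by blast
        show "p \<in> {x, vc} \<or> p \<in> {a, d, va}" if "adj d p" for p using nd[OF that] by blast
        show "p \<in> {x, vc} \<or> p \<in> {a, d, va}" if "adj va p" for p using nva[OF that] that no by blast
      qed (use el x dist inR inC dC in auto)
      show "closed_in adj (N - {x, vc}) {b, vb}"
      proof (rule closed_pair)
        show "p \<in> {x, vc} \<or> p = vb" if "adj b p" for p using nb[OF that] by blast
        show "p \<in> {x, vc} \<or> p = b" if "adj vb p" for p using nvb[OF that] that no adj_sym by blast
      qed (use el x dist inR in auto)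
      show "closed_in adj (N - {x, vc}) {c}"
      proof (rule closed_single)
        show "p \<in> {x, vc}" if "adj c p" for p using nc[OF that] by blast
      qed (use el x inR in auto)
    qed (use R el dist inR xN inC dC in auto)
    moreover have "card {x, vc} \<le> 2" by (simp add: card_insert_if)
    ultimately show False using t_ge_1 by linarith
  qed
qed

text \<open>A second component \<open>D\<close> has one attachment \<open>y1\<close>, and the forbidden pattern shrinks it to a vertex \<open>d\<close>
  and excludes any third component. The resulting graph is again of kite shape, with the roles
  changed: \<open>d\<close> replaces \<open>y1\<close> among the three vertices of degree two, and \<open>y1\<close> joins the vertices of
  \<open>C\<close>, with \<open>v1\<close> adjacent to all the others.\<close>

lemma pendant_kite:
  assumes x: "S = {x}" and Cb: "{C. big C} = {C}" and D: "D \<in> components" "D \<noteq> C"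
  shows "kite_shape adj N"
proof -
  have bC: "big C" using Cb by blast
  note C = bigD[OF bC]
  have attC: "att C = R" by (rule card_R_3_cases(1)[OF card_R_eq_3 bC])
  have small: "\<exists>y. att E = {y}" if E: "E \<in> components" "E \<noteq> C" for E
  proof -
    have "\<not> big E" using Cb E(2) by blast
    then have le: "card (att E) \<le> 1" using big_iff[OF E(1)] by linarith
    then have "att E \<noteq> R" using card_R_eq_3 by force
    then have "t * 2 \<le> card S + card (att E)" by (rule comp_cut[OF E(1)])
    then have "card (att E) \<noteq> 0" using x t_ge_1 by (intro notI) simp
    then have "card (att E) = 1" using le by linarith
    then show ?thesis by (meson card_1_singletonE)
  qed
  obtain y1 where y1: "att D = {y1}" using small[OF D] by blast
  then obtain d where d: "d \<in> D" "adj d y1" "adj y1 d" "y1 \<in> R" using attE[of y1 D] by blast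
  obtain y2 y3 where R: "R = {y1, y2, y3}" "y1 \<noteq> y2" "y1 \<noteq> y3" "y2 \<noteq> y3"
    using card3E[OF card_R_eq_3 d(4)] .
  have inR: "y1 \<in> R" "y2 \<in> R" "y3 \<in> R" using R by auto
  have "y1 \<in> att C" "y2 \<in> att C" "y3 \<in> att C" using attC inR by auto
  then obtain v1 v2 v3 where v: "v1 \<in> C" "v2 \<in> C" "v3 \<in> C" "adj v1 y1" "adj v2 y2" "adj v3 y3"
    by (elim attE) blast
  note dist = spokes_distinct[OF C v(1,2,4,5) inR(1,2) R(2)]
    spokes_distinct[OF C v(1,3,4,6) inR(1,3) R(3)]
    spokes_distinct[OF C v(2,3,5,6) inR(2,3) R(4)]
  note el = comp_elem[OF C v(1)] comp_elem[OF C v(2)] comp_elem[OF C v(3)] comp_elem[OF D(1) d(1)]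
    R_elem[OF inR(1)] R_elem[OF inR(2)] R_elem[OF inR(3)]
  have dn: "\<not> adj d y2" "\<not> adj d y3"
    using one_R_neighbour[OF d(1) D(1) d(2,4)] inR R by auto
  have cross: "\<not> adj c e" "\<not> adj e c" "c \<noteq> e" if "c \<in> C" "e \<in> E" "E \<in> components" "E \<noteq> C" for c e E
    using comps_not_adj[OF C that(3) that(4)[symmetric] that(1,2)] adj_sym by blast+
  have eD: "D = {d}"
  proof (rule ccontr)
    assume "D \<noteq> {d}"
    then obtain p where p: "p \<in> D" "p \<noteq> d" using d(1) by blast
    have "\<not> adj p z" if "z \<in> R" for z
    proof
      assume "adj p z"
      then have "z \<in> att D" using that p(1) unfolding attach_def by blast
      then show False using one_C_neighbour[OF D(1) d(1) p(1) d(2,4) p(2)] y1 \<open>adj p z\<close> by simp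
    qed
    then show False
      using edge_outside[OF inR(2,1,3) R(2)[symmetric] R(4,3) C v(2,5) comp_elem(1)[OF D(1) p(1)]]
        cross[OF v(2) p(1) D] inR by metis
  qed
  have eC: "C = {v1, v2, v3}"
  proof (rule ccontr)
    assume "C \<noteq> {v1, v2, v3}"
    then obtain w where w: "w \<in> C" "w \<notin> {v1, v2, v3}" using v by blast
    show False
      using edge_outside[OF inR R(2-4) D(1) d(1,2) comp_elem(1)[OF C w(1)]]
        cross[OF w(1) d(1) D] unattached_not_adj(1)[OF C w R(1) v] inR by metis
  qed
  have "E \<in> {C, D}" if E: "E \<in> components" for E
  proof (rule ccontr)
    assume n: "E \<notin> {C, D}"
    obtain z where z: "att E = {z}" using small[OF E] n by blast
    then obtain e where e: "e \<in> E" "adj e z" "z \<in> R" using attE[of z E] by blast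
    have de: "\<not> adj d e" "d \<noteq> e" using comps_not_adj[OF D(1) E _ d(1) e(1)] n by auto
    have ce: "\<not> adj c e" "\<not> adj e c" "c \<noteq> e" if "c \<in> C" for c
      using cross[OF that e(1) E] n by auto
    have eN: "e \<in> N" "e \<notin> R" using comp_elem[OF E e(1)] by auto
    have er: "\<not> adj e y" "\<not> adj y e" if "y \<in> R" "y \<noteq> z" for y
      using one_R_neighbour[OF e(1) E e(2,3) that] adj_sym by blast+
    note cd = cross[OF v(2) d(1) D] cross[OF v(3) d(1) D]
    note basics = d(3) v adj_sym[OF v(5)] de ce[OF v(2)] ce[OF v(3)] eN el dist dn adj_sym[of y2 d] adj_sym[of y3 d]
      R inR cd R_independent[OF inR(1,2)] R_independent[OF inR(1,3)] R_independent[OF inR(2,3)]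
    have vy: "\<not> adj y1 v2" "\<not> adj y1 v3" "\<not> adj y2 v3"
      using one_R_neighbour[OF v(2) C v(5) inR(2,1)] one_R_neighbour[OF v(3) C v(6) inR(3,1)]
        one_R_neighbour[OF v(3) C v(6) inR(3,2)] R(2-4) adj_sym by blast+
    \<comment> \<open>The edge of the pattern is \<open>y2, v2\<close> if \<open>E\<close> hangs on the same vertex as \<open>D\<close>, and \<open>y1, d\<close> otherwise.\<close>
    consider "z = y1" | "z = y2" | "z = y3" using e(3) R(1) by blast
    then show False
    proof cases
      case 1
      then show False
        using er[OF inR(2)] er[OF inR(3)] basics by (intro free[of y2 v2 y3 d e]) auto
    next
      case 2
      then show False
        using er[OF inR(1)] er[OF inR(3)] basics vy by (intro free[of y1 d e y3 v2]) auto
    next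
      case 3
      then show False
        using er[OF inR(1)] er[OF inR(2)] basics vy by (intro free[of y1 d e y2 v3]) auto
    qed
  qed
  then have UCD: "U = C \<union> {d}"
    using components_cover[of "{C, D}"] comps_subset[OF C] comps_subset[OF D(1)] eD by blast
  have Dd: "{d} \<in> components" "C \<noteq> {d}" using D eD by auto
  have a23: "adj v2 v3" and a12: "adj v1 v2"
    using pendant_adj[OF x C Dd UCD R eC v(4-6) d(2)] by auto
  have a13: "adj v1 v3"
    by (rule pendant_adj(2)[OF x C Dd UCD, of y1 y3 y2 v1 v3 v2]) (use R eC v d in auto)
  have dC: "d \<notin> C" using cross(3)[OF _ d(1) D] by blast
  have nd: "adj d p \<longleftrightarrow> p = x \<or> p = y1" for p
  proof -
    have sub: "q = x \<or> q = y1" if "adj d q" for q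
      using component_nbrs[OF Dd(1) _ inR(1) d(2) that] x by blast
    obtain q where "adj d q" "q \<noteq> y1" using second_neighbour[of d y1] el by blast
    then have "adj d x" using sub by blast
    then show ?thesis using sub d(2) by blast
  qed
  have n2: "adj y2 p \<longleftrightarrow> p = x \<or> p = v2" for p
    by (rule R_nbrs[OF x C v(2) inR(2) v(5)]) (use UCD dn adj_sym in blast)
  have n3: "adj y3 p \<longleftrightarrow> p = x \<or> p = v3" for p
    by (rule R_nbrs[OF x C v(3) inR(3) v(6)]) (use UCD dn adj_sym in blast)
  have "distinct [x, d, y2, y3, v2, v3, y1, v1]"
    using R dist el inR x dC v by auto
  moreover have "N = {x, d, y2, y3, v2, v3, y1, v1}"
    using UCD eC R(1) x S_N R_N by blast
  ultimately show ?thesis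
    unfolding kite_shape_def
    using nd n2 n3 a23 adj_sym[OF a12] adj_sym[OF a13] adj_sym[OF v(4)] by blast
qed

text \<open>Let \<open>Z\<close> be the set of vertices of \<open>C\<close> without a neighbour in \<open>R\<close>. By the forbidden pattern \<open>Z\<close> is
  independent and each of its elements is adjacent to \<open>v1\<close>, \<open>v2\<close> and \<open>v3\<close>. Deleting these three
  and \<open>x\<close> isolates \<open>R\<close> and \<open>Z\<close>, so \<open>|Z| \<le> 1\<close>. If \<open>Z = {w}\<close> and \<open>v1, v2, v3\<close> were
  independent, deleting \<open>x\<close> and \<open>w\<close> would leave three components.\<close>

lemma single_component_shape:
  assumes x: "S = {x}" and Cb: "big C" and UC: "U = C"
  shows "H1_shape adj N \<or> kite_shape adj N"
proof -
  note C = bigD[OF Cb]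
  obtain y1 y2 y3 v1 v2 v3 where R: "R = {y1, y2, y3}" "y1 \<noteq> y2" "y1 \<noteq> y3" "y2 \<noteq> y3"
    and v: "v1 \<in> C" "v2 \<in> C" "v3 \<in> C" "adj v1 y1" "adj v2 y2" "adj v3 y3"
    using spokes[OF card_R_eq_3 Cb] .
  have inR: "y1 \<in> R" "y2 \<in> R" "y3 \<in> R" using R by auto
  note dist = spokes_distinct[OF C v(1,2,4,5) inR(1,2) R(2)]
    spokes_distinct[OF C v(1,3,4,6) inR(1,3) R(3)]
    spokes_distinct[OF C v(2,3,5,6) inR(2,3) R(4)]
  note el = comp_elem[OF C v(1)] comp_elem[OF C v(2)] comp_elem[OF C v(3)]
    R_elem[OF inR(1)] R_elem[OF inR(2)] R_elem[OF inR(3)]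
  have xN: "x \<in> N" using x S_N by blast
  have n1: "adj y1 p \<longleftrightarrow> p = x \<or> p = v1" and n2: "adj y2 p \<longleftrightarrow> p = x \<or> p = v2"
    and n3: "adj y3 p \<longleftrightarrow> p = x \<or> p = v3" for p
    using R_nbrs[OF x C v(1) inR(1) v(4)] R_nbrs[OF x C v(2) inR(2) v(5)]
      R_nbrs[OF x C v(3) inR(3) v(6)] UC by blast+
  define Z where "Z = C - {v1, v2, v3}"
  have Z: "w \<in> C" "w \<notin> {v1, v2, v3}" "w \<in> U" "w \<in> N" "w \<notin> S" "w \<notin> R" if "w \<in> Z" for w
    using that comp_elem[OF C] unfolding Z_def by auto
  have un: "\<not> adj w y" "\<not> adj y w" if "w \<in> Z" "y \<in> R" for w y
    using unattached_not_adj[OF C Z(1,2)[OF that(1)] R(1) v that(2)] by auto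
  have Zv: "adj v1 w" "adj v2 w" "adj v3 w" if w: "w \<in> Z" for w
  proof -
    note o = edge_outside[OF _ _ _ _ _ _ C _ _ Z(3)[OF w]]
    show "adj v1 w" using o[OF inR R(2-4) v(1,4)] Z(2)[OF w] un[OF w] inR by blast
    show "adj v2 w"
      using o[OF inR(2,1,3) R(2)[symmetric] R(4,3) v(2,5)] Z(2)[OF w] un[OF w] inR by blast
    show "adj v3 w"
      using o[OF inR(3,1,2) R(3)[symmetric] R(4)[symmetric] R(2) v(3,6)] Z(2)[OF w] un[OF w] inR by blast
  qed
  have ZZ: "\<not> adj w w'" if w: "w \<in> Z" "w' \<in> Z" for w w'
  proof
    assume a: "adj w w'"
    then have "w \<noteq> w'" using adj_irrefl by auto
    then show False
      using a free[of w w' y1 y2 y3] Z[OF w(1)] Z[OF w(2)] un[OF w(1)] un[OF w(2)] inR el R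
        R_independent[OF inR(1,2)] R_independent[OF inR(1,3)] R_independent[OF inR(2,3)] by auto
  qed
  have Zone: "w = w'" if w: "w \<in> Z" "w' \<in> Z" for w w'
  proof (rule ccontr)
    assume ne: "w \<noteq> w'"
    let ?W = "{x, v1, v2, v3}" and ?I = "{y1, y2, y3, w, w'}"
    have I: "card ?I = 5" using ne R Z(6)[OF w(1)] Z(6)[OF w(2)] inR by auto
    have nw: "p \<in> ?W" if z: "z \<in> Z" "adj z p" for z p
    proof -
      have "p \<notin> R" using un[OF z(1)] z(2) by blast
      then have "p \<in> S \<or> p \<in> C" using comp_nbr[OF C Z(1)[OF z(1)] z(2)] by blast
      then show ?thesis using ZZ[OF z(1), of p] z(2) x unfolding Z_def by blast
    qed
    have "t * card ?I \<le> card ?W"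
    proof (rule toughness_family[of _ _ "\<lambda>i. {i}"])
      show "?W \<subseteq> N" using xN el by auto
      fix i assume i: "i \<in> ?I"
      show "closed_in adj (N - ?W) {i}"
      proof (rule closed_single)
        show "p \<in> ?W" if "adj i p" for p
          using i that n1[of p] n2[of p] n3[of p] nw[OF w(1), of p] nw[OF w(2), of p] by blast
        show "i \<in> N" "i \<notin> ?W" using i el Z[OF w(1)] Z[OF w(2)] x inR by auto
      qed
    qed (use I in auto)
    moreover have "card ?W \<le> 4" by (simp add: card_insert_if)
    ultimately show False using I t_ge_1 by simp
  qed
  show ?thesis
  proof (cases "Z = {}")
    case True
    then have "C = {v1, v2, v3}" using v unfolding Z_def by blast
    then show ?thesis using single_component_H1[OF x C UC R _ v(4-6)] by blast
  next
    case False
    then obtain w where w: "w \<in> Z" by blast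
    then have eC: "C = {v1, v2, v3, w}" using Zone v unfolding Z_def by blast
    have nw: "p = x \<or> p \<in> {v1, v2, v3}" if "adj w p" for p
      using comp_nbr[OF C Z(1)[OF w] that] un(1)[OF w, of p] ZZ[OF w w] that x eC by blast
    have "adj v1 v2 \<or> adj v1 v3 \<or> adj v2 v3"
    proof (rule ccontr)
      assume no: "\<not> (adj v1 v2 \<or> adj v1 v3 \<or> adj v2 v3)"
      have pair: "closed_in adj (N - {x, w}) {y, c}"
        if c: "c \<in> {v1, v2, v3}" and y: "y \<in> R" "adj c y" for c y
      proof (rule closed_pair)
        have cC: "c \<in> C" using c v by blast
        show "y \<in> N" "y \<notin> {x, w}" using R_elem[OF y(1)] x Z(6)[OF w] y(1) by auto
        show "c \<in> N" "c \<notin> {x, w}" using comp_elem[OF C cC] x Z(2)[OF w] c by auto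
        show "p \<in> {x, w} \<or> p = c" if "adj y p" for p
          using R_nbr_comp[OF C cC y that] UC x by blast
        show "p \<in> {x, w} \<or> p = y" if "adj c p" for p
          using component_nbrs[OF C cC y that] that c no x eC adj_sym by blast
      qed
      have "t * 3 \<le> card {x, w}"
        by (rule toughness3[of _ "{y1, v1}" "{y2, v2}" "{y3, v3}"])
          (use pair v inR xN Z(4)[OF w] R dist el in auto)
      moreover have "card {x, w} \<le> 2" by (simp add: card_insert_if)
      ultimately show False using t_ge_1 by linarith
    qed
    moreover have "distinct [x, y1, y2, y3, v1, v2, v3, w]"
      using R dist el inR x Z[OF w] by auto
    moreover have "N = {x, y1, y2, y3, v1, v2, v3, w}"
      using UC eC R(1) x S_N R_N by blast
    ultimately have "kite_shape adj N"
    proof (elim disjE)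
      assume "adj v1 v2" and d: "distinct [x, y1, y2, y3, v1, v2, v3, w]"
        and N: "N = {x, y1, y2, y3, v1, v2, v3, w}"
      moreover have "distinct [x, y3, y1, y2, v1, v2, v3, w]" "N = {x, y3, y1, y2, v1, v2, v3, w}"
        using d N by auto
      ultimately show ?thesis unfolding kite_shape_def using n1 n2 n3 Zv[OF w] by blast
    next
      assume "adj v1 v3" and d: "distinct [x, y1, y2, y3, v1, v2, v3, w]"
        and N: "N = {x, y1, y2, y3, v1, v2, v3, w}"
      moreover have "distinct [x, y2, y1, y3, v1, v3, v2, w]" "N = {x, y2, y1, y3, v1, v3, v2, w}"
        using d N by auto
      ultimately show ?thesis unfolding kite_shape_def using n1 n2 n3 Zv[OF w] by blast
    next
      assume "adj v2 v3" and d: "distinct [x, y1, y2, y3, v1, v2, v3, w]"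
        and N: "N = {x, y1, y2, y3, v1, v2, v3, w}"
      moreover have "distinct [x, y1, y2, y3, v2, v3, v1, w]" "N = {x, y1, y2, y3, v2, v3, v1, w}"
        using d N by auto
      ultimately show ?thesis unfolding kite_shape_def using n1 n2 n3 Zv[OF w] by blast
    qed
    then show ?thesis by blast
  qed
qed

lemma exceptional_shape: "H0_shape adj N \<or> H1_shape adj N \<or> kite_shape adj N"
  using card_R_3_cases(2)[OF card_R_eq_3]
proof (elim disjE conjE exE)
  fix C D assume "S = {}" "C \<noteq> D" "{C. big C} = {C, D}"
  then show ?thesis using two_components_H0 by blast
next
  fix x C assume x: "S = {x}" and Cb: "{C. big C} = {C}"
  have bC: "big C" using Cb by blast
  show ?thesis
  proof (cases "\<exists>D\<in>components. D \<noteq> C")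
    case True
    then show ?thesis using pendant_kite[OF x Cb] by blast
  next
    case False
    then have "U = C" using components_cover[of "{C}"] comps_subset[OF bigD[OF bC]] by blast
    then show ?thesis using single_component_shape[OF x bC] by blast
  qed
qed

end

section \<open>The forbidden linear forests as patterns\<close>

lemma verts_disjoint_union: "verts (disjoint_union Gs) = (\<Union>i<length Gs. Pair i ` verts (Gs ! i))"
  and edges_disjoint_union: "edges (disjoint_union Gs) = (\<Union>i<length Gs. (`) (Pair i) ` edges (Gs ! i))"
  unfolding disjoint_union_def by simp_all

lemma verts_path_graph: "verts (path_graph b) = {..<b}"
  and edges_path_graph: "edges (path_graph b) = (\<lambda>j. {j, Suc j}) ` {..<b - 1}"
  unfolding path_graph_def by auto

lemmas forest_simps = verts_disjoint_union edges_disjoint_union verts_path_graph edges_path_graph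
  lessThan_Suc numeral_eq_Suc

lemma no_pattern_P4_P1:
  assumes "simple_graph G" "induced_free Q G" "Q \<simeq> disjoint_union [path_graph 4, path_graph 1]"
  shows "\<not> induced_pattern (adjacent G) (verts G) {(0, 1), (1, 2), (2, 3)} [a, b, c, d, e]"
proof (rule induced_free_no_pattern[OF assms(1-3), where vs = "[(0, 0), (0, 1), (0, 2), (0, 3), (1, 0)]"])
  let ?vs = "[(0, 0), (0, 1), (0, 2), (0, 3), (1, 0)]"
  show "{?vs ! j, ?vs ! i} \<in> edges (disjoint_union [path_graph 4, path_graph 1]) \<longleftrightarrow> (j, i) \<in> {(0, 1), (1, 2), (2, 3)}"
    if "i < length ?vs" "j < i" for i j
    using that by (auto simp: forest_simps less_Suc_eq doubleton_eq_iff)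
qed (auto simp: forest_simps)

lemma no_pattern_P3_2P1:
  assumes "simple_graph G" "induced_free Q G" "Q \<simeq> disjoint_union (path_graph 3 # replicate 2 (path_graph 1))"
  shows "\<not> induced_pattern (adjacent G) (verts G) {(0, 1), (1, 2)} [a, b, c, d, e]"
proof (rule induced_free_no_pattern[OF assms(1-3), where vs = "[(0, 0), (0, 1), (0, 2), (1, 0), (2, 0)]"])
  let ?vs = "[(0, 0), (0, 1), (0, 2), (1, 0), (2, 0)]"
  show "{?vs ! j, ?vs ! i} \<in> edges (disjoint_union (path_graph 3 # replicate 2 (path_graph 1))) \<longleftrightarrow> (j, i) \<in> {(0, 1), (1, 2)}"
    if "i < length ?vs" "j < i" for i j
    using that by (auto simp: forest_simps less_Suc_eq doubleton_eq_iff)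
qed (auto simp: forest_simps)

lemma no_pattern_P2_3P1:
  assumes "simple_graph G" "induced_free Q G" "Q \<simeq> disjoint_union (path_graph 2 # replicate 3 (path_graph 1))"
  shows "\<not> induced_pattern (adjacent G) (verts G) {(0, 1)} [a, b, c, d, e]"
proof (rule induced_free_no_pattern[OF assms(1-3), where vs = "[(0, 0), (0, 1), (1, 0), (2, 0), (3, 0)]"])
  let ?vs = "[(0, 0), (0, 1), (1, 0), (2, 0), (3, 0)]"
  show "{?vs ! j, ?vs ! i} \<in> edges (disjoint_union (path_graph 2 # replicate 3 (path_graph 1))) \<longleftrightarrow> (j, i) \<in> {(0, 1)}"
    if "i < length ?vs" "j < i" for i j
    using that by (auto simp: forest_simps less_Suc_eq doubleton_eq_iff)
qed (auto simp: forest_simps)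

lemma no_pattern_P3_P2:
  assumes "simple_graph G" "induced_free Q G" "Q \<simeq> disjoint_union [path_graph 3, path_graph 2]"
  shows "\<not> induced_pattern (adjacent G) (verts G) {(0, 1), (1, 2), (3, 4)} [a, b, c, d, e]"
proof (rule induced_free_no_pattern[OF assms(1-3), where vs = "[(0, 0), (0, 1), (0, 2), (1, 0), (1, 1)]"])
  let ?vs = "[(0, 0), (0, 1), (0, 2), (1, 0), (1, 1)]"
  show "{?vs ! j, ?vs ! i} \<in> edges (disjoint_union [path_graph 3, path_graph 2]) \<longleftrightarrow> (j, i) \<in> {(0, 1), (1, 2), (3, 4)}"
    if "i < length ?vs" "j < i" for i j
    using that by (auto simp: forest_simps less_Suc_eq doubleton_eq_iff)
qed (auto simp: forest_simps)

lemma no_pattern_2P2_P1: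
  assumes "simple_graph G" "induced_free Q G" "Q \<simeq> disjoint_union (replicate 2 (path_graph 2) @ [path_graph 1])"
  shows "\<not> induced_pattern (adjacent G) (verts G) {(0, 1), (2, 3)} [a, b, c, d, e]"
proof (rule induced_free_no_pattern[OF assms(1-3), where vs = "[(0, 0), (0, 1), (1, 0), (1, 1), (2, 0)]"])
  let ?vs = "[(0, 0), (0, 1), (1, 0), (1, 1), (2, 0)]"
  show "{?vs ! j, ?vs ! i} \<in> edges (disjoint_union (replicate 2 (path_graph 2) @ [path_graph 1])) \<longleftrightarrow> (j, i) \<in> {(0, 1), (2, 3)}"
    if "i < length ?vs" "j < i" for i j
    using that by (auto simp: forest_simps less_Suc_eq doubleton_eq_iff)
qed (auto simp: forest_simps)

lemma no_pattern_5P1: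
  assumes "simple_graph G" "induced_free Q G" "Q \<simeq> disjoint_union (replicate 5 (path_graph 1))"
    and "length xs = 5"
  shows "\<not> induced_pattern (adjacent G) (verts G) {} xs"
proof (rule induced_free_no_pattern[OF assms(1-3), where vs = "[(0, 0), (1, 0), (2, 0), (3, 0), (4, 0)]"])
  let ?vs = "[(0, 0), (1, 0), (2, 0), (3, 0), (4, 0)]"
  show "{?vs ! j, ?vs ! i} \<in> edges (disjoint_union (replicate 5 (path_graph 1))) \<longleftrightarrow> (j, i) \<in> {}"
    if "i < length ?vs" "j < i" for i j
    using that by (auto simp: forest_simps less_Suc_eq doubleton_eq_iff)
qed (use assms in \<open>auto simp: forest_simps\<close>)

lemma no_pattern_P5:
  assumes "simple_graph G" "induced_free Q G" "Q \<simeq> path_graph 5"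
  shows "\<not> induced_pattern (adjacent G) (verts G) {(0, 1), (1, 2), (2, 3), (3, 4)} [a, b, c, d, e]"
proof (rule induced_free_no_pattern[OF assms, where vs = "[0..<5]"])
  fix i j :: nat
  assume ij: "i < length [0..<5]" "j < i"
  then have "{[0..<5] ! j, [0..<5] ! i} \<in> edges (path_graph 5) \<longleftrightarrow> i = Suc j"
    unfolding path_graph_def by (auto simp: doubleton_eq_iff)
  moreover have "(j, i) \<in> {(0, 1), (1, 2), (2, 3), (3, 4)} \<longleftrightarrow> i = Suc j"
    using ij by auto
  ultimately show "{[0..<5] ! j, [0..<5] ! i} \<in> edges (path_graph 5) \<longleftrightarrow>
      (j, i) \<in> {(0, 1), (1, 2), (2, 3), (3, 4)}"
    by blast
qed (auto simp: path_graph_def)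

section \<open>The exceptional graphs\<close>

text \<open>Vertex maps out of the exceptional graphs, given by lists of images; the vertices \<open>T n\<close> and \<open>V n\<close> are
  numbered from \<open>1\<close>.\<close>

primrec place :: "'a \<Rightarrow> 'a list \<Rightarrow> 'a list \<Rightarrow> hvertex \<Rightarrow> 'a" where
  "place x ys vs X = x"
| "place x ys vs (T n) = ys ! (n - 1)"
| "place x ys vs (V n) = vs ! (n - 1)"

lemma graph_isomorphism_image:
  assumes H: "simple_graph H" and f: "bij_betw f (verts H) N"
  shows "graph_isomorphism f H \<lparr>verts = N, edges = (`) f ` edges H\<rparr>"
proof -
  have inj: "inj_on f (verts H)" using f unfolding bij_betw_def by blast
  have pull: "{u, v} \<in> edges H" if "u \<in> verts H" "v \<in> verts H" "e \<in> edges H" "{f u, f v} = f ` e" for u v e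
  proof -
    have "f ` {u, v} = f ` e" "e \<subseteq> verts H" using that H unfolding simple_graph_def by auto
    then have "{u, v} = e" using inj_on_image_eq_iff[OF inj, of "{u, v}" e] that by blast
    then show ?thesis using that by simp
  qed
  have push: "{f u, f v} \<in> (`) f ` edges H" if "{u, v} \<in> edges H" for u v
    using imageI[OF that, of "(`) f"] by simp
  have "{u, v} \<in> edges H \<longleftrightarrow> {f u, f v} \<in> (`) f ` edges H"
    if "u \<in> verts H" "v \<in> verts H" for u v
    using pull[OF that] push by (auto elim!: imageE)
  then show ?thesis unfolding graph_isomorphism_def using f by simp
qed

text \<open>The spanning copy of \<open>H\<close> is its image under \<open>f\<close>.\<close>

lemma exceptional_forI:
  assumes G: "simple_graph G" and H: "simple_graph H" and f: "bij_betw f (verts H) (verts G)"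
    and sub: "\<And>e. e \<in> edges H \<Longrightarrow> f ` e \<in> edges G"
    and extra: "\<And>p q. adjacent G p q \<Longrightarrow> {p, q} \<in> (`) f ` edges H \<or>
      (\<exists>w\<in>verts G - f ` {X, T 1, T 2, T 3}. {p, q} = {f X, w})"
  shows "exceptional_for H G"
proof -
  let ?K = "\<lparr>verts = verts G, edges = (`) f ` edges H\<rparr>"
  have KG: "edges ?K \<subseteq> edges G" using sub by auto
  have "\<forall>e\<in>edges ?K. e \<subseteq> verts G \<and> card e = 2"
    using subsetD[OF KG] G unfolding simple_graph_def by blast
  then have K: "spanning_subgraph ?K G"
    using KG G unfolding spanning_subgraph_def simple_graph_def by simp
  have "e \<in> edges_between G (f ` {X}) (verts G - (f ` {T 1, T 2, T 3} \<union> f ` {X}))"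
    if e: "e \<in> edges G - edges ?K" for e
  proof -
    obtain p q where pq: "e = {p, q}" using G e unfolding simple_graph_def by (meson DiffD1 card_2_iff)
    then obtain w where "w \<in> verts G - f ` {X, T 1, T 2, T 3}" "{p, q} = {f X, w}"
      using extra[of p q] e unfolding adjacent_def by auto
    then show ?thesis using e pq unfolding edges_between_def by auto
  qed
  then show ?thesis
    unfolding exceptional_for_def Let_def
    using K graph_isomorphism_image[OF H f] by (intro exI[of _ ?K] exI[of _ f]) blast
qed

lemma simple_H: "simple_graph H0" "simple_graph H1" "simple_graph H2" "simple_graph H3" "simple_graph H4"
  unfolding simple_graph_def H0_def H1_def H2_def H3_def H4_def by simp_all

lemma H1_shape_exceptional:
  assumes G: "simple_graph G" and sh: "H1_shape (adjacent G) (verts G)"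
  shows "exceptional_for H1 G"
proof -
  interpret finite_graph "verts G" "adjacent G" by (rule finite_graph_adjacent[OF G])
  obtain x y1 y2 y3 v1 v2 v3 where d: "distinct [x, y1, y2, y3, v1, v2, v3]"
    and N: "verts G = {x, y1, y2, y3, v1, v2, v3}"
    and y: "\<And>p. adjacent G y1 p \<longleftrightarrow> p = x \<or> p = v1" "\<And>p. adjacent G y2 p \<longleftrightarrow> p = x \<or> p = v2"
      "\<And>p. adjacent G y3 p \<longleftrightarrow> p = x \<or> p = v3"
    and v: "adjacent G v1 v2" "adjacent G v2 v3" "adjacent G v1 v3"
    using sh unfolding H1_shape_def by blast
  have y': "adjacent G p y1 \<longleftrightarrow> p = x \<or> p = v1" "adjacent G p y2 \<longleftrightarrow> p = x \<or> p = v2"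
    "adjacent G p y3 \<longleftrightarrow> p = x \<or> p = v3" for p
    using y adj_sym by blast+
  let ?f = "place x [y1, y2, y3] [v1, v2, v3]"
  have E: "(`) ?f ` edges H1 = {{x, y1}, {x, y2}, {x, y3}, {v1, v2}, {v2, v3}, {v1, v3},
      {y1, v1}, {y2, v2}, {y3, v3}}"
    by (simp add: H1_def numeral_eq_Suc)
  have rest: "verts G - ?f ` {X, T 1, T 2, T 3} = {v1, v2, v3}"
    unfolding N using d by (auto simp: numeral_eq_Suc)
  show ?thesis
  proof (rule exceptional_forI[OF G simple_H(2), of ?f])
    show "bij_betw ?f (verts H1) (verts G)"
      unfolding bij_betw_def N H1_def using d by (auto simp: numeral_eq_Suc)
    show "?f ` e \<in> edges G" if "e \<in> edges H1" for e
      using that y y' v unfolding adjacent_def H1_def by (auto simp: numeral_eq_Suc)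
    show "{p, q} \<in> (`) ?f ` edges H1 \<or> (\<exists>w\<in>verts G - ?f ` {X, T 1, T 2, T 3}. {p, q} = {?f X, w})"
      if pq: "adjacent G p q" for p q
    proof -
      have "p \<in> {x, y1, y2, y3, v1, v2, v3}" "q \<in> {x, y1, y2, y3, v1, v2, v3}" "p \<noteq> q"
        using adj_in[OF pq] N pq adj_irrefl by auto
      then consider "p \<in> {y1, y2, y3}" | "q \<in> {y1, y2, y3}" | "p = x" "q \<in> {v1, v2, v3}"
        | "q = x" "p \<in> {v1, v2, v3}" | "p \<in> {v1, v2, v3}" "q \<in> {v1, v2, v3}" "p \<noteq> q"
        by blast
      then show ?thesis
      proof cases
        case 1
        then have "p = y1 \<and> (q = x \<or> q = v1) \<or> p = y2 \<and> (q = x \<or> q = v2) \<or> p = y3 \<and> (q = x \<or> q = v3)"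
          using pq y by blast
        then show ?thesis unfolding E rest by (elim disjE conjE) (simp_all add: doubleton_eq_iff)
      next
        case 2
        then have "q = y1 \<and> (p = x \<or> p = v1) \<or> q = y2 \<and> (p = x \<or> p = v2) \<or> q = y3 \<and> (p = x \<or> p = v3)"
          using pq y' by blast
        then show ?thesis unfolding E rest by (elim disjE conjE) (simp_all add: doubleton_eq_iff)
      next
        case 3
        then show ?thesis unfolding rest by auto
      next
        case 4
        then show ?thesis unfolding rest by (auto simp: insert_commute)
      next
        case 5
        then show ?thesis unfolding E rest by (elim insertE emptyE) (simp_all add: doubleton_eq_iff)
      qed
    qed
  qed
qed

text \<open>The pairs \<open>v1, v3\<close> and \<open>v2, v3\<close> decide between \<open>H\<^sub>2\<close>, \<open>H\<^sub>3\<close> and \<open>H\<^sub>4\<close>. As \<open>H\<^sub>3\<close> contains the first pair,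
  the case of the second pair alone is reduced to it by exchanging \<open>v1\<close> with \<open>v2\<close> and \<open>y2\<close> with \<open>y3\<close>.\<close>

lemma kite_shape_exceptional:
  assumes G: "simple_graph G" and sh: "kite_shape (adjacent G) (verts G)"
  shows "\<exists>H\<in>{H2, H3, H4}. exceptional_for H G"
proof -
  interpret finite_graph "verts G" "adjacent G" by (rule finite_graph_adjacent[OF G])
  have core: ?thesis
    if d: "distinct [x, y1, y2, y3, v1, v2, v3, v4]"
    and N: "verts G = {x, y1, y2, y3, v1, v2, v3, v4}"
    and y: "\<And>p. adjacent G y1 p \<longleftrightarrow> p = x \<or> p = v3" "\<And>p. adjacent G y2 p \<longleftrightarrow> p = x \<or> p = v1"
      "\<And>p. adjacent G y3 p \<longleftrightarrow> p = x \<or> p = v2"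
    and v: "adjacent G v1 v2" "adjacent G v1 v4" "adjacent G v2 v4" "adjacent G v3 v4"
    and order: "adjacent G v2 v3 \<Longrightarrow> adjacent G v1 v3"
    for x y1 y2 y3 v1 v2 v3 v4
  proof -
    have y': "adjacent G p y1 \<longleftrightarrow> p = x \<or> p = v3" "adjacent G p y2 \<longleftrightarrow> p = x \<or> p = v1"
      "adjacent G p y3 \<longleftrightarrow> p = x \<or> p = v2" for p
      using y adj_sym by blast+
    let ?f = "place x [y1, y2, y3] [v1, v2, v3, v4]"
    let ?core = "{{x, y1}, {x, y2}, {x, y3}, {y1, v3}, {y2, v1}, {y3, v2},
      {v1, v2}, {v1, v4}, {v2, v4}, {v3, v4}}"
    let ?W = "{X, T 1, T 2, T 3, V 1, V 2, V 3, V 4}"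
    have bij: "bij_betw ?f ?W (verts G)"
      unfolding bij_betw_def N using d by (auto simp: numeral_eq_Suc)
    have rest: "verts G - ?f ` {X, T 1, T 2, T 3} = {v1, v2, v3, v4}"
      unfolding N using d by (auto simp: numeral_eq_Suc)
    have coreG: "?core \<subseteq> edges G" using y' y v unfolding adjacent_def by simp
    have covered: "{p, q} \<in> ?core \<or> {p, q} \<in> {{v1, v3}, {v2, v3}} \<or> (\<exists>w\<in>{v1, v2, v3, v4}. {p, q} = {x, w})"
      if pq: "adjacent G p q" for p q
    proof -
      have "p \<in> {x, y1, y2, y3, v1, v2, v3, v4}" "q \<in> {x, y1, y2, y3, v1, v2, v3, v4}" "p \<noteq> q"
        using adj_in[OF pq] N pq adj_irrefl by auto
      then consider "p \<in> {y1, y2, y3}" | "q \<in> {y1, y2, y3}" | "p = x" "q \<in> {v1, v2, v3, v4}"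
        | "q = x" "p \<in> {v1, v2, v3, v4}"
        | "p \<in> {v1, v2, v3, v4}" "q \<in> {v1, v2, v3, v4}" "p \<noteq> q"
        by blast
      then show ?thesis
      proof cases
        case 1
        then have "p = y1 \<and> (q = x \<or> q = v3) \<or> p = y2 \<and> (q = x \<or> q = v1) \<or> p = y3 \<and> (q = x \<or> q = v2)"
          using pq y by blast
        then show ?thesis by (elim disjE conjE) (simp_all add: doubleton_eq_iff)
      next
        case 2
        then have "q = y1 \<and> (p = x \<or> p = v3) \<or> q = y2 \<and> (p = x \<or> p = v1) \<or> q = y3 \<and> (p = x \<or> p = v2)"
          using pq y' by blast
        then show ?thesis by (elim disjE conjE) (simp_all add: doubleton_eq_iff)
      next
        case 3
        then show ?thesis by (intro disjI2 bexI[of _ q]) simp_all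
      next
        case 4
        then have "{p, q} = {x, p}" by auto
        then show ?thesis using 4(2) by (intro disjI2 bexI[of _ p])
      next
        case 5
        then show ?thesis by (elim insertE emptyE) (simp_all add: doubleton_eq_iff)
      qed
    qed
    have exc: "exceptional_for H G"
      if H: "simple_graph H" "verts H = ?W" and E: "(`) ?f ` edges H = ?core \<union> E"
        and EG: "E \<subseteq> edges G" and all: "{{v1, v3}, {v2, v3}} \<inter> edges G \<subseteq> E" for H E
    proof (rule exceptional_forI[OF G H(1), of ?f])
      show "bij_betw ?f (verts H) (verts G)" unfolding H(2) by (rule bij)
      show "?f ` e \<in> edges G" if "e \<in> edges H" for e
        using imageI[OF that, of "(`) ?f"] EG coreG unfolding E by blast
      show "{p, q} \<in> (`) ?f ` edges H \<or> (\<exists>w\<in>verts G - ?f ` {X, T 1, T 2, T 3}. {p, q} = {?f X, w})"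
        if pq: "adjacent G p q" for p q
      proof -
        have "{p, q} \<in> edges G" using pq unfolding adjacent_def .
        from covered[OF pq] show ?thesis
        proof (elim disjE)
          assume "{p, q} \<in> ?core"
          then show ?thesis unfolding E by (intro disjI1 UnI1)
        next
          assume "{p, q} \<in> {{v1, v3}, {v2, v3}}"
          then have "{p, q} \<in> E" using \<open>{p, q} \<in> edges G\<close> by (intro subsetD[OF all IntI])
          then show ?thesis unfolding E by (intro disjI1 UnI2)
        next
          assume "\<exists>w\<in>{v1, v2, v3, v4}. {p, q} = {x, w}"
          then show ?thesis unfolding rest place.simps by (rule disjI2)
        qed
      qed
    qed
    show ?thesis
    proof (cases "adjacent G v1 v3")
      case a13: True
      show ?thesis
      proof (cases "adjacent G v2 v3")
        case True
        have "exceptional_for H2 G"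
        proof (rule exc[OF simple_H(3), of "{{v1, v3}, {v2, v3}}"])
          show "verts H2 = ?W" by (simp add: H2_def)
          show "(`) ?f ` edges H2 = ?core \<union> {{v1, v3}, {v2, v3}}"
            by (auto simp: H2_def numeral_eq_Suc)
        qed (use a13 True in \<open>auto simp: adjacent_def\<close>)
        then show ?thesis by blast
      next
        case False
        have "exceptional_for H3 G"
        proof (rule exc[OF simple_H(4), of "{{v1, v3}}"])
          show "verts H3 = ?W" by (simp add: H3_def)
          show "(`) ?f ` edges H3 = ?core \<union> {{v1, v3}}"
            by (auto simp: H3_def numeral_eq_Suc)
        qed (use a13 False in \<open>auto simp: adjacent_def\<close>)
        then show ?thesis by blast
      qed
    next
      case False
      then have "\<not> adjacent G v2 v3" using order by blast
      have "exceptional_for H4 G"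
      proof (rule exc[OF simple_H(5), of "{}"])
        show "verts H4 = ?W" by (simp add: H4_def)
        show "(`) ?f ` edges H4 = ?core \<union> {}"
          by (auto simp: H4_def numeral_eq_Suc)
      qed (use False \<open>\<not> adjacent G v2 v3\<close> in \<open>auto simp: adjacent_def\<close>)
      then show ?thesis by blast
    qed
  qed
  obtain x y1 y2 y3 v1 v2 v3 v4 where d: "distinct [x, y1, y2, y3, v1, v2, v3, v4]"
    and N: "verts G = {x, y1, y2, y3, v1, v2, v3, v4}"
    and y: "\<And>p. adjacent G y1 p \<longleftrightarrow> p = x \<or> p = v3" "\<And>p. adjacent G y2 p \<longleftrightarrow> p = x \<or> p = v1"
      "\<And>p. adjacent G y3 p \<longleftrightarrow> p = x \<or> p = v2"
    and v: "adjacent G v1 v2" "adjacent G v1 v4" "adjacent G v2 v4" "adjacent G v3 v4"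
    using sh unfolding kite_shape_def by blast
  show ?thesis
  proof (cases "adjacent G v2 v3 \<longrightarrow> adjacent G v1 v3")
    case True
    then show ?thesis using core[OF d N y v] by blast
  next
    case False
    show ?thesis
      by (rule core[of x y1 y3 y2 v2 v1 v3 v4]) (use d N y v adj_sym[OF v(1)] False in auto)
  qed
qed

text \<open>\<open>H\<^sub>0\<close> has no vertex \<open>X\<close>, so the first argument of \<open>place\<close> is arbitrary.\<close>

lemma H0_shape_isomorphic:
  assumes G: "simple_graph G" and sh: "H0_shape (adjacent G) (verts G)"
  shows "G \<simeq> H0"
proof -
  interpret finite_graph "verts G" "adjacent G" by (rule finite_graph_adjacent[OF G])
  from sh obtain y1 y2 y3 v1 v2 v3 u1 u2 u3 where d: "distinct [y1, y2, y3, v1, v2, v3, u1, u2, u3]"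
    and N: "verts G = {y1, y2, y3, v1, v2, v3, u1, u2, u3}"
    and y: "\<forall>p. adjacent G y1 p \<longleftrightarrow> p = v1 \<or> p = u1" "\<forall>p. adjacent G y2 p \<longleftrightarrow> p = v2 \<or> p = u2"
      "\<forall>p. adjacent G y3 p \<longleftrightarrow> p = v3 \<or> p = u3"
    and v: "adjacent G v1 v2" "adjacent G v2 v3" "adjacent G v1 v3"
    and u: "adjacent G u1 u2" "adjacent G u2 u3" "adjacent G u1 u3"
    and vu: "\<forall>v\<in>{v1, v2, v3}. \<forall>u\<in>{u1, u2, u3}. \<not> adjacent G v u"
    unfolding H0_shape_def by (elim exE conjE) (rule that; assumption)
  have y': "adjacent G p y1 \<longleftrightarrow> p = v1 \<or> p = u1" "adjacent G p y2 \<longleftrightarrow> p = v2 \<or> p = u2"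
    "adjacent G p y3 \<longleftrightarrow> p = v3 \<or> p = u3" for p
    using y adj_sym by blast+
  let ?f = "place y1 [y1, y2, y3] [v1, v2, v3, u1, u2, u3]"
  let ?E = "{{v1, v2}, {v2, v3}, {v1, v3}, {u1, u2}, {u2, u3}, {u1, u3},
      {y1, v1}, {y1, u1}, {y2, v2}, {y2, u2}, {y3, v3}, {y3, u3}}"
  have E: "(`) ?f ` edges H0 = ?E"
    by (simp add: H0_def numeral_eq_Suc)
  have bij: "bij_betw ?f (verts H0) (verts G)"
    unfolding bij_betw_def N H0_def using d by (auto simp: numeral_eq_Suc)
  have covered: "{p, q} \<in> ?E" if pq: "adjacent G p q" for p q
  proof -
    have "p \<in> {y1, y2, y3, v1, v2, v3, u1, u2, u3}" "q \<in> {y1, y2, y3, v1, v2, v3, u1, u2, u3}" "p \<noteq> q"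
      using adj_in[OF pq] N pq adj_irrefl by auto
    then consider "p \<in> {y1, y2, y3}" | "q \<in> {y1, y2, y3}" | "p \<in> {v1, v2, v3}" "q \<in> {u1, u2, u3}"
      | "p \<in> {u1, u2, u3}" "q \<in> {v1, v2, v3}" | "p \<in> {v1, v2, v3}" "q \<in> {v1, v2, v3}" "p \<noteq> q"
      | "p \<in> {u1, u2, u3}" "q \<in> {u1, u2, u3}" "p \<noteq> q"
      by blast
    then show ?thesis
    proof cases
      case 1
      then have "p = y1 \<and> (q = v1 \<or> q = u1) \<or> p = y2 \<and> (q = v2 \<or> q = u2) \<or> p = y3 \<and> (q = v3 \<or> q = u3)"
        using pq y by blast
      then show ?thesis by (elim disjE conjE) (simp_all add: doubleton_eq_iff)
    next
      case 2
      then have "q = y1 \<and> (p = v1 \<or> p = u1) \<or> q = y2 \<and> (p = v2 \<or> p = u2) \<or> q = y3 \<and> (p = v3 \<or> p = u3)"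
        using pq y' by blast
      then show ?thesis by (elim disjE conjE) (simp_all add: doubleton_eq_iff)
    next
      case 3
      show ?thesis using bspec[OF bspec[OF vu 3(1)] 3(2)] pq by (rule notE)
    next
      case 4
      show ?thesis using bspec[OF bspec[OF vu 4(2)] 4(1)] adj_sym[OF pq] by (rule notE)
    next
      case 5
      then show ?thesis by (elim insertE emptyE) (simp_all add: doubleton_eq_iff)
    next
      case 6
      then show ?thesis by (elim insertE emptyE) (simp_all add: doubleton_eq_iff)
    qed
  qed
  have GE: "edges G = ?E"
  proof
    show "?E \<subseteq> edges G" using y v u unfolding adjacent_def by simp
    show "edges G \<subseteq> ?E"
    proof
      fix e assume e: "e \<in> edges G"
      then have "card e = 2" using G unfolding simple_graph_def by blast
      then obtain p q where pq: "e = {p, q}" by (meson card_2_iff)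
      have "adjacent G p q" using e unfolding pq adjacent_def .
      then show "e \<in> ?E" unfolding pq by (rule covered)
    qed
  qed
  have "graph_isomorphism ?f H0 G"
    using graph_isomorphism_image[OF simple_H(1) bij]
    unfolding E GE[symmetric] graph_isomorphism_def graph.select_convs .
  then have "H0 \<simeq> G" unfolding isomorphic_def by blast
  then show ?thesis by (rule isomorphic_sym)
qed

section \<open>Toughness, linear forests on five vertices and 2-factors\<close>

theorem theorem1:
  fixes t :: real and R :: "'r graph" and G :: "'a graph"
  assumes "t > 0"
    and "linear_forest R" and "card (verts R) = 5"
    and "simple_graph G" and "card (verts G) \<ge> 3"
    and "tough t G" and "induced_free R G"
    and "((R \<simeq> disjoint_union [path_graph 4, path_graph 1] \<or>
           R \<simeq> disjoint_union (path_graph 3 # replicate 2 (path_graph 1)) \<or>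
           R \<simeq> disjoint_union (path_graph 2 # replicate 3 (path_graph 1))) \<and>
          t = 1 \<and>
          \<not> ((R \<simeq> disjoint_union (path_graph 2 # replicate 3 (path_graph 1)) \<and>
              (G \<simeq> H0 \<or> (\<exists>H \<in> {H1, H2, H3, H4}. exceptional_for H G))) \<or>
             (R \<simeq> disjoint_union (path_graph 3 # replicate 2 (path_graph 1)) \<and>
              exceptional_for H1 G)))
       \<or> (R \<simeq> disjoint_union (replicate 5 (path_graph 1)) \<and> t > 1)
       \<or> ((R \<simeq> path_graph 5 \<or>
           R \<simeq> disjoint_union [path_graph 3, path_graph 2] \<or>
           R \<simeq> disjoint_union (replicate 2 (path_graph 2) @ [path_graph 1])) \<and>
          t = 3 / 2)"
  shows "has_two_factor G"
proof (rule ccontr)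
  assume no: "\<not> has_two_factor G"
  let ?N = "verts G" and ?adj = "adjacent G"
  note G = assms(4) and free = assms(7)
  have t1: "t \<ge> 1" using assms(8) by linarith
  interpret finite_graph ?N ?adj by (rule finite_graph_adjacent[OF G])
  have "tough_graph ?N ?adj t"
  proof
    show "1 \<le> t" by (rule t1)
    show "3 \<le> card ?N" by (rule assms(5))
    show "t * card \<D> \<le> card W"
      if "W \<subseteq> ?N" "\<And>D. D \<in> \<D> \<Longrightarrow> closed_in ?adj (?N - W) D" "\<And>D. D \<in> \<D> \<Longrightarrow> D \<noteq> {}"
        "pairwise disjnt \<D>" "2 \<le> card \<D>" for W \<D>
      by (rule tough_closed_family[OF G assms(6) _ that]) (use t1 in auto)
  qed
  then interpret tough_graph ?N ?adj t .
  have "\<exists>w. ?adj v w" if "v \<in> ?N" for v using second_neighbour[OF that] by metis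
  then have "\<exists>S R. tutte_barrier ?N ?adj S R"
    using two_factor_or_barrier has_two_factor_of_relation[OF G] no by metis
  then obtain S R' where "tutte_barrier ?N ?adj S R'" by blast
  then interpret tough_barrier ?N ?adj t S R'
    using \<open>tough_graph ?N ?adj t\<close> by (simp add: tough_barrier_def)
  from assms(8) show False
  proof (elim disjE conjE)
    assume "R \<simeq> disjoint_union [path_graph 4, path_graph 1]"
    then show False using no_pattern_P4_P1[OF G free] pattern_P4_P1 by blast
  next
    assume R: "R \<simeq> disjoint_union (path_graph 3 # replicate 2 (path_graph 1))"
      and ex: "\<not> ((R \<simeq> disjoint_union (path_graph 2 # replicate 3 (path_graph 1)) \<and>
              (G \<simeq> H0 \<or> (\<exists>H \<in> {H1, H2, H3, H4}. exceptional_for H G))) \<or>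
             (R \<simeq> disjoint_union (path_graph 3 # replicate 2 (path_graph 1)) \<and>
              exceptional_for H1 G))"
    have "H1_shape ?adj ?N" using no_pattern_P3_2P1[OF G free R] pattern_P3_2P1 by blast
    then show False using H1_shape_exceptional[OF G] R ex by blast
  next
    assume R: "R \<simeq> disjoint_union (path_graph 2 # replicate 3 (path_graph 1))"
      and ex: "\<not> ((R \<simeq> disjoint_union (path_graph 2 # replicate 3 (path_graph 1)) \<and>
              (G \<simeq> H0 \<or> (\<exists>H \<in> {H1, H2, H3, H4}. exceptional_for H G))) \<or>
             (R \<simeq> disjoint_union (path_graph 3 # replicate 2 (path_graph 1)) \<and>
              exceptional_for H1 G))"
    interpret pattern_free_barrier ?N ?adj t S R'
      by unfold_locales (rule no_pattern_P2_3P1[OF G free R])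
    show False
      using exceptional_shape H0_shape_isomorphic[OF G] H1_shape_exceptional[OF G]
        kite_shape_exceptional[OF G] R ex by blast
  next
    assume "R \<simeq> disjoint_union (replicate 5 (path_graph 1))" "t > 1"
    then show False using no_pattern_5P1[OF G free] pattern_5P1 by blast
  next
    assume "R \<simeq> path_graph 5" "t = 3 / 2"
    then show False using no_pattern_P5[OF G free] pattern_P5 by blast
  next
    assume "R \<simeq> disjoint_union [path_graph 3, path_graph 2]" "t = 3 / 2"
    then show False using no_pattern_P3_P2[OF G free] pattern_P3_P2 by blast
  next
    assume "R \<simeq> disjoint_union (replicate 2 (path_graph 2) @ [path_graph 1])" "t = 3 / 2"
    then show False using no_pattern_2P2_P1[OF G free] pattern_2P2_P1 by blast
  qed
qed

end
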